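(* Let $\hat\alpha_i^m$ be the empirical allocation generated by the $\mathcal{OCBA}^{\mathcal U}$ algorithm, and let $\boldsymbol\alpha^*$ be the unique optimal allocation (both defined in the context). There is a (small) constant $\bar\varepsilon>0$ such that for any $\varepsilon$ with $0<\varepsilon<\bar\varepsilon$, almost surely, the following holds: given a finite random time $M(\varepsilon)$ such that $\max_{i,j\ne i^*}|\hat{\mathcal W}_i^m-\hat{\mathcal W}_j^m|\le\varepsilon$ for all $m\ge M(\varepsilon)$, there exists a random time $M'(\varepsilon)$ with $M(\varepsilon)\le M'(\varepsilon)<\infty$ such that $$\max_{i=1,\dots,k}|\hat\alpha_i^m-\alpha_i^*|\le\varepsilon\qquad\text{for all } m\ge M'(\varepsilon).$$
   Context: Setting: $k\ge2$ designs with fixed true means $\mu_i\in\mathbb R$ and variances $\sigma_i^2>0$; observations $X_{i,l}\sim\mathcal N(\mu_i,\sigma_i^2)$ independent across all $i,l$; the best design $i^*=\arg\max_i\mu_i$ is unique. Prior: a probability density $\pi(\boldsymbol\phi,\boldsymbol\psi)$ on $\mathbb R^k\times\mathbb R_+^k$ (means $\boldsymbol\phi$, variances $\boldsymbol\psi$) that is bounded above by a constant, uniformly continuous, and bounded below by a constant $\underline c>0$ on $H_w=[\mu_{\min}-\bar\epsilon,\mu_{\max}+\bar\epsilon]^k\times[\sigma_{\min}^2-\bar\epsilon,\sigma_{\max}^2+\bar\epsilon+(\mu_{\max}-\mu_{\min}+2\bar\epsilon)^2]^k$ for some $0<\bar\epsilon<\sigma_{\min}^2/2$, where min/max are over the true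 means and variances. Algorithm $\mathcal{OCBA}^{\mathcal U}$ (run indefinitely): at $m=0$ each design has been sampled $n_0\ge6$ times. After iteration $m$, design $i$ has received $N_i^m$ samples in total, $N^m=\sum_iN_i^m$, $\hat\alpha_i^m=N_i^m/N^m$. The posterior $\pi^m$ is the normalization of $\pi(\boldsymbol\phi,\boldsymbol\psi)\prod_i\prod_{l=1}^{N_i^m}f(X_{i,l}\mid\phi_i,\psi_i)$, with $f(\cdot\mid\phi_i,\psi_i)$ the normal density with mean $\phi_i$ and variance $\psi_i$; $\hat\mu_i^m$ and $(\hat\sigma_i^m)^2$ are the expectations of $\phi_i$ and $\psi_i$ under $\pi^m$. Let $i^{*,m}\in\arg\max_i\hat\mu_i^m$; if the argmax is not unique, $i^{*,m}$ is an element of it with the fewest samples so far. Define $$\hat{\mathcal V}_i^m=\min_{\phi}\left(\tfrac{\hat\alpha_i^m}{2}\log\left(1+\tfrac{(\hat\mu_i^m-\phi)^2}{(\hat\sigma_i^m)^2}\right)+\tfrac{\hat\alpha_{i^{*,m}}^m}{2}\log\left(1+\tfrac{(\hat\mu_{i^{*,m}}^m-\phi)^2}{(\hat\sigma_{i^{*,m}}^m)^2}\right)\right),$$ with $\hat\phi_i^m$ the smallest minimizer, $\hat{\mathcal W}_i^m=\frac{2}{\hat\alpha^m_{i^{*,m}}}\hat{\mathcal V}_i^m$, and $$\hat{\mathcal U}_i^m=\log\left(1+\tfrac{(\hat\mu_i^m-\hat\phi_i^m)^2}{(\hat\sigma_i^m)^2}\right),\quad \hat{\mathcal U}_i^{*,m}=\log\left(1+\tfrac{(\hat\mu_{i^{*,m}}^m-\hat\phi_i^m)^2}{(\hat\sigma_{i^{*,m}}^m)^2}\right).$$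 At iteration $m\ge1$ the algorithm takes one more sample of design $i^m$, chosen as follows. (1) If $\arg\max_i\hat\mu_i^{m-1}$ is not unique, $i^m=i^{*,m-1}$. (2) Otherwise let $j^{m-1}\in\arg\min_{i\ne i^{*,m-1}}\hat{\mathcal V}_i^{m-1}$ (ties broken arbitrarily); if $\sum_{i\ne i^{*,m-1}}\hat{\mathcal U}_i^{*,m-1}/\hat{\mathcal U}_i^{m-1}>1$, set $i^m=i^{*,m-1}$; else set $i^m=j^{m-1}$. Then the posterior is updated. Optimal allocation: $\boldsymbol\alpha^*$ is the unique maximizer of $\min_{i\ne i^*}\mathcal V_i(\alpha_i,\alpha_{i^*})$ over $\{\boldsymbol\alpha\ge0,\sum_i\alpha_i=1\}$, where $$\mathcal V_i(\alpha_i,\alpha_{i^*})=\min_{\phi}\left(\tfrac{\alpha_i}{2}\log\left(1+\tfrac{(\mu_i-\phi)^2}{\sigma_i^2}\right)+\tfrac{\alpha_{i^*}}{2}\log\left(1+\tfrac{(\mu_{i^*}-\phi)^2}{\sigma_{i^*}^2}\right)\right).$$ It is a known property of the algorithm that, for all sufficiently small $\varepsilon>0$, an almost surely finite random time $M(\varepsilon)$ as in the claim exists. Random constants such as $\bar\varepsilon$ may depend on the sample path. *)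

theory Defs
  imports "HOL-Probability.Probability"
begin

text \<open>
  The designs are the elements of a finite type \<open>'k\<close>. A parameter vector is a pair
  \<open>(\<phi>, \<psi>)\<close> of means and variances; all variances below are variances, not standard deviations.
\<close>

type_synonym 'k params = "(real ^ 'k) \<times> (real ^ 'k)"

definition param_space :: "'k::finite params set" where
  "param_space = {(\<phi>, \<psi>). \<forall>i. 0 < \<psi> $ i}"

definition prior_core :: "('k::finite \<Rightarrow> real) \<Rightarrow> ('k \<Rightarrow> real) \<Rightarrow> real \<Rightarrow> 'k params set" where
  "prior_core \<mu> v e =
    (let \<mu>min = Min (range \<mu>); \<mu>max = Max (range \<mu>); vmin = Min (range v); vmax = Max (range v)
     in {(\<phi>, \<psi>). \<forall>i. \<phi> $ i \<in> {\<mu>min - e .. \<mu>max + e} \<and>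
           \<psi> $ i \<in> {vmin - e .. vmax + e + (\<mu>max - \<mu>min + 2 * e)\<^sup>2}})"

definition admissible_prior ::
  "('k::finite \<Rightarrow> real) \<Rightarrow> ('k \<Rightarrow> real) \<Rightarrow> ('k params \<Rightarrow> real) \<Rightarrow> bool" where
  "admissible_prior \<mu> v prior \<longleftrightarrow>
     (\<forall>z\<in>param_space. 0 \<le> prior z) \<and>
     set_integrable lborel param_space prior \<and>
     (LINT z:param_space|lborel. prior z) = 1 \<and>
     (\<exists>C. \<forall>z\<in>param_space. prior z \<le> C) \<and>
     uniformly_continuous_on param_space prior \<and>
     (\<exists>e c. 0 < e \<and> e < Min (range v) / 2 \<and> 0 < c \<and> (\<forall>z\<in>prior_core \<mu> v e. c \<le> prior z))"

subsection \<open>Posterior\<close>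

text \<open>\<open>n i\<close> is the number of samples of design \<open>i\<close>; they are \<open>x i 0, \<dots>, x i (n i - 1)\<close>.\<close>

definition posterior_weight ::
  "('k::finite params \<Rightarrow> real) \<Rightarrow> ('k \<Rightarrow> nat) \<Rightarrow> ('k \<Rightarrow> nat \<Rightarrow> real) \<Rightarrow> 'k params \<Rightarrow> real" where
  "posterior_weight prior n x z =
     prior z * (\<Prod>i\<in>UNIV. \<Prod>l<n i. normal_density (fst z $ i) (sqrt (snd z $ i)) (x i l))"

definition posterior_density ::
  "('k::finite params \<Rightarrow> real) \<Rightarrow> ('k \<Rightarrow> nat) \<Rightarrow> ('k \<Rightarrow> nat \<Rightarrow> real) \<Rightarrow> 'k params \<Rightarrow> real" where
  "posterior_density prior n x z =
     posterior_weight prior n x z / (LINT z':param_space|lborel. posterior_weight prior n x z')"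

definition mean_hat ::
  "('k::finite params \<Rightarrow> real) \<Rightarrow> ('k \<Rightarrow> nat) \<Rightarrow> ('k \<Rightarrow> nat \<Rightarrow> real) \<Rightarrow> 'k \<Rightarrow> real" where
  "mean_hat prior n x i = (LINT z:param_space|lborel. fst z $ i * posterior_density prior n x z)"

definition var_hat ::
  "('k::finite params \<Rightarrow> real) \<Rightarrow> ('k \<Rightarrow> nat) \<Rightarrow> ('k \<Rightarrow> nat \<Rightarrow> real) \<Rightarrow> 'k \<Rightarrow> real" where
  "var_hat prior n x i = (LINT z:param_space|lborel. snd z $ i * posterior_density prior n x z)"

subsection \<open>Rate functions and the optimal allocation\<close>

text \<open>
  In this part \<open>\<mu>\<close>, \<open>v\<close> and \<open>a\<close> (means, variances, allocation) are either the true or the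
  estimated ones, and \<open>b\<close> is the corresponding best design.
\<close>

definition rate_obj ::
  "('k \<Rightarrow> real) \<Rightarrow> ('k \<Rightarrow> real) \<Rightarrow> ('k \<Rightarrow> real) \<Rightarrow> 'k \<Rightarrow> 'k \<Rightarrow> real \<Rightarrow> real" where
  "rate_obj \<mu> v a b i \<phi> =
     a i / 2 * ln (1 + (\<mu> i - \<phi>)\<^sup>2 / v i) + a b / 2 * ln (1 + (\<mu> b - \<phi>)\<^sup>2 / v b)"

text \<open>
  The infimum is a minimum: for \<open>v > 0\<close> and \<open>a \<ge> 0\<close> the objective is continuous and is either
  constant or tends to infinity at both ends.
\<close>

definition rate_V ::
  "('k \<Rightarrow> real) \<Rightarrow> ('k \<Rightarrow> real) \<Rightarrow> ('k \<Rightarrow> real) \<Rightarrow> 'k \<Rightarrow> 'k \<Rightarrow> real" where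
  "rate_V \<mu> v a b i = (INF \<phi>. rate_obj \<mu> v a b i \<phi>)"

definition rate_argmin ::
  "('k \<Rightarrow> real) \<Rightarrow> ('k \<Rightarrow> real) \<Rightarrow> ('k \<Rightarrow> real) \<Rightarrow> 'k \<Rightarrow> 'k \<Rightarrow> real" where
  "rate_argmin \<mu> v a b i =
     (LEAST \<phi>. \<forall>\<phi>'. rate_obj \<mu> v a b i \<phi> \<le> rate_obj \<mu> v a b i \<phi>')"

definition rate_W ::
  "('k \<Rightarrow> real) \<Rightarrow> ('k \<Rightarrow> real) \<Rightarrow> ('k \<Rightarrow> real) \<Rightarrow> 'k \<Rightarrow> 'k \<Rightarrow> real" where
  "rate_W \<mu> v a b i = 2 / a b * rate_V \<mu> v a b i"

definition rate_U ::
  "('k \<Rightarrow> real) \<Rightarrow> ('k \<Rightarrow> real) \<Rightarrow> ('k \<Rightarrow> real) \<Rightarrow> 'k \<Rightarrow> 'k \<Rightarrow> real" where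
  "rate_U \<mu> v a b i = ln (1 + (\<mu> i - rate_argmin \<mu> v a b i)\<^sup>2 / v i)"

definition rate_Ustar ::
  "('k \<Rightarrow> real) \<Rightarrow> ('k \<Rightarrow> real) \<Rightarrow> ('k \<Rightarrow> real) \<Rightarrow> 'k \<Rightarrow> 'k \<Rightarrow> real" where
  "rate_Ustar \<mu> v a b i = ln (1 + (\<mu> b - rate_argmin \<mu> v a b i)\<^sup>2 / v b)"

definition allocations :: "('k::finite \<Rightarrow> real) set" where
  "allocations = {a. (\<forall>i. 0 \<le> a i) \<and> (\<Sum>i\<in>UNIV. a i) = 1}"

definition min_rate ::
  "('k::finite \<Rightarrow> real) \<Rightarrow> ('k \<Rightarrow> real) \<Rightarrow> 'k \<Rightarrow> ('k \<Rightarrow> real) \<Rightarrow> real" where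
  "min_rate \<mu> v b a = Min ((\<lambda>i. rate_V \<mu> v a b i) ` (UNIV - {b}))"

definition unique_optimal_allocation ::
  "('k::finite \<Rightarrow> real) \<Rightarrow> ('k \<Rightarrow> real) \<Rightarrow> 'k \<Rightarrow> ('k \<Rightarrow> real) \<Rightarrow> bool" where
  "unique_optimal_allocation \<mu> v b a \<longleftrightarrow>
     a \<in> allocations \<and> (\<forall>a'\<in>allocations. a' \<noteq> a \<longrightarrow> min_rate \<mu> v b a' < min_rate \<mu> v b a)"

subsection \<open>The algorithm, along one sample path\<close>

text \<open>
  \<open>x i l\<close> is the observation number \<open>l\<close> (from 0) of design \<open>i\<close>, \<open>I m\<close> the design sampled at
  iteration \<open>m \<ge> 1\<close> (the value \<open>I 0\<close> is irrelevant), and \<open>B m\<close> the estimated best design after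
  iteration \<open>m\<close>.
\<close>

definition num_samples :: "nat \<Rightarrow> (nat \<Rightarrow> 'k) \<Rightarrow> nat \<Rightarrow> 'k \<Rightarrow> nat" where
  "num_samples n0 I m i = n0 + card {t \<in> {1..m}. I t = i}"

definition alloc_hat :: "nat \<Rightarrow> (nat \<Rightarrow> 'k::finite) \<Rightarrow> nat \<Rightarrow> 'k \<Rightarrow> real" where
  "alloc_hat n0 I m i = real (num_samples n0 I m i) / real (\<Sum>j\<in>UNIV. num_samples n0 I m j)"

text \<open>
  All choices left open by the algorithm (ties) are covered by the relation being
  non-functional: \<open>I\<close> and \<open>B\<close> may be any sequences satisfying it. If the argmax \<open>A\<close> is a
  singleton, the condition on sample numbers is void.
\<close>

definition OCBA_U_run ::
  "('k::finite params \<Rightarrow> real) \<Rightarrow> nat \<Rightarrow> ('k \<Rightarrow> nat \<Rightarrow> real) \<Rightarrow> (nat \<Rightarrow> 'k) \<Rightarrow> (nat \<Rightarrow> 'k) \<Rightarrow> bool"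
where
  "OCBA_U_run prior n0 x I B \<longleftrightarrow>
     (\<forall>m. let n = num_samples n0 I m; \<mu> = mean_hat prior n x; v = var_hat prior n x;
              a = alloc_hat n0 I m; b = B m; A = {i. \<forall>j. \<mu> j \<le> \<mu> i}
          in b \<in> A \<and> (\<forall>i\<in>A. n b \<le> n i) \<and>
             (if card A \<noteq> 1 then I (Suc m) = b
              else if (\<Sum>i\<in>UNIV - {b}. rate_Ustar \<mu> v a b i / rate_U \<mu> v a b i) > 1
              then I (Suc m) = b
              else I (Suc m) \<noteq> b \<and>
                   (\<forall>i. i \<noteq> b \<longrightarrow> rate_V \<mu> v a b (I (Suc m)) \<le> rate_V \<mu> v a b i)))"

definition W_hat ::
  "('k::finite params \<Rightarrow> real) \<Rightarrow> nat \<Rightarrow> ('k \<Rightarrow> nat \<Rightarrow> real) \<Rightarrow> (nat \<Rightarrow> 'k) \<Rightarrow> (nat \<Rightarrow> 'k) \<Rightarrow>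
   nat \<Rightarrow> 'k \<Rightarrow> real" where
  "W_hat prior n0 x I B m i =
     (let n = num_samples n0 I m
      in rate_W (mean_hat prior n x) (var_hat prior n x) (alloc_hat n0 I m) (B m) i)"

end

theory Submission
  imports Defs
begin

text \<open>
  If the gaps between the \<open>W\<close>-values do not tend to 0, the hypothesis fails for every small \<open>\<epsilon>\<close>; so
  it suffices to show, on almost every path on which they do, that the allocation converges to the
  optimum. There is no need to compare \<open>\<epsilon>\<close> with the resulting distance of the allocations.

  The posterior is dominated by a constant times a product of normal/inverse-gamma posteriors of
  flat priors. Hence the estimates of a design with \<open>n\<close> samples are within \<open>O(n\<^sup>-\<^sup>1\<^sup>/\<^sup>2)\<close> of the
  sample mean and consistent, and they stay bounded for a design with few samples.

  Suppose some designs are sampled only finitely often. Comparing rates shows that the designs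
  sampled infinitely often share the same mean and that a non-best one among them is sampled only
  if its estimated mean is within \<open>O(n\<^sup>-\<^sup>1\<^sup>/\<^sup>2)\<close> of the best. Almost surely there are arbitrarily
  large scales \<open>N\<close> at which all sample means, for all sample sizes between \<open>N\<close> and \<open>L N\<close>, are
  separated on a much larger multiple of \<open>N\<^sup>-\<^sup>1\<^sup>/\<^sup>2\<close>. Since the best design is sampled only while
  its sample size is at most a constant times another one, no sample size can grow beyond such a
  scale.

  If all designs are sampled infinitely often, let \<open>\<alpha>\<close> be a limit point of the allocation, reached
  along times at which the sum \<open>G\<close> of the ratios \<open>U\<^sup>*/U\<close> is always \<open>> 1\<close> or always \<open>\<le> 1\<close>. The
  rates at \<open>\<alpha>\<close> are all equal, and the weights \<open>1/U\<close> bound the minimal rate of any allocation by a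
  function of the share of the best design alone, increasing or decreasing according to the sign of
  \<open>G - 1\<close>. So the share of the best design drifts towards its optimal value, and then every limit
  point is optimal. Equal rates may be attained at several minimisers, and \<open>G\<close> may jump there;
  this argument does not need \<open>G \<longlonglongrightarrow> 1\<close>.
\<close>

section \<open>Rate functions\<close>

text \<open>The means of the non-best designs may coincide. While one design starves, the smallest
  rate times the total sample size stays bounded, so a design other than the best is sampled only if
  estimated means tie up to the inverse square root of a sample size. This is just the scale of the
  noise in sample means, and no law of large numbers forbids such ties. Excursions break them: the
  amplitudes \<open>K ^ Suc (rank i)\<close> separate all designs at once, because the set of
  starved designs is known only along the path, and they are available for all \<open>L\<close> and
  all large \<open>K\<close>, because the constants of the comparison also come from the path. The
  bound \<open>6 \<le> n0\<close> makes the posterior mean of the variance finite under a flat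
  prior: the marginal is inverse gamma of shape \<open>(n - 3) / 2\<close>, which has to exceed 1.
  The weights \<open>1 / U\<close> come from concavity: a rate is a minimum over
  \<open>\<phi>\<close> of functions linear in the allocation, each minimiser gives a supporting
  linear function, and \<open>1 / U\<close> gives all non-best shares the same coefficient.\<close>

lemma rate_obj_has_derivative:
  assumes "v i > 0" "v b > 0"
  shows "(rate_obj \<mu> v a b i has_real_derivative
           a i * (p - \<mu> i) / (v i + (p - \<mu> i)\<^sup>2) - a b * (\<mu> b - p) / (v b + (\<mu> b - p)\<^sup>2)) (at p)"
proof -
  have pos: "v i + (p - \<mu> i)\<^sup>2 > 0" "v b + (\<mu> b - p)\<^sup>2 > 0"
    using assms by (simp_all add: add_pos_nonneg)
  have D: "((\<lambda>\<phi>. ln (1 + (\<mu> j - \<phi>)\<^sup>2 / v j)) has_real_derivative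
           - (2 * (\<mu> j - p)) / (v j + (\<mu> j - p)\<^sup>2)) (at p)" if "v j > 0" for j
  proof -
    have "1 + (\<mu> j - p)\<^sup>2 / v j > 0" using that by (simp add: add_pos_nonneg)
    moreover have "v j + (\<mu> j - p)\<^sup>2 > 0" using that by (simp add: add_pos_nonneg)
    ultimately show ?thesis using that
      by (auto intro!: derivative_eq_intros simp: divide_simps)
  qed
  have "(rate_obj \<mu> v a b i has_real_derivative
      a i / 2 * (- (2 * (\<mu> i - p)) / (v i + (\<mu> i - p)\<^sup>2)) + a b / 2 * (- (2 * (\<mu> b - p)) / (v b + (\<mu> b - p)\<^sup>2))) (at p)"
    unfolding rate_obj_def by (intro DERIV_add DERIV_cmult D assms)
  moreover have "a i / 2 * (- (2 * (\<mu> i - p)) / (v i + (\<mu> i - p)\<^sup>2)) + a b / 2 * (- (2 * (\<mu> b - p)) / (v b + (\<mu> b - p)\<^sup>2))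
    = a i * (p - \<mu> i) / (v i + (p - \<mu> i)\<^sup>2) - a b * (\<mu> b - p) / (v b + (\<mu> b - p)\<^sup>2)"
    by (simp add: power2_commute[of p] right_diff_distrib minus_divide_left algebra_simps flip: add_divide_distrib diff_divide_distrib)
  ultimately show ?thesis by simp
qed

lemma rate_obj_first_order:
  assumes "v i > 0" "v b > 0" "\<And>\<phi>. rate_obj \<mu> v a b i p \<le> rate_obj \<mu> v a b i \<phi>"
  shows "a i * (p - \<mu> i) / (v i + (p - \<mu> i)\<^sup>2) = a b * (\<mu> b - p) / (v b + (\<mu> b - p)\<^sup>2)"
  using DERIV_local_min[OF rate_obj_has_derivative[of v i b \<mu> a p], of 1] assms by auto

text \<open>At \<open>p = \<mu> i\<close> the derivative consists of the nonzero term of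
  \<open>b\<close> alone. This keeps the logarithm \<open>U\<close> positive, also for limit
  allocations once the share of \<open>b\<close> is known to be positive.\<close>

lemma rate_minimizer_neq_mean:
  assumes "v i > 0" "v b > 0" "a b > 0" "\<mu> i \<noteq> \<mu> b"
    and "\<And>\<phi>. rate_obj \<mu> v a b i p \<le> rate_obj \<mu> v a b i \<phi>"
  shows "p \<noteq> \<mu> i"
proof
  assume "p = \<mu> i"
  with rate_obj_first_order[OF assms(1,2,5)] have "a b * (\<mu> b - \<mu> i) / (v b + (\<mu> b - \<mu> i)\<^sup>2) = 0"
    by simp
  moreover have "v b + (\<mu> b - \<mu> i)\<^sup>2 > 0" using assms by (simp add: add_pos_nonneg)
  ultimately show False using assms by simp
qed

lemma rate_obj_nonneg:
  assumes "v i > 0" "v b > 0" "a i \<ge> 0" "a b \<ge> 0"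
  shows "0 \<le> rate_obj \<mu> v a b i \<phi>"
  using assms by (auto simp: rate_obj_def intro!: add_nonneg_nonneg mult_nonneg_nonneg ln_ge_zero)

lemma rate_V_le:
  assumes "v i > 0" "v b > 0" "a i \<ge> 0" "a b \<ge> 0"
  shows "rate_V \<mu> v a b i \<le> rate_obj \<mu> v a b i \<phi>"
  unfolding rate_V_def
  by (rule cINF_lower) (auto intro!: bdd_belowI[of _ 0] rate_obj_nonneg assms)

lemma rate_V_nonneg:
  assumes "v i > 0" "v b > 0" "a i \<ge> 0" "a b \<ge> 0"
  shows "0 \<le> rate_V \<mu> v a b i"
  unfolding rate_V_def by (rule cINF_greatest) (auto intro!: rate_obj_nonneg assms)

lemma rate_V_eq_minimum:
  assumes "\<And>\<phi>. rate_obj \<mu> v a b i p \<le> rate_obj \<mu> v a b i \<phi>"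
  shows "rate_V \<mu> v a b i = rate_obj \<mu> v a b i p"
  unfolding rate_V_def by (rule cInf_eq_minimum) (use assms in auto)

text \<open>A least element over the reals need not exist, so \<open>rate_argmin\<close> has to be
  justified. From outside \<open>{\<mu> i..\<mu> b}\<close>, moving to the nearer endpoint lowers
  the objective; hence all minimisers lie in this compact interval, and their closed set attains its
  infimum.\<close>

lemma rate_argmin_minimizes:
  assumes v: "v i > 0" "v b > 0" and a: "a i > 0" "a b > 0" and le: "\<mu> i \<le> \<mu> b"
  shows "rate_obj \<mu> v a b i (rate_argmin \<mu> v a b i) \<le> rate_obj \<mu> v a b i \<phi>"
    and "\<mu> i \<le> rate_argmin \<mu> v a b i" and "rate_argmin \<mu> v a b i \<le> \<mu> b"
proof -
  let ?f = "rate_obj \<mu> v a b i"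
  have mono: "?f x < ?f y" if "(\<mu> i - x)\<^sup>2 < (\<mu> i - y)\<^sup>2" "(\<mu> b - x)\<^sup>2 < (\<mu> b - y)\<^sup>2" for x y
  proof -
    have "ln (1 + (\<mu> j - x)\<^sup>2 / v j) < ln (1 + (\<mu> j - y)\<^sup>2 / v j)"
      if "(\<mu> j - x)\<^sup>2 < (\<mu> j - y)\<^sup>2" "v j > 0" for j
    proof -
      have "(\<mu> j - x)\<^sup>2 / v j < (\<mu> j - y)\<^sup>2 / v j" using that by (intro divide_strict_right_mono)
      moreover have "1 + (\<mu> j - x)\<^sup>2 / v j > 0" using that by (simp add: add_pos_nonneg)
      ultimately show ?thesis by (subst ln_less_cancel_iff) auto
    qed
    then show ?thesis unfolding rate_obj_def using a v that
      by (intro add_strict_mono mult_strict_left_mono) auto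
  qed
  have left: "?f (\<mu> i) < ?f y" if "y < \<mu> i" for y
    using that le by (intro mono power_strict_mono) (auto intro!: power2_strict_mono)
  have right: "?f (\<mu> b) < ?f y" if "y > \<mu> b" for y
    using that le by (intro mono) (auto intro!: power2_strict_mono)
  have cont: "continuous_on S ?f" for S
    by (intro continuous_at_imp_continuous_on ballI DERIV_isCont[OF rate_obj_has_derivative[of v i b, OF v]])
  obtain p where p: "p \<in> {\<mu> i..\<mu> b}" "\<And>y. y \<in> {\<mu> i..\<mu> b} \<Longrightarrow> ?f p \<le> ?f y"
    using continuous_attains_inf[OF _ _ cont, of "{\<mu> i..\<mu> b}"] le by auto
  have pmin: "?f p \<le> ?f y" for y
    using p(2)[of y] p(2)[of "\<mu> i"] p(2)[of "\<mu> b"] left[of y] right[of y] le by fastforce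
  let ?S = "{x \<in> {\<mu> i..\<mu> b}. ?f x = ?f p}"
  have "closed ?S"
    using continuous_closed_preimage_constant[OF cont, of "{\<mu> i..\<mu> b}" "?f p"]
    by (simp add: Collect_conj_eq)
  then have "compact ?S"
    by (auto simp: compact_eq_bounded_closed intro: bounded_subset[OF bounded_closed_interval[of "\<mu> i" "\<mu> b"]])
  moreover have "?S \<noteq> {}" using p by auto
  ultimately obtain q where q: "q \<in> ?S" "\<And>y. y \<in> ?S \<Longrightarrow> q \<le> y"
    using compact_attains_inf[of ?S] by blast
  have "rate_argmin \<mu> v a b i = q"
    unfolding rate_argmin_def
  proof (rule Least_equality)
    show "\<forall>\<phi>'. ?f q \<le> ?f \<phi>'" using q pmin by simp
    fix y assume y: "\<forall>\<phi>'. ?f y \<le> ?f \<phi>'"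
    then have "?f y = ?f p" using pmin[of y] by (simp add: order_antisym)
    moreover have "y \<in> {\<mu> i..\<mu> b}" using y left[of y] right[of y] by (auto simp: not_less[symmetric])
    ultimately show "q \<le> y" using q by auto
  qed
  with q pmin show "?f (rate_argmin \<mu> v a b i) \<le> ?f \<phi>" "\<mu> i \<le> rate_argmin \<mu> v a b i" "rate_argmin \<mu> v a b i \<le> \<mu> b"
    by auto
qed

text \<open>From \<open>ln t \<le> t - 1\<close> at the reciprocal, and from
  \<open>ln (1 + u) \<le> u\<close>. Logarithms are thereby exchanged for squares at the price of
  the constants \<open>lo\<close> and \<open>H\<close>.\<close>

lemma ln_one_plus_bounds:
  fixes x w H :: real
  assumes "0 < lo" "lo \<le> w" "w + x\<^sup>2 \<le> H"
  shows "x\<^sup>2 / H \<le> ln (1 + x\<^sup>2 / w)" and "ln (1 + x\<^sup>2 / w) \<le> x\<^sup>2 / lo"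
proof -
  have w: "w > 0" using assms by simp
  have pos: "w + x\<^sup>2 > 0" using w by (simp add: add_pos_nonneg)
  let ?t = "1 + x\<^sup>2 / w"
  have t: "?t > 0" using w by (simp add: add_pos_nonneg)
  have "- ln ?t \<le> 1 / ?t - 1"
    using ln_le_minus_one[of "1 / ?t"] t by (simp add: ln_div)
  moreover have "1 - 1 / ?t = x\<^sup>2 / (w + x\<^sup>2)"
    using w pos by (simp add: field_simps)
  moreover have "x\<^sup>2 / H \<le> x\<^sup>2 / (w + x\<^sup>2)"
    using pos assms by (intro divide_left_mono) auto
  ultimately show "x\<^sup>2 / H \<le> ln (1 + x\<^sup>2 / w)" by linarith
  have "ln ?t \<le> x\<^sup>2 / w" using ln_add_one_self_le_self[of "x\<^sup>2 / w"] w by simp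
  also have "\<dots> \<le> x\<^sup>2 / lo" using assms by (intro divide_left_mono) auto
  finally show "ln ?t \<le> x\<^sup>2 / lo" .
qed

text \<open>With \<open>x = p - \<mu> i\<close> and \<open>y = \<mu> b - p\<close>, the first-order
  condition says that \<open>y / x\<close> equals \<open>a i / a b\<close> up to a factor between
  \<open>lo / H\<close> and \<open>H / lo\<close>. Squaring costs this factor twice and replacing
  the logarithms by squares once more, whence the cube. \<open>H\<close> bounds
  \<open>v i + x\<^sup>2\<close> because the two means are at most \<open>2 * D\<close> apart. The
  upper bound on the rate comes from the test point \<open>\<mu> b\<close>.\<close>

lemma rate_bounds:
  assumes lo: "0 < lo" and v: "lo \<le> v i" "v i \<le> hi" "lo \<le> v b" "v b \<le> hi"
    and a: "a i > 0" "a b > 0" and D: "\<bar>\<mu> i\<bar> \<le> D" "\<bar>\<mu> b\<bar> \<le> D" and less: "\<mu> i < \<mu> b"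
    and H: "H = hi + 4 * D\<^sup>2"
  shows "rate_U \<mu> v a b i > 0"
    and "rate_Ustar \<mu> v a b i / rate_U \<mu> v a b i \<le> (H / lo) ^ 3 * (a i / a b)\<^sup>2"
    and "(a i / a b)\<^sup>2 \<le> (H / lo) ^ 3 * (rate_Ustar \<mu> v a b i / rate_U \<mu> v a b i)"
    and "min (a i) (a b) * (\<mu> b - \<mu> i)\<^sup>2 \<le> 4 * H * rate_V \<mu> v a b i"
    and "rate_V \<mu> v a b i \<le> a i * (2 * D\<^sup>2 / lo)"
proof -
  define p where "p = rate_argmin \<mu> v a b i"
  define x where "x = p - \<mu> i"
  define y where "y = \<mu> b - p"
  have vpos: "v i > 0" "v b > 0" using lo v by auto
  note am = rate_argmin_minimizes[of v i b a \<mu>, OF vpos a less_imp_le[OF less], folded p_def]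
  have xy: "x \<ge> 0" "y \<ge> 0" "x + y = \<mu> b - \<mu> i" using am(2,3) by (auto simp: x_def y_def)
  have sq: "x\<^sup>2 \<le> 4 * D\<^sup>2" "y\<^sup>2 \<le> 4 * D\<^sup>2" "(\<mu> b - \<mu> i)\<^sup>2 \<le> 4 * D\<^sup>2"
    using xy D less power_mono[of x "2 * D" 2] power_mono[of y "2 * D" 2] power_mono[of "\<mu> b - \<mu> i" "2 * D" 2]
    by (auto simp: power_mult_distrib abs_le_iff)
  have ex: "v i + x\<^sup>2 \<le> H" "v b + y\<^sup>2 \<le> H" using sq v H by auto
  have hlo: "lo \<le> H" using ex v zero_le_power2[of x] by linarith
  have Hpos: "H > 0" using hlo lo by simp
  have posx: "v i + x\<^sup>2 > 0" "v b + y\<^sup>2 > 0" using vpos by (simp_all add: add_pos_nonneg)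
  have fo: "a i * x / (v i + x\<^sup>2) = a b * y / (v b + y\<^sup>2)"
    using rate_obj_first_order[OF vpos am(1)] by (simp add: x_def y_def)
  then have fo': "a i * x * (v b + y\<^sup>2) = a b * y * (v i + x\<^sup>2)"
    using posx by (simp add: frac_eq_eq)
  \<comment> \<open>The first-order condition makes \<open>x\<close> and \<open>y\<close> vanish
    together, and their sum is positive.\<close>
  have xpos: "x > 0" and ypos: "y > 0"
  proof -
    have "x = 0 \<longleftrightarrow> y = 0" using fo' a posx by auto
    then show "x > 0" "y > 0" using xy less by (auto simp: le_less)
  qed
  define r where "r = a i / a b"
  have rpos: "r > 0" using a by (simp add: r_def)
  have q: "y / x = r * ((v b + y\<^sup>2) / (v i + x\<^sup>2))"
  proof -
    have "y / x = (a i * (v b + y\<^sup>2)) / (a b * (v i + x\<^sup>2))"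
      using fo' a xpos posx by (subst frac_eq_eq) (auto simp: mult_ac)
    then show ?thesis by (simp add: r_def)
  qed
  have qle: "y / x \<le> r * (H / lo)" unfolding q
    using rpos ex v lo posx by (intro mult_left_mono frac_le) (auto intro: order_trans[of lo "v i"])
  have "r = (y / x) * ((v i + x\<^sup>2) / (v b + y\<^sup>2))" using q posx by simp
  also have "\<dots> \<le> y / x * (H / lo)"
    using xpos ypos ex v lo posx by (intro mult_left_mono frac_le) (auto intro: order_trans[of lo "v b"])
  finally have rle: "r \<le> y / x * (H / lo)" .
  have U: "rate_U \<mu> v a b i = ln (1 + x\<^sup>2 / v i)" "rate_Ustar \<mu> v a b i = ln (1 + y\<^sup>2 / v b)"
    by (simp_all add: rate_U_def rate_Ustar_def p_def[symmetric] x_def y_def power2_commute)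
  note Ub = ln_one_plus_bounds[OF lo v(1) ex(1), folded U]
  note Sb = ln_one_plus_bounds[OF lo v(3) ex(2), folded U]
  have xs: "x\<^sup>2 / H > 0" "y\<^sup>2 / H > 0" using xpos ypos Hpos by auto
  show Upos: "rate_U \<mu> v a b i > 0" using Ub xs by linarith
  have Spos: "rate_Ustar \<mu> v a b i > 0" using Sb xs by linarith
  have "rate_Ustar \<mu> v a b i / rate_U \<mu> v a b i \<le> (y\<^sup>2 / lo) / (x\<^sup>2 / H)"
    using Ub Sb xs lo by (intro frac_le) auto
  also have "\<dots> = (H / lo) * (y / x)\<^sup>2" by (simp add: field_simps)
  also have "\<dots> \<le> (H / lo) * (r * (H / lo))\<^sup>2"
    using Hpos lo qle xpos ypos by (intro mult_left_mono power_mono) auto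
  finally show "rate_Ustar \<mu> v a b i / rate_U \<mu> v a b i \<le> (H / lo) ^ 3 * (a i / a b)\<^sup>2"
    by (simp add: r_def power2_eq_square power3_eq_cube mult_ac)
  have "r\<^sup>2 \<le> (y / x * (H / lo))\<^sup>2" using rle rpos by (intro power_mono) auto
  also have "\<dots> = (H / lo) ^ 3 * ((y\<^sup>2 / H) / (x\<^sup>2 / lo))" using Hpos lo
    by (simp add: power2_eq_square power3_eq_cube mult_ac)
  also have "\<dots> \<le> (H / lo) ^ 3 * (rate_Ustar \<mu> v a b i / rate_U \<mu> v a b i)"
    using Hpos lo Ub Sb xs Upos Spos by (intro mult_left_mono frac_le) auto
  finally show "(a i / a b)\<^sup>2 \<le> (H / lo) ^ 3 * (rate_Ustar \<mu> v a b i / rate_U \<mu> v a b i)"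
    by (simp add: r_def)
  let ?m = "min (a i) (a b)"
  have V: "rate_V \<mu> v a b i = a i / 2 * rate_U \<mu> v a b i + a b / 2 * rate_Ustar \<mu> v a b i"
    using rate_V_eq_minimum[OF am(1)] by (simp add: rate_obj_def rate_U_def rate_Ustar_def p_def)
  have "(\<mu> b - \<mu> i)\<^sup>2 \<le> 2 * x\<^sup>2 + 2 * y\<^sup>2"
    using xy(3) zero_le_power2[of "x - y"] by (simp flip: xy(3) add: power2_eq_square algebra_simps)
  then have "?m * (\<mu> b - \<mu> i)\<^sup>2 \<le> ?m * (2 * x\<^sup>2 + 2 * y\<^sup>2)"
    using a by (intro mult_left_mono) auto
  also have "\<dots> = 4 * H * (?m / 2 * (x\<^sup>2 / H) + ?m / 2 * (y\<^sup>2 / H))" using Hpos by (simp add: field_simps)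
  also have "\<dots> \<le> 4 * H * (a i / 2 * rate_U \<mu> v a b i + a b / 2 * rate_Ustar \<mu> v a b i)"
    using Hpos a Ub Sb xs by (intro mult_left_mono add_mono mult_mono) auto
  finally show "?m * (\<mu> b - \<mu> i)\<^sup>2 \<le> 4 * H * rate_V \<mu> v a b i" using V by simp
  have "rate_V \<mu> v a b i \<le> a i / 2 * ln (1 + (\<mu> i - \<mu> b)\<^sup>2 / v i)"
    using rate_V_le[of v i b a \<mu> "\<mu> b"] vpos a by (simp add: rate_obj_def)
  also have "\<dots> \<le> a i / 2 * ((\<mu> i - \<mu> b)\<^sup>2 / lo)"
    using ln_one_plus_bounds(2)[OF lo v(1) order_refl, of "\<mu> i - \<mu> b"] a by (intro mult_left_mono) auto
  also have "\<dots> \<le> a i / 2 * (4 * D\<^sup>2 / lo)"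
    using sq(3) a lo by (intro mult_left_mono divide_right_mono) (auto simp: power2_commute)
  finally show "rate_V \<mu> v a b i \<le> a i * (2 * D\<^sup>2 / lo)" by (simp add: mult_ac)
qed

section \<open>Sampling decisions\<close>

text \<open>The decision rule becomes three inequalities on sample sizes, which is all that the
  starvation argument sees of the rates. By \<open>rate_bounds\<close> the ratios are comparable
  with the squares of \<open>n i / n b\<close>, and the rate of \<open>i\<close> is at most a
  constant times \<open>n i / T\<close>. The first condition on \<open>Q\<close> brings every ratio
  down to \<open>1 / CARD('k)\<close> when \<open>b\<close> is oversampled; the second absorbs the
  constants of the rate comparison.\<close>

lemma ocba_step_sampling:
  fixes \<mu> v a :: "'k::finite \<Rightarrow> real" and n :: "'k \<Rightarrow> nat" and Q :: nat
  assumes lo: "0 < lo" and v: "\<And>i. lo \<le> v i" "\<And>i. v i \<le> hi" and D: "\<And>i. \<bar>\<mu> i\<bar> \<le> D"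
    and H: "H = hi + 4 * D\<^sup>2"
    and n: "\<And>i. 1 \<le> n i" and T: "0 < T" and a: "\<And>i. a i = real (n i) / T"
    and Q: "(H / lo) ^ 3 * CARD('k) \<le> Q" "4 * H * (2 * D\<^sup>2 / lo) \<le> Q" "1 \<le> Q"
    and A: "A = {i. \<forall>j. \<mu> j \<le> \<mu> i}" "b \<in> A" "\<forall>i\<in>A. n b \<le> n i"
    and step: "if card A \<noteq> 1 then j = b
              else if (\<Sum>i\<in>UNIV - {b}. rate_Ustar \<mu> v a b i / rate_U \<mu> v a b i) > 1
              then j = b
              else j \<noteq> b \<and> (\<forall>i. i \<noteq> b \<longrightarrow> rate_V \<mu> v a b j \<le> rate_V \<mu> v a b i)"
  shows "j = b \<Longrightarrow> \<exists>i. i \<noteq> b \<and> n b \<le> Q * n i"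
    and "j \<noteq> b \<Longrightarrow> i \<noteq> b \<Longrightarrow> n i \<le> Q * n b"
    and "j \<noteq> b \<Longrightarrow> i \<noteq> b \<Longrightarrow> min (n j) (n b) * (\<mu> b - \<mu> j)\<^sup>2 \<le> Q * n i"
proof -
  let ?\<kappa> = "(H / lo) ^ 3"
  have apos: "a i > 0" for i using n[of i] T by (simp add: a)
  have hlo: "lo \<le> H" using v[of b] H zero_le_power2[of D] by linarith
  have HL: "0 \<le> H / lo" using hlo lo by simp
  have \<kappa>: "1 \<le> ?\<kappa>" using hlo lo by (intro one_le_power) auto
  have \<kappa>Q: "?\<kappa> \<le> Q"
  proof -
    have "?\<kappa> * 1 \<le> ?\<kappa> * real CARD('k)"
      using hlo lo by (intro mult_left_mono) (auto simp: Suc_le_eq)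
    then show ?thesis using Q(1) by linarith
  qed
  have QQ: "real Q \<le> (real Q)\<^sup>2" using Q(3) by (simp add: power2_eq_square)
  have ratio: "a i / a b = n i / n b" for i using T by (simp add: a)
  have npos: "real (n i) > 0" for i using n[of i] by linarith
  have less: "\<mu> i < \<mu> b" if "card A = 1" "i \<noteq> b" for i
  proof -
    have "A = {b}" using that A(2) by (metis card_1_singletonE singletonD)
    then have "i \<notin> A" using that by simp
    then obtain j where "\<mu> i < \<mu> j" unfolding A(1) by (auto simp: not_le)
    moreover have "\<mu> j \<le> \<mu> b" using A(2) unfolding A(1) by auto
    ultimately show ?thesis by simp
  qed
  note rb = rate_bounds[of lo v _ hi b a \<mu> D H, OF lo v(1) v(2) v(1) v(2) apos apos D D _ H]
  show "\<exists>i. i \<noteq> b \<and> n b \<le> Q * n i" if "j = b"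
  proof (cases "card A = 1")
    case False
    \<comment> \<open>In a tie there is another maximiser, and the tie rule makes \<open>b\<close>
      one with the fewest samples.\<close>
    have "\<not> A \<subseteq> {b}"
    proof
      assume "A \<subseteq> {b}"
      then have "A = {b}" using A(2) by blast
      then show False using False by simp
    qed
    then obtain i where i: "i \<in> A" "i \<noteq> b" by auto
    then have "n b \<le> Q * n i" using A(3) Q(3) by (metis le_trans mult_le_mono1 nat_mult_1)
    with i show ?thesis by auto
  next
    case True
    show ?thesis
    proof (rule ccontr)
      assume c: "\<not> ?thesis"
      have share: "rate_Ustar \<mu> v a b i / rate_U \<mu> v a b i \<le> 1 / CARD('k)" if i: "i \<noteq> b" for i
      proof -
        have "Q * n i < n b" using c i by auto
        then have "real Q * n i < n b" by (metis of_nat_less_iff of_nat_mult)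
        then have "real (n i) / n b \<le> 1 / Q" using npos[of b] Q(3) by (simp add: field_simps)
        then have "(real (n i) / n b)\<^sup>2 \<le> (1 / Q)\<^sup>2" by (intro power_mono) auto
        also have "\<dots> \<le> 1 / Q" using QQ Q(3) by (simp add: power_divide frac_le)
        finally have "?\<kappa> * (a i / a b)\<^sup>2 \<le> ?\<kappa> * (1 / Q)"
          using \<kappa> HL by (intro mult_left_mono) (auto simp: ratio)
        also have "x * (1 / Q) \<le> 1 / CARD('k)" if "x * CARD('k) \<le> Q" for x :: real
          using that Q(3) by (simp add: field_simps)
        from this[OF Q(1)] have "?\<kappa> * (1 / Q) \<le> 1 / CARD('k)" .
        finally show ?thesis using rb(2)[OF less[OF True i]] by linarith
      qed
      have "(\<Sum>i\<in>UNIV - {b}. rate_Ustar \<mu> v a b i / rate_U \<mu> v a b i) \<le> (\<Sum>i\<in>UNIV - {b}. 1 / CARD('k))"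
        using share by (intro sum_mono) auto
      also have "\<dots> \<le> 1" by (simp add: divide_simps card_Diff_subset)
      finally show False using step True that by auto
    qed
  qed
  assume jb: "j \<noteq> b"
  then have c1: "card A = 1" using step by (auto split: if_splits)
  have G: "(\<Sum>i\<in>UNIV - {b}. rate_Ustar \<mu> v a b i / rate_U \<mu> v a b i) \<le> 1"
    and V: "\<And>i. i \<noteq> b \<Longrightarrow> rate_V \<mu> v a b j \<le> rate_V \<mu> v a b i"
    using step c1 jb by (auto split: if_splits simp: not_less)
  have vpos: "v i > 0" for i using lo v(1)[of i] by linarith
  have term_nonneg: "0 \<le> rate_Ustar \<mu> v a b i / rate_U \<mu> v a b i" if "i \<noteq> b" for i
    using rb(1)[OF less[OF c1 that]] vpos[of b]
    by (intro divide_nonneg_pos) (auto simp: rate_Ustar_def intro!: ln_ge_zero)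
  assume i: "i \<noteq> b"
  show "n i \<le> Q * n b"
  proof -
    have "rate_Ustar \<mu> v a b i / rate_U \<mu> v a b i \<le> 1"
      using G i term_nonneg by (intro order_trans[OF member_le_sum[of i "UNIV - {b}"] G]) auto
    then have "?\<kappa> * (rate_Ustar \<mu> v a b i / rate_U \<mu> v a b i) \<le> ?\<kappa> * 1"
      using \<kappa> HL by (intro mult_left_mono) auto
    then have "(real (n i) / n b)\<^sup>2 \<le> (real Q)\<^sup>2"
      using rb(3)[OF less[OF c1 i], unfolded ratio] \<kappa>Q QQ by linarith
    then have "real (n i) / n b \<le> Q" by (rule power2_le_imp_le) simp
    then have "real (n i) \<le> real (Q * n b)" using npos[of b] by (simp add: field_simps)
    then show ?thesis by (simp only: of_nat_le_iff)
  qed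
  show "min (n j) (n b) * (\<mu> b - \<mu> j)\<^sup>2 \<le> Q * n i"
  proof -
    \<comment> \<open>The sampled design has the smallest rate, so its rate is capped by that of
      \<open>i\<close>; multiplying by \<open>T\<close> turns shares into sample sizes.\<close>
    have "min (a j) (a b) * (\<mu> b - \<mu> j)\<^sup>2 \<le> 4 * H * rate_V \<mu> v a b j"
      by (rule rb(4)[OF less[OF c1 jb]])
    also have "\<dots> \<le> 4 * H * (a i * (2 * D\<^sup>2 / lo))"
      using V[OF i] rb(5)[OF less[OF c1 i]] hlo lo by (intro mult_left_mono) auto
    also have "\<dots> = a i * (4 * H * (2 * D\<^sup>2 / lo))" by simp
    also have "\<dots> \<le> a i * Q" using Q(2) apos[of i] by (intro mult_left_mono) auto
    finally have "T * (min (a j) (a b) * (\<mu> b - \<mu> j)\<^sup>2) \<le> T * (a i * Q)"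
      using T by (intro mult_left_mono) auto
    moreover have "T * min (a j) (a b) = min (n j) (n b)"
      using T by (simp add: a min_mult_distrib_left)
    then have "T * (min (a j) (a b) * (\<mu> b - \<mu> j)\<^sup>2) = min (n j) (n b) * (\<mu> b - \<mu> j)\<^sup>2"
      by (simp only: mult.assoc[symmetric])
    moreover have "T * (a i * Q) = Q * n i" using T by (simp add: a)
    ultimately show ?thesis by linarith
  qed
qed

section \<open>Every design is sampled infinitely often\<close>

text \<open>\<open>x\<close> and \<open>y\<close> are the excesses of two sample means over a common
  mean, \<open>s\<close> and \<open>t\<close> those of the estimates. Sample sizes in
  \<open>{N..L * N}\<close> turn the envelopes into \<open>x \<le> 2 * A / sqrt N\<close> and
  \<open>y \<ge> (K / L) * (A / sqrt N)\<close>. The constant \<open>2 * C + q + 3\<close> pays for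
  the upper envelope (2), for the two estimation errors (\<open>2 * C\<close>) and for a remaining
  gap of \<open>q + 1\<close>, whose square exceeds \<open>q\<close>.\<close>

lemma excursion_gap:
  fixes x y s C K L q A :: real and p k N :: nat
  assumes N: "0 < N" "N \<le> p" "N \<le> k" "k \<le> L * N"
    and L: "1 \<le> L" and A: "1 \<le> A" and K: "L * (2 * C + q + 3) \<le> K" and C: "0 \<le> C" and q: "0 \<le> q"
    and up: "p * x \<le> 2 * A * sqrt N" and lower: "A * K * sqrt N \<le> k * y"
    and s: "\<bar>s - x\<bar> \<le> C / sqrt p" "\<bar>t - y\<bar> \<le> C / sqrt k"
  shows "s < t" and "q < min p k * (t - s)\<^sup>2"
proof -
  let ?r = "sqrt (real N)"
  have r: "?r > 0" "?r * ?r = N" using N by auto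
  have p: "real p > 0" and k: "real k > 0" using N by auto
  have "x \<le> 2 * A * ?r / p" using up p by (simp add: field_simps)
  also have "\<dots> \<le> 2 * A * ?r / N" using N A by (intro divide_left_mono) auto
  also have "\<dots> = 2 * A / ?r" using r by (simp add: field_simps)
  finally have x: "x \<le> 2 * A / ?r" .
  have Kpos: "K \<ge> 0" using K L C q by (intro order_trans[OF _ K] mult_nonneg_nonneg) auto
  have "(K / L) * (A / ?r) = A * K * ?r / (L * N)" using r L by (simp add: field_simps)
  also have "\<dots> \<le> A * K * ?r / k" using N A Kpos k L by (intro divide_left_mono) auto
  also have "\<dots> \<le> y" using lower k by (simp add: field_simps)
  finally have y: "(K / L) * (A / ?r) \<le> y" .
  have KL: "2 * C + q + 3 \<le> K / L" using K L by (simp add: field_simps)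
  have "(2 * C + q + 1) * 1 \<le> (K / L - 2) * A" using KL A C q by (intro mult_mono) auto
  then have "(2 * C + q + 1) / ?r \<le> (K / L - 2) * A / ?r" using r by (intro divide_right_mono) auto
  also have "\<dots> \<le> y - x" using x y by (simp add: diff_divide_distrib left_diff_distrib)
  finally have yx: "(2 * C + q + 1) / ?r \<le> y - x" .
  have "C / sqrt p \<le> C / ?r" "C / sqrt k \<le> C / ?r" using N C by (auto intro!: divide_left_mono)
  then have "t - s \<ge> (2 * C + q + 1) / ?r - 2 * (C / ?r)" using yx s by linarith
  also have "(2 * C + q + 1) / ?r - 2 * (C / ?r) = (q + 1) / ?r" by (simp add: add_divide_distrib)
  finally have ts: "(q + 1) / ?r \<le> t - s" .
  have "0 < (q + 1) / ?r" using q r by simp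
  then show "s < t" using ts by linarith
  have "q < (q + 1)\<^sup>2" using q by (simp add: power2_eq_square algebra_simps) (smt (verit) mult_nonneg_nonneg)
  also have "\<dots> = N * ((q + 1) / ?r)\<^sup>2" using r N by (simp add: power_divide)
  also have "\<dots> \<le> min p k * (t - s)\<^sup>2"
    using N ts q r by (intro mult_mono power_mono) auto
  finally show "q < min p k * (t - s)\<^sup>2" .
qed

text \<open>Of the algorithm only the sampling inequalities are kept, of the data only the error
  bound, the limits and the excursions. The order of quantifiers matters: \<open>L\<close> is fixed
  by \<open>Q\<close> and the range of the ranks, and only then is \<open>K\<close> chosen, large in
  terms of \<open>L\<close>, \<open>C\<close> and the sample sizes of the starved designs.\<close>

lemma all_designs_sampled_infinitely_often:
  fixes n :: "nat \<Rightarrow> 'k::finite \<Rightarrow> nat" and mh :: "nat \<Rightarrow> 'k \<Rightarrow> real" and xbar :: "'k \<Rightarrow> nat \<Rightarrow> real"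
    and rank :: "'k \<Rightarrow> nat" and Q :: nat
  assumes n_Suc: "\<And>m i. n (Suc m) i = n m i + (if I (Suc m) = i then 1 else 0)"
    and n_pos: "\<And>m i. 1 \<le> n m i"
    and best: "\<And>m i. mh m i \<le> mh m (B m)"
    and sample_best: "\<And>m. I (Suc m) = B m \<Longrightarrow> \<exists>i. i \<noteq> B m \<and> n m (B m) \<le> Q * n m i"
    and sample_other: "\<And>m i. I (Suc m) \<noteq> B m \<Longrightarrow> i \<noteq> B m \<Longrightarrow> n m i \<le> Q * n m (B m)"
      "\<And>m i. I (Suc m) \<noteq> B m \<Longrightarrow> i \<noteq> B m \<Longrightarrow>
        min (n m (I (Suc m))) (n m (B m)) * (mh m (B m) - mh m (I (Suc m)))\<^sup>2 \<le> Q * n m i"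
    and approx: "\<And>m i. \<bar>mh m i - xbar i (n m i)\<bar> \<le> C / sqrt (n m i)"
    and lim: "\<And>i. xbar i \<longlonglongrightarrow> \<mu> i"
    and rank: "inj rank" "\<And>i. rank i < R"
    and excursions: "\<And>L::nat. \<exists>K0. \<forall>K\<ge>K0. \<exists>\<^sub>\<infinity>N. \<forall>i. \<forall>k\<in>{N..L * N}.
        real K ^ Suc (rank i) * sqrt N \<le> k * (xbar i k - \<mu> i) \<and>
        k * (xbar i k - \<mu> i) \<le> 2 * real K ^ Suc (rank i) * sqrt N"
  shows "filterlim (\<lambda>m. n m i) at_top sequentially"
proof -
  define S where "S = {i. \<forall>M. \<exists>m\<ge>M. I (Suc m) = i}"
  have mono: "n m i \<le> n m' i" if "m \<le> m'" for m m' i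
    using that by (induction rule: dec_induct) (auto simp: n_Suc)
  have S_lim: "filterlim (\<lambda>m. n m i) at_top sequentially" if "i \<in> S" for i
  proof -
    have "\<exists>m. c \<le> n m i" for c
    proof (induction c)
      case (Suc c)
      then obtain m where "c \<le> n m i" by blast
      moreover obtain m' where "m' \<ge> m" "I (Suc m') = i" using \<open>i \<in> S\<close> by (auto simp: S_def)
      ultimately have "Suc c \<le> n (Suc m') i" using mono[of m m' i] by (simp add: n_Suc)
      then show ?case by blast
    qed simp
    then show ?thesis
      unfolding filterlim_at_top eventually_sequentially by (meson mono order_trans)
  qed
  then have S_ev: "\<forall>\<^sub>F m in sequentially. \<forall>i\<in>S. c \<le> n m i" for c
    by (intro eventually_ball_finite ballI) (auto simp: filterlim_at_top)
  have "\<exists>M. \<forall>m\<ge>M. I (Suc m) \<noteq> i" if "i \<notin> S" for i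
    using that by (auto simp: S_def)
  then have "\<forall>\<^sub>F m in sequentially. \<forall>i\<in>-S. I (Suc m) \<noteq> i"
    by (intro eventually_ball_finite ballI) (auto simp: eventually_sequentially)
  then obtain M0 where M0: "\<And>m. m \<ge> M0 \<Longrightarrow> I (Suc m) \<in> S"
    by (auto simp: eventually_sequentially)
  define k where "k = (\<Sum>i\<in>UNIV. n M0 i)"
  have k: "n m i \<le> k" if "i \<notin> S" "m \<ge> M0" for m i
  proof -
    have "n m i = n M0 i" using that(2)
    proof (induction rule: dec_induct)
      case (step m)
      then show ?case using M0[of m] that(1) by (auto simp: n_Suc)
    qed simp
    then show ?thesis by (simp add: k_def member_le_sum)
  qed
  define s where "s = I (Suc M0)"
  have s: "s \<in> S" using M0 by (simp add: s_def)
  have "S = UNIV"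
  proof (rule ccontr)
    assume "S \<noteq> UNIV"
    then obtain f where f: "f \<notin> S" by auto
    have "\<forall>\<^sub>F m in sequentially. m \<ge> M0 \<and> (\<forall>i\<in>S. Q * k + 1 \<le> n m i)"
      by (intro eventually_conj eventually_ge_at_top S_ev)
    then obtain M1 where M1: "\<And>m. m \<ge> M1 \<Longrightarrow> m \<ge> M0 \<and> (\<forall>i\<in>S. Q * k + 1 \<le> n m i)"
      by (auto simp: eventually_sequentially)
    \<comment> \<open>After \<open>M1\<close>, a best design outside \<open>S\<close> would have at
      most \<open>k\<close> samples and so cap the size of \<open>s\<close> by \<open>Q * k\<close>,
      which \<open>s\<close> has already passed.\<close>
    have BS: "B m \<in> S" if m: "m \<ge> M1" for m
    proof (rule ccontr)
      assume B: "B m \<notin> S"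
      then have "I (Suc m) \<noteq> B m" using M0[of m] M1[OF m] by auto
      then have "n m s \<le> Q * n m (B m)" using sample_other(1)[of m s] s B by auto
      also have "\<dots> \<le> Q * k" using k[OF B] M1[OF m] by simp
      finally show False using M1[OF m] s by force
    qed
    \<comment> \<open>The starved \<open>f\<close> is never the best design at these times, so its
      small sample size bounds the gap of every design that is sampled without being best.\<close>
    have far: "\<not> Q * k < min (n m (I (Suc m))) (n m (B m)) * (mh m (B m) - mh m (I (Suc m)))\<^sup>2"
      if m: "m \<ge> M1" and "I (Suc m) \<noteq> B m" for m
    proof -
      have "f \<noteq> B m" using BS[OF m] f by auto
      from sample_other(2)[OF that(2) this] k[OF f, of m] M1[OF m]
      have "min (n m (I (Suc m))) (n m (B m)) * (mh m (B m) - mh m (I (Suc m)))\<^sup>2 \<le> Q * n m f"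
        and "real (Q * n m f) \<le> Q * k" by (auto simp del: of_nat_mult)
      then show ?thesis by simp
    qed
    have mh_lim: "(\<lambda>m. mh m i) \<longlonglongrightarrow> \<mu> i" if i: "i \<in> S" for i
    proof -
      have "(\<lambda>k. C / sqrt (real k)) \<longlonglongrightarrow> 0"
        by (intro tendsto_divide_0[OF tendsto_const] filterlim_at_top_imp_at_infinity
            filterlim_compose[OF sqrt_at_top filterlim_real_sequentially])
      from filterlim_compose[OF this S_lim[OF i]] have "(\<lambda>m. mh m i - xbar i (n m i)) \<longlonglongrightarrow> 0"
        by (rule Lim_null_comparison[rotated]) (simp add: approx)
      from tendsto_add[OF this filterlim_compose[OF lim[of i] S_lim[OF i]]] show ?thesis by simp
    qed
    \<comment> \<open>Otherwise, at late times at which \<open>j\<close> is sampled, it stays behind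
      the best design by more than \<open>g\<close> while both sample sizes exceed
      \<open>Q * k / g\<^sup>2\<close>, against \<open>far\<close>.\<close>
    have "\<mu> j \<ge> \<mu> t" if t: "t \<in> S" and j: "j \<in> S" for t j
    proof (rule ccontr)
      assume "\<not> \<mu> j \<ge> \<mu> t"
      define g where "g = (\<mu> t - \<mu> j) / 2"
      have g: "g > 0" using \<open>\<not> \<mu> j \<ge> \<mu> t\<close> by (simp add: g_def)
      have "(\<lambda>m. mh m t - mh m j) \<longlonglongrightarrow> \<mu> t - \<mu> j" by (intro tendsto_diff mh_lim t j)
      then have "\<forall>\<^sub>F m in sequentially. g < mh m t - mh m j"
        by (rule order_tendstoD) (use g in \<open>simp add: g_def\<close>)
      then have "\<forall>\<^sub>F m in sequentially. M1 \<le> m \<and> (g < mh m t - mh m j) \<and>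
          (\<forall>i\<in>S. nat \<lceil>Q * k / g\<^sup>2\<rceil> + 1 \<le> n m i)"
        by (intro eventually_conj eventually_ge_at_top S_ev)
      then obtain M where M: "\<And>m. m \<ge> M \<Longrightarrow> M1 \<le> m \<and> (g < mh m t - mh m j) \<and>
          (\<forall>i\<in>S. nat \<lceil>Q * k / g\<^sup>2\<rceil> + 1 \<le> n m i)"
        by (auto simp: eventually_sequentially)
      obtain m where m: "m \<ge> M" "I (Suc m) = j" using j by (auto simp: S_def)
      note Mm = M[OF m(1)]
      have gap: "g < mh m (B m) - mh m j" using Mm best[of m t] by linarith
      then have "j \<noteq> B m" using g by auto
      then have "\<not> Q * k < min (n m j) (n m (B m)) * (mh m (B m) - mh m j)\<^sup>2"
        using far[of m] Mm m by auto
      moreover have "Q * k / g\<^sup>2 < n m i" if "i \<in> S" for i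
      proof -
        have "nat \<lceil>Q * k / g\<^sup>2\<rceil> + 1 \<le> n m i" using Mm that by blast
        then show ?thesis using real_nat_ceiling_ge[of "Q * k / g\<^sup>2"] by linarith
      qed
      then have "Q * k / g\<^sup>2 < min (n m j) (n m (B m))"
        using j BS[of m] Mm by (auto simp: min_def simp del: of_nat_mult)
      then have "Q * k < min (n m j) (n m (B m)) * g\<^sup>2" using g by (simp add: field_simps)
      moreover have "min (n m j) (n m (B m)) * g\<^sup>2 \<le> min (n m j) (n m (B m)) * (mh m (B m) - mh m j)\<^sup>2"
        using gap g by (intro mult_left_mono power_mono) auto
      ultimately show False by linarith
    qed
    then have \<mu>_eq: "\<mu> i = \<mu> j" if "i \<in> S" "j \<in> S" for i j
      using that by (meson order_antisym)
    \<comment> \<open>The numbers \<open>c i\<close> cap the sample sizes in units of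
      \<open>N\<close>. A step up in rank costs a factor \<open>Q\<close> by
      \<open>sample_best\<close> and one more sample, which \<open>Q + 2\<close> covers.
      \<open>L\<close> dominates all caps, so capped sizes that have reached \<open>N\<close> lie in
      the window.\<close>
    define L where "L = (Q + 2) ^ Suc R"
    define c where "c i = (Q + 2) ^ Suc (rank i)" for i
    have c_le: "c i \<le> L" for i
      unfolding c_def L_def using rank(2)[of i] by (intro power_increasing) auto
    have c_ge: "Q + 2 \<le> c i" for i
      unfolding c_def by (rule self_le_power) auto
    have L1: "1 \<le> L" unfolding L_def by (rule one_le_power) simp
    obtain K0 where K0: "\<And>K. K \<ge> K0 \<Longrightarrow> \<exists>\<^sub>\<infinity>N. \<forall>i. \<forall>k\<in>{N..L * N}.
        real K ^ Suc (rank i) * sqrt N \<le> k * (xbar i k - \<mu> i) \<and>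
        k * (xbar i k - \<mu> i) \<le> 2 * real K ^ Suc (rank i) * sqrt N"
      using excursions[of L] by blast
    have "0 \<le> C / sqrt (n 0 f)" using approx[of 0 f] by linarith
    then have C: "0 \<le> C" using n_pos[of 0 f] by (auto simp: zero_le_divide_iff)
    \<comment> \<open>The number \<open>Q * k\<close> of \<open>far\<close> is the \<open>q\<close>
      of \<open>excursion_gap\<close>.\<close>
    define K where "K = max (max K0 1) (nat \<lceil>L * (2 * C + Q * k + 3)\<rceil>)"
    have K: "K \<ge> K0" "K \<ge> 1" "real L * (2 * C + real (Q * k) + 3) \<le> K"
      unfolding K_def by (auto simp: max_def) linarith+
    \<comment> \<open>The scale exceeds the sizes of the starved designs and all sizes at time
      \<open>M1\<close>, so every design starts below the window.\<close>
    define N0 where "N0 = k + 1 + (\<Sum>i\<in>UNIV. n M1 i)"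
    obtain N where N: "N \<ge> N0" and exc: "\<And>i k. k \<in> {N..L * N} \<Longrightarrow>
        real K ^ Suc (rank i) * sqrt N \<le> k * (xbar i k - \<mu> i) \<and>
        k * (xbar i k - \<mu> i) \<le> 2 * real K ^ Suc (rank i) * sqrt N"
      using K0[OF K(1), unfolded INFM_nat_le] by metis
    have Nk: "k \<le> N" "0 < N" and NM1: "n M1 i \<le> N" for i
      using N member_le_sum[of i UNIV "n M1"] by (auto simp: N0_def)
    have gap: "mh m i < mh m j"
      "Q * k < min (n m i) (n m j) * (mh m j - mh m i)\<^sup>2"
      if "i \<in> S" "j \<in> S" "rank i < rank j" "n m i \<in> {N..L * N}" "n m j \<in> {N..L * N}" for i j m
    proof -
      have A: "1 \<le> real K ^ Suc (rank i)" using K by (intro one_le_power) auto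
      have "real K ^ Suc (rank i) * K = real K ^ Suc (Suc (rank i))" by simp
      also have "\<dots> \<le> real K ^ Suc (rank j)" using K that by (intro power_increasing) auto
      finally have "real K ^ Suc (rank i) * K * sqrt N \<le> real K ^ Suc (rank j) * sqrt N"
        by (intro mult_right_mono) auto
      also have "\<dots> \<le> n m j * (xbar j (n m j) - \<mu> i)" using exc[of "n m j" j] that \<mu>_eq[of i j] by auto
      finally have lower: "real K ^ Suc (rank i) * K * sqrt N \<le> n m j * (xbar j (n m j) - \<mu> i)" .
      have up: "n m i * (xbar i (n m i) - \<mu> i) \<le> 2 * real K ^ Suc (rank i) * sqrt N"
        using exc[of "n m i" i] that by auto
      have kL: "real (n m j) \<le> real L * N" using that by (simp flip: of_nat_mult)
      note * = excursion_gap[where L="real L" and x="xbar i (n m i) - \<mu> i" and y="xbar j (n m j) - \<mu> i"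
          and s="mh m i - \<mu> i" and t="mh m j - \<mu> i", OF Nk(2) _ _ kL _ A K(3) C _ up lower]
      show "mh m i < mh m j" "Q * k < min (n m i) (n m j) * (mh m j - mh m i)\<^sup>2"
        using *(1) *(2) approx[of m i] approx[of m j] that L1 by auto
    qed
    text \<open>Among the designs with at least \<open>N\<close> samples only the one of highest rank can be the best, and it
      is then sampled only if another design has at least a fraction \<open>1 / Q\<close> of its samples. So the
      sample size of each design is controlled by those of lower rank.\<close>
    have bound: "n m i \<le> c i * N" if "m \<ge> M1" "i \<in> S" for m i
      using that
    proof (induction arbitrary: i rule: dec_induct)
      case base
      have "1 * N \<le> c i * N" using c_ge[of i] by (intro mult_le_mono1) simp
      then show ?case using NM1[of i] by linarith
    next
      case (step m)
      have IH: "n m i \<le> c i * N" if "i \<in> S" for i using step that by auto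
      have IHL: "n m i \<le> L * N" if "i \<in> S" for i
        using IH[OF that] c_le[of i] by (meson le_trans mult_le_mono1)
      show ?case
      proof (cases "I (Suc m) = i \<and> N \<le> n m i")
        case False
        moreover have "1 * N \<le> c i * N" using c_ge[of i] by (intro mult_le_mono1) simp
        then have "Suc l \<le> c i * N" if "l < N" for l using that by linarith
        ultimately show ?thesis using IH[OF step.prems] by (auto simp: n_Suc)
      next
        case True
        have small: ?thesis if "n m i \<le> Q * N"
        proof -
          have "n (Suc m) i \<le> (Q + 2) * N" using that Nk True by (simp add: n_Suc)
          also have "\<dots> \<le> c i * N" using c_ge[of i] by (intro mult_le_mono1)
          finally show ?thesis .
        qed
        show ?thesis
        proof (cases "B m = i")
          case False
          have B: "B m \<in> S" using BS step by auto
          \<comment> \<open>Were both in the window, rank would order the estimates: a higher rank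
            of \<open>B m\<close> makes the gap too large for \<open>i\<close> to be sampled, and a
            higher rank of \<open>i\<close> contradicts that \<open>B m\<close> is best.\<close>
          have "n m (B m) < N"
          proof (rule ccontr)
            assume "\<not> n m (B m) < N"
            then have r: "n m i \<in> {N..L * N}" "n m (B m) \<in> {N..L * N}" using True IHL B step.prems by auto
            have "rank i \<noteq> rank (B m)" using rank(1) False by (auto dest: injD)
            then consider "rank i < rank (B m)" | "rank (B m) < rank i" by linarith
            then show False
            proof cases
              case 1
              then show False using gap(2)[OF step.prems B 1 r] far[of m] step True False by auto
            next
              case 2
              then show False using gap(1)[OF B step.prems 2 r(2,1)] best[of m i] by simp
            qed
          qed
          then have "Q * n m (B m) \<le> Q * N" by simp
          moreover have "n m i \<le> Q * n m (B m)" using sample_other(1)[of m i] False True by auto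
          ultimately show ?thesis using small by linarith
        next
          case B: True
          then obtain j where j: "j \<noteq> i" "n m i \<le> Q * n m j" using sample_best[of m] True by auto
          show ?thesis
          proof (cases "j \<in> S \<and> N \<le> n m j")
            case False
            then have "n m j \<le> N" using k[of j m] Nk M1[of m] step by auto
            then have "Q * n m j \<le> Q * N" by simp
            then show ?thesis using small j by linarith
          next
            case jS: True
            then have r: "n m i \<in> {N..L * N}" "n m j \<in> {N..L * N}" using True IHL step.prems by auto
            have "\<not> rank i < rank j" using gap(1)[OF step.prems _ _ r] best[of m j] B jS by auto
            moreover have "rank i \<noteq> rank j" using rank(1) j by (auto dest: injD)
            ultimately have "rank j < rank i" by simp
            then have cj: "c j \<le> (Q + 2) ^ rank i" unfolding c_def by (intro power_increasing) auto
            have "n m i \<le> Q * (c j * N)" using j IH[of j] jS by (meson le_trans mult_le_mono2)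
            also have "\<dots> \<le> Q * ((Q + 2) ^ rank i * N)" using cj by (intro mult_le_mono2 mult_le_mono1)
            finally have "n (Suc m) i \<le> Q * ((Q + 2) ^ rank i * N) + 1" using True by (simp add: n_Suc)
            also have "1 \<le> (Q + 2) ^ rank i * N" using Nk by simp
            also have "Q * ((Q + 2) ^ rank i * N) + (Q + 2) ^ rank i * N \<le> c i * N"
              by (simp add: c_def algebra_simps)
            finally show ?thesis by simp
          qed
        qed
      qed
    qed
    have "\<forall>\<^sub>F m in sequentially. m \<ge> M1 \<and> (\<forall>i\<in>S. c s * N + 1 \<le> n m i)"
      by (intro eventually_conj eventually_ge_at_top S_ev)
    then obtain m where "m \<ge> M1" "\<forall>i\<in>S. c s * N + 1 \<le> n m i"
      using eventually_happens'[OF sequentially_bot] by blast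
    with bound[of m s] s show False by force
  qed
  then show ?thesis using S_lim by auto
qed

section \<open>Convergence of the allocation\<close>

lemma exists_other_design:
  assumes "2 \<le> CARD('k::finite)"
  shows "\<exists>i. i \<noteq> (b :: 'k)"
proof (rule ccontr)
  assume "\<not> ?thesis"
  then have "(UNIV :: 'k set) = {b}" by auto
  then show False using assms by (metis card_1_singleton_iff numeral_le_one_iff One_nat_def semiring_norm(69))
qed

text \<open>Comparison with the point mass at \<open>b\<close>. If \<open>astar b\<close> were 0,
  the test point \<open>\<mu> i\<close> would show that the minimal rate of \<open>astar\<close> is
  at most 0, whereas that of the point mass is at least 0, against uniqueness.\<close>

lemma optimal_allocation_best_pos:
  fixes v :: "'k::finite \<Rightarrow> real"
  assumes v: "\<And>i. 0 < v i" and opt: "unique_optimal_allocation \<mu> v b astar" and card: "2 \<le> CARD('k)"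
  shows "0 < astar b"
proof (rule ccontr)
  assume "\<not> 0 < astar b"
  have al: "astar \<in> allocations" using opt by (simp add: unique_optimal_allocation_def)
  then have ast: "\<And>i. 0 \<le> astar i" by (auto simp: allocations_def)
  then have 0: "astar b = 0" using \<open>\<not> 0 < astar b\<close> by (simp add: antisym)
  define a' :: "'k \<Rightarrow> real" where "a' i = (if i = b then 1 else 0)" for i
  have a': "a' \<in> allocations" by (auto simp: allocations_def a'_def)
  have ne: "a' \<noteq> astar" using 0 by (metis a'_def zero_neq_one)
  obtain i where i: "i \<noteq> b"
    using exists_other_design[OF card] by blast
  have "min_rate \<mu> v b a' < min_rate \<mu> v b astar"
    using opt a' ne by (auto simp: unique_optimal_allocation_def)
  moreover have "min_rate \<mu> v b astar \<le> 0"
  proof -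
    have "min_rate \<mu> v b astar \<le> rate_V \<mu> v astar b i"
      unfolding min_rate_def using i by (intro Min_le) auto
    also have "\<dots> \<le> rate_obj \<mu> v astar b i (\<mu> i)" by (intro rate_V_le v ast)
    also have "\<dots> = 0" by (simp add: rate_obj_def 0)
    finally show ?thesis .
  qed
  moreover have "0 \<le> min_rate \<mu> v b a'"
    unfolding min_rate_def using i v by (subst Min_ge_iff) (auto intro!: rate_V_nonneg simp: a'_def)
  ultimately show False by linarith
qed

text \<open>Weak duality: at fixed \<open>p\<close> the objective bounds every rate from above and
  is linear in the allocation, with equality at \<open>\<alpha>\<close>. The sequences are meant to
  run along a subsequence already chosen. The \<open>\<phi> m i\<close> are arbitrary minimisers,
  since a limit of least minimisers is a minimiser but perhaps not the least one; the sum of ratios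
  passes to its limit along the same sequence.\<close>

lemma limit_allocation_optimal:
  fixes mh vh a \<phi> :: "nat \<Rightarrow> 'k::finite \<Rightarrow> real" and \<mu> v \<alpha> p astar :: "'k \<Rightarrow> real" and b :: 'k
  defines "U \<equiv> \<lambda>m i. ln (1 + (mh m i - \<phi> m i)\<^sup>2 / vh m i)"
    and "S \<equiv> \<lambda>m i. ln (1 + (mh m b - \<phi> m i)\<^sup>2 / vh m b)"
  assumes card: "2 \<le> CARD('k)" and v: "\<And>i. 0 < v i" and b: "\<And>i. i \<noteq> b \<Longrightarrow> \<mu> i < \<mu> b"
    and mh: "\<And>i. (\<lambda>m. mh m i) \<longlonglongrightarrow> \<mu> i" and vh: "\<And>i. (\<lambda>m. vh m i) \<longlonglongrightarrow> v i"
    and a: "\<And>m. a m \<in> allocations" "\<And>i. (\<lambda>m. a m i) \<longlonglongrightarrow> \<alpha> i"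
    and \<phi>: "\<And>m i x. i \<noteq> b \<Longrightarrow> rate_obj (mh m) (vh m) (a m) b i (\<phi> m i) \<le> rate_obj (mh m) (vh m) (a m) b i x"
      "\<And>i. (\<lambda>m. \<phi> m i) \<longlonglongrightarrow> p i"
    and U: "\<And>m i. i \<noteq> b \<Longrightarrow> 0 < U m i" and S: "\<And>m i. 0 \<le> S m i"
    and gaps: "\<And>i j. i \<noteq> b \<Longrightarrow> j \<noteq> b \<Longrightarrow>
      (\<lambda>m. rate_V (mh m) (vh m) (a m) b i - rate_V (mh m) (vh m) (a m) b j) \<longlonglongrightarrow> 0"
    and opt: "unique_optimal_allocation \<mu> v b astar"
    and G: "(\<forall>m. (\<Sum>i\<in>UNIV - {b}. S m i / U m i) > 1) \<and> astar b \<le> \<alpha> b \<or>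
            (\<forall>m. (\<Sum>i\<in>UNIV - {b}. S m i / U m i) \<le> 1) \<and> \<alpha> b \<le> astar b"
  shows "\<alpha> = astar"
proof -
  have ln_lim: "(\<lambda>m. ln (1 + (mh m j - x m)\<^sup>2 / vh m j)) \<longlonglongrightarrow> ln (1 + (\<mu> j - y)\<^sup>2 / v j)"
    if "x \<longlonglongrightarrow> y" for j x y
  proof -
    have "1 + (\<mu> j - y)\<^sup>2 / v j > 0" using v[of j] by (simp add: add_pos_nonneg)
    then show ?thesis using v[of j] that by (intro tendsto_intros mh vh) auto
  qed
  have obj_lim: "(\<lambda>m. rate_obj (mh m) (vh m) (a m) b i (x m)) \<longlonglongrightarrow> rate_obj \<mu> v \<alpha> b i y"
    if "x \<longlonglongrightarrow> y" for i x y
    unfolding rate_obj_def using that by (intro tendsto_intros ln_lim a) auto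
  define U0 where "U0 i = ln (1 + (\<mu> i - p i)\<^sup>2 / v i)" for i
  define S0 where "S0 i = ln (1 + (\<mu> b - p i)\<^sup>2 / v b)" for i
  have U_lim: "(\<lambda>m. U m i) \<longlonglongrightarrow> U0 i" and S_lim: "(\<lambda>m. S m i) \<longlonglongrightarrow> S0 i" for i
    unfolding U_def U0_def S_def S0_def by (intro ln_lim \<phi>)+
  have \<alpha>_nonneg: "0 \<le> \<alpha> i" for i
    by (rule LIMSEQ_le_const[OF a(2)]) (use a(1) in \<open>auto simp: allocations_def\<close>)
  have \<alpha>_sum: "(\<Sum>i\<in>UNIV. \<alpha> i) = 1"
  proof (rule LIMSEQ_unique)
    show "(\<lambda>m. \<Sum>i\<in>UNIV. a m i) \<longlonglongrightarrow> (\<Sum>i\<in>UNIV. \<alpha> i)" by (intro tendsto_sum a)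
    show "(\<lambda>m. \<Sum>i\<in>UNIV. a m i) \<longlonglongrightarrow> 1" using a(1) by (simp add: allocations_def)
  qed
  have \<alpha>: "\<alpha> \<in> allocations" using \<alpha>_nonneg \<alpha>_sum by (simp add: allocations_def)
  have ast: "astar \<in> allocations" using opt by (simp add: unique_optimal_allocation_def)
  then have ast_nonneg: "0 \<le> astar i" and ast_sum: "(\<Sum>i\<in>UNIV. astar i) = 1" for i
    by (auto simp: allocations_def)
  have p: "rate_obj \<mu> v \<alpha> b i (p i) \<le> rate_obj \<mu> v \<alpha> b i x" if "i \<noteq> b" for i x
    using \<phi>(1)[OF that] by (intro LIMSEQ_le[OF obj_lim[OF \<phi>(2)] obj_lim[OF tendsto_const]]) auto
  have V0: "rate_V \<mu> v \<alpha> b i = rate_obj \<mu> v \<alpha> b i (p i)" if "i \<noteq> b" for i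
    by (intro rate_V_eq_minimum p that)
  have V_lim: "(\<lambda>m. rate_V (mh m) (vh m) (a m) b i) \<longlonglongrightarrow> rate_V \<mu> v \<alpha> b i" if "i \<noteq> b" for i
    unfolding V0[OF that] rate_V_eq_minimum[of "mh _" "vh _" "a _" b i, OF \<phi>(1)[OF that]]
    by (rule obj_lim[OF \<phi>(2)])
  have V_eq: "rate_V \<mu> v \<alpha> b i = rate_V \<mu> v \<alpha> b j" if "i \<noteq> b" "j \<noteq> b" for i j
    using LIMSEQ_unique[OF tendsto_diff[OF V_lim[OF that(1)] V_lim[OF that(2)]] gaps[OF that]] by simp
  obtain i0 where i0: "i0 \<noteq> b"
    using exists_other_design[OF card] by blast
  define w where "w = rate_V \<mu> v \<alpha> b i0"
  have w: "rate_V \<mu> v \<alpha> b i = w" if "i \<noteq> b" for i using V_eq[OF that i0] by (simp add: w_def)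
  have "(\<lambda>i. rate_V \<mu> v \<alpha> b i) ` (UNIV - {b}) = {w}" using w i0 by auto
  then have min_\<alpha>: "min_rate \<mu> v b \<alpha> = w" by (simp add: min_rate_def)
  \<comment> \<open>If \<open>\<alpha> b\<close> were 0, only the alternative with sums at most 1
    would remain, hence \<open>S m i \<le> U m i\<close> for all \<open>i \<noteq> b\<close>. A
    design with positive share would have \<open>p i = \<mu> i\<close>, so
    \<open>U0 i \<le> 0\<close> while \<open>S0 i > 0\<close>.\<close>
  have \<alpha>b: "0 < \<alpha> b"
  proof (rule ccontr)
    assume "\<not> 0 < \<alpha> b"
    then have 0: "\<alpha> b = 0" using \<alpha>_nonneg[of b] by simp
    with G optimal_allocation_best_pos[OF v opt card]
    have G1: "\<And>m. (\<Sum>i\<in>UNIV - {b}. S m i / U m i) \<le> 1" by auto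
    obtain i where i: "\<alpha> i \<noteq> 0" using \<alpha>_sum by (metis sum.neutral zero_neq_one)
    then have ib: "i \<noteq> b" and \<alpha>i: "0 < \<alpha> i" using 0 \<alpha>_nonneg[of i] by auto
    have "\<alpha> i / 2 * U0 i \<le> 0" using p[OF ib, of "\<mu> i"] by (simp add: rate_obj_def 0 U0_def)
    then have U00: "U0 i \<le> 0" using \<alpha>i by (simp add: mult_le_0_iff)
    have p_eq: "p i = \<mu> i"
    proof (rule ccontr)
      assume "p i \<noteq> \<mu> i"
      then have "U0 i > 0" unfolding U0_def using v[of i] by (intro ln_gt_zero) simp
      then show False using U00 by simp
    qed
    have "S m i \<le> U m i" for m
    proof -
      have "S m i / U m i \<le> (\<Sum>i\<in>UNIV - {b}. S m i / U m i)"
        using ib U S by (intro member_le_sum) (auto intro!: divide_nonneg_pos)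
      then have "S m i / U m i \<le> 1" using G1[of m] by linarith
      then show ?thesis using U[OF ib, of m] by (simp add: field_simps)
    qed
    then have "S0 i \<le> U0 i" by (intro LIMSEQ_le[OF S_lim U_lim]) auto
    moreover have "S0 i > 0" unfolding S0_def p_eq using v[of b] b[OF ib] by (intro ln_gt_zero) simp
    ultimately show False using U00 by linarith
  qed
  have U0: "0 < U0 i" if "i \<noteq> b" for i
  proof -
    have "p i \<noteq> \<mu> i" using rate_minimizer_neq_mean[OF v v \<alpha>b _ p[OF that]] b[OF that] by auto
    then show ?thesis unfolding U0_def using v[of i] by (intro ln_gt_zero) simp
  qed
  define G0 where "G0 = (\<Sum>i\<in>UNIV - {b}. S0 i / U0 i)"
  have G_lim: "(\<lambda>m. \<Sum>i\<in>UNIV - {b}. S m i / U m i) \<longlonglongrightarrow> G0"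
    unfolding G0_def using U0 by (intro tendsto_sum tendsto_divide S_lim U_lim) fastforce
  \<comment> \<open>Both alternatives say that passing from \<open>\<alpha> b\<close> to
    \<open>astar b\<close> does not increase \<open>a' b * (G0 - 1)\<close>, the only varying term
    in \<open>lin\<close>.\<close>
  have G0: "(astar b - \<alpha> b) * (G0 - 1) \<le> 0"
    using G
  proof
    assume *: "(\<forall>m. (\<Sum>i\<in>UNIV - {b}. S m i / U m i) > 1) \<and> astar b \<le> \<alpha> b"
    then have "1 \<le> G0" by (intro LIMSEQ_le_const[OF G_lim]) (auto intro: less_imp_le)
    then show ?thesis using * by (intro mult_nonpos_nonneg) auto
  next
    assume *: "(\<forall>m. (\<Sum>i\<in>UNIV - {b}. S m i / U m i) \<le> 1) \<and> \<alpha> b \<le> astar b"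
    then have "G0 \<le> 1" by (intro LIMSEQ_le_const2[OF G_lim]) auto
    then show ?thesis using * by (intro mult_nonneg_nonpos) auto
  qed
  define \<Lambda> where "\<Lambda> = (\<Sum>i\<in>UNIV - {b}. 1 / U0 i)"
  have \<Lambda>: "0 < \<Lambda>" unfolding \<Lambda>_def using i0 U0 by (intro sum_pos) auto
  text \<open>With the weights \<open>1 / U0 i\<close> the weighted sum of the linearised rates depends on the
    allocation only through its component at \<open>b\<close>.\<close>
  have lin: "(\<Sum>i\<in>UNIV - {b}. 1 / U0 i * rate_obj \<mu> v a' b i (p i)) = (1 + a' b * (G0 - 1)) / 2"
    if "a' \<in> allocations" for a'
  proof -
    have "1 / U0 i * rate_obj \<mu> v a' b i (p i) = a' i / 2 + a' b / 2 * (S0 i / U0 i)" if "i \<noteq> b" for i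
      using U0[OF that] by (simp add: rate_obj_def U0_def[symmetric] S0_def[symmetric] field_simps)
    then have "(\<Sum>i\<in>UNIV - {b}. 1 / U0 i * rate_obj \<mu> v a' b i (p i))
        = (\<Sum>i\<in>UNIV - {b}. a' i / 2 + a' b / 2 * (S0 i / U0 i))" by (intro sum.cong) auto
    also have "\<dots> = (\<Sum>i\<in>UNIV - {b}. a' i) / 2 + a' b / 2 * G0"
      unfolding G0_def sum_distrib_left sum_divide_distrib by (rule sum.distrib)
    also have "(\<Sum>i\<in>UNIV - {b}. a' i) = 1 - a' b"
      using that by (simp add: allocations_def sum.remove[of UNIV b] algebra_simps)
    finally show ?thesis by (simp add: field_simps)
  qed
  have "min_rate \<mu> v b astar * \<Lambda> = (\<Sum>i\<in>UNIV - {b}. 1 / U0 i * min_rate \<mu> v b astar)"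
    by (simp add: \<Lambda>_def sum_distrib_left mult.commute)
  also have "\<dots> \<le> (\<Sum>i\<in>UNIV - {b}. 1 / U0 i * rate_obj \<mu> v astar b i (p i))"
  proof (intro sum_mono mult_left_mono)
    fix i assume i: "i \<in> UNIV - {b}"
    have "min_rate \<mu> v b astar \<le> rate_V \<mu> v astar b i"
      unfolding min_rate_def using i by (intro Min_le) auto
    also have "\<dots> \<le> rate_obj \<mu> v astar b i (p i)" by (intro rate_V_le v ast_nonneg)
    finally show "min_rate \<mu> v b astar \<le> rate_obj \<mu> v astar b i (p i)" .
    show "0 \<le> 1 / U0 i" using U0[of i] i by simp
  qed
  also have "\<dots> = (1 + astar b * (G0 - 1)) / 2" by (rule lin[OF ast])
  also have "\<dots> \<le> (1 + \<alpha> b * (G0 - 1)) / 2" using G0 left_diff_distrib[of "astar b" "\<alpha> b" "G0 - 1"] by simp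
  also have "\<dots> = (\<Sum>i\<in>UNIV - {b}. 1 / U0 i * rate_obj \<mu> v \<alpha> b i (p i))" by (rule lin[OF \<alpha>, symmetric])
  also have "\<dots> = (\<Sum>i\<in>UNIV - {b}. 1 / U0 i * w)" using V0 w by (intro sum.cong) auto
  also have "\<dots> = w * \<Lambda>" by (simp add: \<Lambda>_def sum_distrib_left mult.commute)
  finally have "min_rate \<mu> v b astar \<le> min_rate \<mu> v b \<alpha>" using \<Lambda> min_\<alpha> by simp
  then show ?thesis using opt \<alpha> by (force simp: unique_optimal_allocation_def not_le[symmetric])
qed

lemma bounded_imp_pointwise_convergent_subseq:
  fixes g :: "nat \<Rightarrow> 'k::finite \<Rightarrow> real"
  assumes "\<And>m i. \<bar>g m i\<bar> \<le> D"
  shows "\<exists>r l. strict_mono (r :: nat \<Rightarrow> nat) \<and> (\<forall>i. (\<lambda>m. g (r m) i) \<longlonglongrightarrow> l i)"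
proof -
  define f where "f m = (\<chi> i. g m i)" for m
  have "norm (f m) \<le> (\<Sum>i\<in>(UNIV::'k set). D)" for m
    using norm_le_l1_cart[of "f m"] assms by (intro order_trans[OF norm_le_l1_cart] sum_mono) (auto simp: f_def)
  then have "bounded (range f)" by (auto simp: bounded_iff)
  from bounded_imp_convergent_subsequence[OF this] obtain l r
    where "strict_mono (r :: nat \<Rightarrow> nat)" "(f \<circ> r) \<longlonglongrightarrow> l" by auto
  moreover from this have "(\<lambda>m. g (r m) i) \<longlonglongrightarrow> l $ i" for i
    using tendsto_vec_nth[of "f \<circ> r" l sequentially i] by (simp add: f_def o_def)
  ultimately show ?thesis by (intro exI[of _ r] exI[of _ "\<lambda>i. l $ i"]) auto
qed

text \<open>The share \<open>c m / N m\<close> decreases to 0 as long as the class counted by \<open>c\<close> is not sampled, and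
  otherwise increases by at most \<open>1 / N m\<close>.\<close>

lemma share_eventually_le:
  fixes c N :: "nat \<Rightarrow> real"
  assumes c: "\<And>m. c (Suc m) = c m + (if P m then 1 else 0)" "\<And>m. 0 \<le> c m"
    and N: "\<And>m. N (Suc m) = N m + 1" "0 < N 0"
    and drift: "\<forall>\<^sub>F m in sequentially. s + \<delta> \<le> c m / N m \<longrightarrow> \<not> P m"
    and s: "0 \<le> s" "0 < \<delta>"
  shows "\<forall>\<^sub>F m in sequentially. c m / N m \<le> s + 2 * \<delta>"
proof -
  have N_eq: "N m = N 0 + m" for m by (induction m) (auto simp: N)
  have Npos: "0 < N m" for m using N(2) N_eq[of m] by simp
  have Ntop: "filterlim N at_top sequentially"
    by (subst ext[of N, OF N_eq]) (intro filterlim_tendsto_add_at_top[OF tendsto_const] filterlim_real_sequentially)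
  have "\<forall>\<^sub>F m in sequentially. 1 / \<delta> \<le> N m" using Ntop by (auto simp: filterlim_at_top)
  with drift have "\<forall>\<^sub>F m in sequentially. (s + \<delta> \<le> c m / N m \<longrightarrow> \<not> P m) \<and> 1 / \<delta> \<le> N m"
    by (rule eventually_conj)
  then obtain M where M: "\<And>m. m \<ge> M \<Longrightarrow> s + \<delta> \<le> c m / N m \<Longrightarrow> \<not> P m" "\<And>m. m \<ge> M \<Longrightarrow> 1 / \<delta> \<le> N m"
    by (auto simp: eventually_sequentially)
  have "\<exists>m\<ge>M. c m / N m < s + \<delta>"
  proof (rule ccontr)
    assume "\<not> ?thesis"
    then have *: "\<And>m. m \<ge> M \<Longrightarrow> s + \<delta> \<le> c m / N m" by (auto simp: not_less)
    have const: "c m = c M" if "m \<ge> M" for m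
      using that by (induction rule: dec_induct) (use M(1) * in \<open>auto simp: c\<close>)
    have "(\<lambda>m. c M / N m) \<longlonglongrightarrow> 0"
      by (intro tendsto_divide_0[OF tendsto_const] filterlim_at_top_imp_at_infinity Ntop)
    then have "\<forall>\<^sub>F m in sequentially. c M / N m < s + \<delta>" by (rule order_tendstoD) (use s in auto)
    then have "\<forall>\<^sub>F m in sequentially. c M / N m < s + \<delta> \<and> m \<ge> M"
      by (intro eventually_conj eventually_ge_at_top)
    then obtain m where "c M / N m < s + \<delta>" "m \<ge> M" using eventually_happens'[OF sequentially_bot] by blast
    then show False using *[of m] const[of m] by simp
  qed
  then obtain M' where M': "M' \<ge> M" "c M' / N M' < s + \<delta>" by blast
  \<comment> \<open>Once below \<open>s + \<delta>\<close>, the share can grow only from below that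
    level, and by at most \<open>1 / N m \<le> \<delta>\<close> at a time.\<close>
  have "c m / N m \<le> s + 2 * \<delta>" if "m \<ge> M'" for m
    using that
  proof (induction rule: dec_induct)
    case base
    then show ?case using M' s by simp
  next
    case (step m)
    have pos: "N m > 0" "N (Suc m) > 0" by (rule Npos)+
    have mM: "m \<ge> M" using step M' by simp
    have inv: "1 / N m \<le> \<delta>" using M(2)[OF mM] pos s by (simp add: field_simps)
    show ?case
    proof (cases "P m")
      case False
      then have "c (Suc m) / N (Suc m) \<le> c m / N m" using c pos by (simp add: N divide_left_mono)
      then show ?thesis using step.IH by linarith
    next
      case True
      then have "c m / N m < s + \<delta>" using M(1)[OF mM] by (auto simp: not_le[symmetric])
      moreover have "c (Suc m) / N (Suc m) \<le> (c m + 1) / N m"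
        using c(1)[of m] c(2)[of m] True pos by (simp add: N divide_left_mono)
      ultimately show ?thesis using inv by (simp add: add_divide_distrib)
    qed
  qed
  then show ?thesis by (auto simp: eventually_sequentially)
qed

text \<open>Optimality of a limit point is available only where the sign of \<open>G - 1\<close>
  matches the side on which its share of \<open>b\<close> lies. So the share of \<open>b\<close> is
  settled before the others; once it converges, either sign suffices.\<close>

lemma allocation_converges:
  fixes mh vh :: "nat \<Rightarrow> 'k::finite \<Rightarrow> real" and n :: "nat \<Rightarrow> 'k \<Rightarrow> nat" and I :: "nat \<Rightarrow> 'k" and b :: 'k
  defines "a \<equiv> \<lambda>m i. real (n m i) / real (\<Sum>j\<in>UNIV. n m j)"
  defines "G \<equiv> \<lambda>m. \<Sum>i\<in>UNIV - {b}. rate_Ustar (mh m) (vh m) (a m) b i / rate_U (mh m) (vh m) (a m) b i"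
  assumes card: "2 \<le> CARD('k)" and v: "\<And>i. 0 < v i" and b: "\<And>i. i \<noteq> b \<Longrightarrow> \<mu> i < \<mu> b"
    and mh: "\<And>i. (\<lambda>m. mh m i) \<longlonglongrightarrow> \<mu> i" and vh: "\<And>i. (\<lambda>m. vh m i) \<longlonglongrightarrow> v i"
    and n_Suc: "\<And>m i. n (Suc m) i = n m i + (if I (Suc m) = i then 1 else 0)"
    and n_pos: "\<And>m i. 1 \<le> n m i"
    and step: "\<forall>\<^sub>F m in sequentially. I (Suc m) = b \<longleftrightarrow> G m > 1"
    and gaps: "\<And>i j. i \<noteq> b \<Longrightarrow> j \<noteq> b \<Longrightarrow>
      (\<lambda>m. rate_W (mh m) (vh m) (a m) b i - rate_W (mh m) (vh m) (a m) b j) \<longlonglongrightarrow> 0"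
    and opt: "unique_optimal_allocation \<mu> v b astar"
  shows "(\<lambda>m. a m i) \<longlonglongrightarrow> astar i"
proof -
  define N where "N m = real (\<Sum>j\<in>UNIV. n m j)" for m
  have N_Suc: "N (Suc m) = N m + 1" for m
    by (simp add: N_def n_Suc sum.distrib)
  have npos: "0 < n m i" for m i using n_pos[of m i] by simp
  have Npos: "0 < N m" for m
    unfolding N_def using npos[of m] by (simp add: sum_pos del: of_nat_sum)
  have a_eq: "a m i = n m i / N m" for m i by (simp add: a_def N_def)
  have apos: "0 < a m i" for m i using npos Npos by (simp add: a_eq)
  have al: "a m \<in> allocations" for m
  proof -
    have "(\<Sum>i\<in>UNIV. a m i) = 1" using Npos[of m] by (simp add: a_eq flip: sum_divide_distrib) (simp add: N_def)
    then show ?thesis using apos[of m] by (auto simp: allocations_def intro: less_imp_le)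
  qed
  have a_le: "a m i \<le> 1" for m i
    using al[of m] member_le_sum[of i UNIV "a m"] by (auto simp: allocations_def)
  have "\<forall>\<^sub>F m in sequentially. \<forall>i\<in>UNIV. 0 < vh m i \<and> \<bar>mh m i\<bar> < \<bar>\<mu> i\<bar> + 1 \<and> (i \<noteq> b \<longrightarrow> mh m i < mh m b)"
  proof (intro eventually_ball_finite ballI eventually_conj)
    fix i
    show "\<forall>\<^sub>F m in sequentially. 0 < vh m i" by (rule order_tendstoD(1)[OF vh v])
    show "\<forall>\<^sub>F m in sequentially. \<bar>mh m i\<bar> < \<bar>\<mu> i\<bar> + 1"
      by (rule order_tendstoD(2)[OF tendsto_rabs[OF mh]]) simp
    show "\<forall>\<^sub>F m in sequentially. i \<noteq> b \<longrightarrow> mh m i < mh m b"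
    proof (cases "i = b")
      case False
      have "(\<lambda>m. mh m b - mh m i) \<longlonglongrightarrow> \<mu> b - \<mu> i" by (intro tendsto_diff mh)
      then have "\<forall>\<^sub>F m in sequentially. 0 < mh m b - mh m i"
        by (rule order_tendstoD) (use b[OF False] in simp)
      then show ?thesis by eventually_elim simp
    qed simp
  qed simp
  then obtain M0 where M0: "\<And>m i. m \<ge> M0 \<Longrightarrow> 0 < vh m i" "\<And>m i. m \<ge> M0 \<Longrightarrow> \<bar>mh m i\<bar> < \<bar>\<mu> i\<bar> + 1"
      "\<And>m i. m \<ge> M0 \<Longrightarrow> i \<noteq> b \<Longrightarrow> mh m i < mh m b"
    by (auto simp: eventually_sequentially)
  define \<phi> where "\<phi> m i = rate_argmin (mh m) (vh m) (a m) b i" for m i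
  define D where "D = (\<Sum>i\<in>UNIV. \<bar>\<mu> i\<bar> + 1)"
  have D: "\<bar>mh m i\<bar> \<le> D" if "m \<ge> M0" for m i
    using M0(2)[OF that, of i] member_le_sum[of i UNIV "\<lambda>i. \<bar>\<mu> i\<bar> + 1"] by (simp add: D_def)
  \<comment> \<open>\<open>V\<close> is \<open>a m b / 2\<close> times \<open>W\<close>, and this
    factor is at most 1, so the gaps of \<open>W\<close> control those of \<open>V\<close>.\<close>
  have gapsV: "(\<lambda>m. rate_V (mh m) (vh m) (a m) b i - rate_V (mh m) (vh m) (a m) b j) \<longlonglongrightarrow> 0"
    if "i \<noteq> b" "j \<noteq> b" for i j
  proof (rule Lim_null_comparison[OF _ tendsto_norm_zero[OF gaps[OF that]]])
    have "norm (rate_V (mh m) (vh m) (a m) b i - rate_V (mh m) (vh m) (a m) b j)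
        \<le> norm (rate_W (mh m) (vh m) (a m) b i - rate_W (mh m) (vh m) (a m) b j)" for m
    proof -
      have "rate_V (mh m) (vh m) (a m) b i - rate_V (mh m) (vh m) (a m) b j =
        a m b / 2 * (rate_W (mh m) (vh m) (a m) b i - rate_W (mh m) (vh m) (a m) b j)"
        using apos[of m b] by (simp add: rate_W_def field_simps)
      moreover have "\<bar>a m b / 2\<bar> \<le> 1" using apos[of m b] a_le[of m b] by simp
      moreover have "norm (c * y) \<le> norm y" if "\<bar>c\<bar> \<le> 1" for c y :: real
        using that by (simp add: abs_mult mult_left_le_one_le)
      ultimately show ?thesis by presburger
    qed
    then show "\<forall>\<^sub>F m in sequentially. norm (rate_V (mh m) (vh m) (a m) b i - rate_V (mh m) (vh m) (a m) b j)
        \<le> norm (rate_W (mh m) (vh m) (a m) b i - rate_W (mh m) (vh m) (a m) b j)" by simp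
  qed
  \<comment> \<open>The last part is an implication because \<open>\<alpha>\<close> is known only
    after two extractions, \<open>r1\<close> for the minimisers and \<open>r2\<close> for the
    allocations.\<close>
  have core: "\<exists>r' \<alpha>. strict_mono (r' :: nat \<Rightarrow> nat) \<and> (\<forall>i. (\<lambda>m. a (r (r' m)) i) \<longlonglongrightarrow> \<alpha> i) \<and>
     ((\<forall>m. G (r m) > 1) \<and> astar b \<le> \<alpha> b \<or> (\<forall>m. G (r m) \<le> 1) \<and> \<alpha> b \<le> astar b \<longrightarrow> \<alpha> = astar)"
    if r: "strict_mono (r :: nat \<Rightarrow> nat)" "\<And>m. r m \<ge> M0" for r
  proof -
    note am = rate_argmin_minimizes[of "vh (r m)" i b "a (r m)" "mh (r m)" for m i,
      OF M0(1)[OF r(2)] M0(1)[OF r(2)] apos apos, folded \<phi>_def]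
    \<comment> \<open>The value at \<open>b\<close> is a placeholder that keeps the function bounded
      on all designs.\<close>
    define \<phi>' where "\<phi>' m i = (if i = b then 0 else \<phi> m i)" for m i
    have "\<bar>\<phi>' (r m) i\<bar> \<le> D" for m i
      using am(2,3)[of m i] M0(3)[OF r(2), of i m] D[OF r(2), of m i] D[OF r(2), of m b]
      by (auto simp: \<phi>'_def abs_le_iff)
    from bounded_imp_pointwise_convergent_subseq[of "\<lambda>m. \<phi>' (r m)", OF this] obtain r1 p
      where r1: "strict_mono (r1 :: nat \<Rightarrow> nat)" "\<And>i. (\<lambda>m. \<phi>' (r (r1 m)) i) \<longlonglongrightarrow> p i" by auto
    have "\<bar>a (r (r1 m)) i\<bar> \<le> 1" for m i using apos a_le by (simp add: less_imp_le)
    from bounded_imp_pointwise_convergent_subseq[of "\<lambda>m. a (r (r1 m))", OF this] obtain r2 \<alpha>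
      where r2: "strict_mono (r2 :: nat \<Rightarrow> nat)" "\<And>i. (\<lambda>m. a (r (r1 (r2 m))) i) \<longlonglongrightarrow> \<alpha> i" by auto
    define q where "q m = r (r1 (r2 m))" for m
    have q: "strict_mono q" unfolding q_def using r r1 r2 by (auto simp: strict_mono_def)
    have qM: "q m \<ge> M0" for m by (simp add: q_def r)
    note sub = LIMSEQ_subseq_LIMSEQ[OF _ q, unfolded o_def]
    have \<phi>_lim: "(\<lambda>m. \<phi>' (q m) i) \<longlonglongrightarrow> p i" for i
      using LIMSEQ_subseq_LIMSEQ[OF r1(2) r2(1)] by (simp add: q_def o_def)
    have G_eq: "G m = (\<Sum>i\<in>UNIV - {b}. ln (1 + (mh m b - \<phi>' m i)\<^sup>2 / vh m b) / ln (1 + (mh m i - \<phi>' m i)\<^sup>2 / vh m i))" for m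
      unfolding G_def by (intro sum.cong) (auto simp: rate_U_def rate_Ustar_def \<phi>_def \<phi>'_def)
    have "\<alpha> = astar"
      if G1: "(\<forall>m. G (r m) > 1) \<and> astar b \<le> \<alpha> b \<or> (\<forall>m. G (r m) \<le> 1) \<and> \<alpha> b \<le> astar b"
    proof (rule limit_allocation_optimal[where mh="\<lambda>m. mh (q m)" and vh="\<lambda>m. vh (q m)" and a="\<lambda>m. a (q m)"
          and \<phi>="\<lambda>m. \<phi>' (q m)" and p=p, OF card v b sub[OF mh] sub[OF vh] al _ _ \<phi>_lim _ _ sub[OF gapsV] opt])
      show "(\<lambda>m. a (q m) i) \<longlonglongrightarrow> \<alpha> i" for i using r2(2) by (simp add: q_def)
    next
      fix m i x assume i: "i \<noteq> b"
      show "rate_obj (mh (q m)) (vh (q m)) (a (q m)) b i (\<phi>' (q m) i) \<le> rate_obj (mh (q m)) (vh (q m)) (a (q m)) b i x"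
        using am(1)[of "r1 (r2 m)" i] M0(3)[OF qM i] i by (simp add: q_def \<phi>'_def less_imp_le)
    next
      fix m i assume i: "i \<noteq> b"
      have "\<phi> (q m) i \<noteq> mh (q m) i"
        using M0(3)[OF qM i, of m] i
        by (intro rate_minimizer_neq_mean[of "vh (q m)" i b "a (q m)" "mh (q m)"] M0(1)[OF qM] apos)
          (use am(1)[of "r1 (r2 m)" i] in \<open>auto simp: q_def less_imp_le\<close>)
      then show "0 < ln (1 + (mh (q m) i - \<phi>' (q m) i)\<^sup>2 / vh (q m) i)"
        using M0(1)[OF qM, of m i] i by (intro ln_gt_zero) (simp add: \<phi>'_def)
    next
      fix m i
      show "0 \<le> ln (1 + (mh (q m) b - \<phi>' (q m) i)\<^sup>2 / vh (q m) b)"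
        using M0(1)[OF qM, of m b] by (intro ln_ge_zero) simp
    qed (use G1 in \<open>auto simp: G_eq q_def\<close>)
    then show ?thesis
      by (intro exI[of _ "\<lambda>m. r1 (r2 m)"] exI[of _ \<alpha>]) (use r1 r2 in \<open>auto simp: strict_mono_def\<close>)
  qed
  have eventually_not: "\<forall>\<^sub>F m in sequentially. \<not> P m"
    if "\<And>r. strict_mono (r :: nat \<Rightarrow> nat) \<Longrightarrow> (\<And>m. r m \<ge> M0) \<Longrightarrow> (\<And>m. P (r m)) \<Longrightarrow> False" for P
  proof (rule ccontr)
    assume "\<not> ?thesis"
    then have "infinite {m. P m}"
      by (simp add: not_eventually frequently_cofinite flip: cofinite_eq_sequentially)
    then have "infinite ({m. P m} - {..<M0})" by simp
    from infinite_enumerate[OF this] obtain r where "strict_mono (r :: nat \<Rightarrow> nat)" "\<And>m. r m \<in> {m. P m} - {..<M0}"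
      by blast
    then show False using that[of r] by (auto simp: not_less)
  qed
  \<comment> \<open>By \<open>core\<close> a limit point along such times would equal
    \<open>astar\<close>, yet its share of \<open>b\<close> is at least
    \<open>astar b + \<delta>\<close>.\<close>
  have high: "\<forall>\<^sub>F m in sequentially. \<not> (astar b + \<delta> \<le> a m b \<and> 1 < G m)" if \<delta>: "\<delta> > 0" for \<delta>
  proof (rule eventually_not)
    fix r assume r: "strict_mono (r :: nat \<Rightarrow> nat)" "\<And>m. r m \<ge> M0" "\<And>m. astar b + \<delta> \<le> a (r m) b \<and> 1 < G (r m)"
    obtain r' \<alpha> where *: "\<And>i. (\<lambda>m. a (r (r' m)) i) \<longlonglongrightarrow> \<alpha> i" "astar b \<le> \<alpha> b \<longrightarrow> \<alpha> = astar"
      using core[OF r(1,2)] r(3) by blast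
    have "astar b + \<delta> \<le> \<alpha> b" by (rule LIMSEQ_le_const[OF *(1)]) (use r in auto)
    then show False using * \<delta> by auto
  qed
  have low: "\<forall>\<^sub>F m in sequentially. \<not> (a m b \<le> astar b - \<delta> \<and> G m \<le> 1)" if \<delta>: "\<delta> > 0" for \<delta>
  proof (rule eventually_not)
    fix r assume r: "strict_mono (r :: nat \<Rightarrow> nat)" "\<And>m. r m \<ge> M0" "\<And>m. a (r m) b \<le> astar b - \<delta> \<and> G (r m) \<le> 1"
    obtain r' \<alpha> where *: "\<And>i. (\<lambda>m. a (r (r' m)) i) \<longlonglongrightarrow> \<alpha> i" "\<alpha> b \<le> astar b \<longrightarrow> \<alpha> = astar"
      using core[OF r(1,2)] r(3) by blast
    have "\<alpha> b \<le> astar b - \<delta>" by (rule LIMSEQ_le_const2[OF *(1)]) (use r in auto)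
    then show False using * \<delta> by auto
  qed
  have astar: "astar \<in> allocations" using opt by (simp add: unique_optimal_allocation_def)
  then have ab: "0 \<le> astar b" "astar b \<le> 1"
    using member_le_sum[of b UNIV astar] by (auto simp: allocations_def)
  have b_lim: "(\<lambda>m. a m b) \<longlonglongrightarrow> astar b"
  proof (rule LIMSEQ_I)
    fix \<epsilon> :: real assume \<epsilon>: "\<epsilon> > 0"
    define \<delta> where "\<delta> = \<epsilon> / 3"
    have \<delta>: "\<delta> > 0" "2 * \<delta> < \<epsilon>" using \<epsilon> by (auto simp: \<delta>_def)
    have "\<forall>\<^sub>F m in sequentially. real (n m b) / N m \<le> astar b + 2 * \<delta>"
    proof (rule share_eventually_le[where P="\<lambda>m. I (Suc m) = b"])
      show "\<forall>\<^sub>F m in sequentially. astar b + \<delta> \<le> real (n m b) / N m \<longrightarrow> I (Suc m) \<noteq> b"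
        using high[OF \<delta>(1)] step by eventually_elim (auto simp: a_eq)
    qed (use ab \<delta> N_Suc Npos n_Suc in auto)
    \<comment> \<open>The lower bound is the same drift lemma for the samples outside
      \<open>b\<close>, whose share is \<open>1 - a m b\<close>.\<close>
    moreover have "\<forall>\<^sub>F m in sequentially. (N m - real (n m b)) / N m \<le> (1 - astar b) + 2 * \<delta>"
    proof (rule share_eventually_le[where P="\<lambda>m. I (Suc m) \<noteq> b"])
      show "\<forall>\<^sub>F m in sequentially. (1 - astar b) + \<delta> \<le> (N m - real (n m b)) / N m \<longrightarrow> \<not> I (Suc m) \<noteq> b"
        using low[OF \<delta>(1)] step
      proof eventually_elim
        case (elim m)
        then show ?case using Npos[of m] by (auto simp: a_eq diff_divide_distrib not_le)
      qed
      show "0 \<le> N m - real (n m b)" for m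
        using member_le_sum[of b UNIV "n m"] by (simp add: N_def flip: of_nat_sum)
    qed (use ab \<delta> N_Suc Npos n_Suc in auto)
    ultimately have "\<forall>\<^sub>F m in sequentially. norm (a m b - astar b) < \<epsilon>"
    proof eventually_elim
      case (elim m)
      have "(N m - real (n m b)) / N m = 1 - a m b" using Npos[of m] by (simp add: a_eq diff_divide_distrib)
      with elim \<delta> show ?case by (simp add: a_eq abs_less_iff)
    qed
    then show "\<exists>no. \<forall>m\<ge>no. norm (a m b - astar b) < \<epsilon>" by (simp add: eventually_sequentially)
  qed
  have no_subseq: False
    if r: "strict_mono (r :: nat \<Rightarrow> nat)" "\<And>m. r m \<ge> M0" and far: "\<And>m. \<epsilon> \<le> norm (a (r m) i - astar i)" "\<epsilon> > 0"
      and G: "(\<forall>m. G (r m) > 1) \<or> (\<forall>m. G (r m) \<le> 1)" for r \<epsilon>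
  proof -
    obtain r' \<alpha> where r': "strict_mono r'" and *: "\<And>i. (\<lambda>m. a (r (r' m)) i) \<longlonglongrightarrow> \<alpha> i"
      "(\<forall>m. G (r m) > 1) \<and> astar b \<le> \<alpha> b \<or> (\<forall>m. G (r m) \<le> 1) \<and> \<alpha> b \<le> astar b \<longrightarrow> \<alpha> = astar"
      using core[OF r] by blast
    have "(\<lambda>m. a (r (r' m)) b) \<longlonglongrightarrow> astar b"
      using LIMSEQ_subseq_LIMSEQ[OF LIMSEQ_subseq_LIMSEQ[OF b_lim r(1)] r'] by (simp add: o_def)
    then have "\<alpha> b = astar b" using * LIMSEQ_unique by blast
    then have "\<alpha> = astar" using * G by auto
    moreover have "\<epsilon> \<le> norm (\<alpha> i - astar i)"
      by (rule LIMSEQ_le_const[OF tendsto_norm[OF tendsto_diff[OF *(1) tendsto_const]]]) (use far in auto)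
    ultimately show False using far by simp
  qed
  show ?thesis
  proof (rule LIMSEQ_I)
    fix \<epsilon> :: real assume \<epsilon>: "\<epsilon> > 0"
    have "\<forall>\<^sub>F m in sequentially. \<not> (\<epsilon> \<le> norm (a m i - astar i) \<and> G m > 1)"
      by (rule eventually_not) (use no_subseq \<epsilon> in blast)
    moreover have "\<forall>\<^sub>F m in sequentially. \<not> (\<epsilon> \<le> norm (a m i - astar i) \<and> G m \<le> 1)"
      by (rule eventually_not) (use no_subseq \<epsilon> in blast)
    ultimately have "\<forall>\<^sub>F m in sequentially. norm (a m i - astar i) < \<epsilon>" by eventually_elim auto
    then show "\<exists>no. \<forall>m\<ge>no. norm (a m i - astar i) < \<epsilon>" by (simp add: eventually_sequentially)
  qed
qed

section \<open>Laws of large numbers and excursions\<close>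

context prob_space
begin

text \<open>In the fourth power of \<open>S n + Y n\<close> the mixed terms with odd exponents have
  expectation 0, so the fourth moment of \<open>S n\<close> grows only like
  \<open>n\<^sup>2\<close>. The fourth moments of \<open>S n / n\<close> are then summable, and the
  terms of an almost surely convergent series tend to 0.\<close>

lemma strong_law_fourth_moment:
  fixes Y :: "nat \<Rightarrow> 'a \<Rightarrow> real"
  assumes ind: "indep_vars (\<lambda>_. borel) Y UNIV"
    and int4: "\<And>l. integrable M (\<lambda>\<omega>. Y l \<omega> ^ 4)"
    and mean: "\<And>l. expectation (Y l) = 0"
    and bound: "\<And>l. expectation (\<lambda>\<omega>. Y l \<omega> ^ 4) \<le> K"
  shows "AE \<omega> in M. (\<lambda>n. (\<Sum>l<n. Y l \<omega>) / n) \<longlonglongrightarrow> 0"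
proof -
  have rv[measurable]: "random_variable borel (Y l)" for l
    using ind by (auto simp: indep_vars_def)
  have pow_le: "\<bar>y ^ k\<bar> \<le> 1 + y ^ 4" if "k \<le> 4" for y :: real and k
  proof (cases "\<bar>y\<bar> \<le> 1")
    case True
    then have "\<bar>y\<bar> ^ k \<le> 1" by (intro power_le_one) auto
    moreover have "0 \<le> y ^ 4" by simp
    ultimately show ?thesis unfolding power_abs by linarith
  next
    case False
    then have "\<bar>y\<bar> ^ k \<le> \<bar>y\<bar> ^ 4" using that by (intro power_increasing) auto
    then show ?thesis unfolding power_abs by simp
  qed
  have int_pow: "integrable M (\<lambda>\<omega>. f \<omega> ^ k)"
    if "integrable M (\<lambda>\<omega>. f \<omega> ^ 4)" "f \<in> borel_measurable M" "k \<le> 4" for f :: "'a \<Rightarrow> real" and k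
  proof (rule Bochner_Integration.integrable_bound)
    show "integrable M (\<lambda>\<omega>. 1 + f \<omega> ^ 4)" using that by auto
    show "AE \<omega> in M. norm (f \<omega> ^ k) \<le> norm (1 + f \<omega> ^ 4)"
      using order_trans[OF pow_le[OF that(3)] abs_ge_self] by (auto simp del: power_abs)
  qed (use that in measurable)
  define S where "S n \<omega> = (\<Sum>l<n. Y l \<omega>)" for n \<omega>
  have S_rv[measurable]: "S n \<in> borel_measurable M" for n unfolding S_def by measurable
  have S_Suc: "S (Suc n) \<omega> = S n \<omega> + Y n \<omega>" for n \<omega> by (simp add: S_def)
  have indS: "indep_var borel (Y n) borel (S n)" for n
  proof -
    have "S n = (\<lambda>\<omega>. \<Sum>l\<in>{..<n}. Y l \<omega>)" by (simp add: S_def fun_eq_iff)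
    then show ?thesis
      using indep_vars_sum[of "{..<n}" n Y] indep_vars_subset[OF ind, of "insert n {..<n}"] by simp
  qed
  have prod: "integrable M (\<lambda>\<omega>. Y n \<omega> ^ j * S n \<omega> ^ k)"
    "expectation (\<lambda>\<omega>. Y n \<omega> ^ j * S n \<omega> ^ k) = expectation (\<lambda>\<omega>. Y n \<omega> ^ j) * expectation (\<lambda>\<omega>. S n \<omega> ^ k)"
    if "integrable M (\<lambda>\<omega>. S n \<omega> ^ 4)" "j \<le> 4" "k \<le> 4" for n j k
  proof -
    have i: "indep_var borel (\<lambda>\<omega>. Y n \<omega> ^ j) borel (\<lambda>\<omega>. S n \<omega> ^ k)"
      using indep_var_compose[OF indS, of "\<lambda>x. x ^ j" borel "\<lambda>x. x ^ k" borel n] by (simp add: o_def)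
    show "integrable M (\<lambda>\<omega>. Y n \<omega> ^ j * S n \<omega> ^ k)"
      by (rule indep_var_integrable[OF i int_pow int_pow]) (use int4 that in auto)
    show "expectation (\<lambda>\<omega>. Y n \<omega> ^ j * S n \<omega> ^ k) = expectation (\<lambda>\<omega>. Y n \<omega> ^ j) * expectation (\<lambda>\<omega>. S n \<omega> ^ k)"
      by (rule indep_var_lebesgue_integral[OF i int_pow int_pow]) (use int4 that in auto)
  qed
  \<comment> \<open>\<open>c\<close> bounds the second moments because
    \<open>y\<^sup>2 \<le> 1 + y ^ 4\<close>, and since \<open>c \<ge> 1\<close> its square bounds
    the fourth moments; one constant serves the induction.\<close>
  define c where "c = K + 1"
  have "0 \<le> expectation (\<lambda>\<omega>. Y 0 \<omega> ^ 4)" by (intro integral_nonneg_AE) auto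
  then have c1: "1 \<le> c" using bound[of 0] unfolding c_def by linarith
  have Y2: "expectation (\<lambda>\<omega>. Y l \<omega> ^ 2) \<le> c" for l
  proof -
    have "expectation (\<lambda>\<omega>. Y l \<omega> ^ 2) \<le> expectation (\<lambda>\<omega>. 1 + Y l \<omega> ^ 4)"
    proof (intro integral_mono)
      show "Y l \<omega> ^ 2 \<le> 1 + Y l \<omega> ^ 4" for \<omega> using pow_le[of 2 "Y l \<omega>"] by simp
    qed (use int_pow[OF int4] int4 in auto)
    also have "\<dots> = 1 + expectation (\<lambda>\<omega>. Y l \<omega> ^ 4)" using int4 by (simp add: prob_space)
    finally show ?thesis using bound[of l] by (simp add: c_def)
  qed
  have Y4: "expectation (\<lambda>\<omega>. Y l \<omega> ^ 4) \<le> c\<^sup>2" for l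
  proof -
    have "c \<le> c\<^sup>2" using c1 by (simp add: power2_eq_square)
    then show ?thesis using bound[of l] by (simp add: c_def)
  qed
  \<comment> \<open>The induction step adds at most \<open>6 * n + 1\<close> multiples of
    \<open>c\<^sup>2\<close>, where the claim leaves room for \<open>6 * n + 3\<close>.\<close>
  have moments: "integrable M (\<lambda>\<omega>. S n \<omega> ^ 4) \<and> expectation (S n) = 0 \<and>
    expectation (\<lambda>\<omega>. S n \<omega> ^ 2) \<le> n * c \<and> expectation (\<lambda>\<omega>. S n \<omega> ^ 4) \<le> 3 * n\<^sup>2 * c\<^sup>2" for n
  proof (induction n)
    case 0
    then show ?case by (simp add: S_def)
  next
    case (Suc n)
    then have int: "integrable M (\<lambda>\<omega>. S n \<omega> ^ 4)" and E1: "expectation (S n) = 0"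
      and E2: "expectation (\<lambda>\<omega>. S n \<omega> ^ 2) \<le> n * c" and E4: "expectation (\<lambda>\<omega>. S n \<omega> ^ 4) \<le> 3 * n\<^sup>2 * c\<^sup>2" by auto
    note iS = int_pow[OF int S_rv] and iY = int_pow[OF int4 rv, of _ n]
    have iS1: "integrable M (S n)" and iY1: "integrable M (Y n)" using iS[of 1] iY[of 1] by simp_all
    note p = prod[OF int]
    have e2: "S (Suc n) \<omega> ^ 2 = S n \<omega> ^ 2 + 2 * (Y n \<omega> ^ 1 * S n \<omega> ^ 1) + Y n \<omega> ^ 2" for \<omega>
      unfolding S_Suc by (simp add: power2_eq_square algebra_simps)
    have e4: "S (Suc n) \<omega> ^ 4 = S n \<omega> ^ 4 + 4 * (Y n \<omega> ^ 1 * S n \<omega> ^ 3) + 6 * (Y n \<omega> ^ 2 * S n \<omega> ^ 2)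
        + 4 * (Y n \<omega> ^ 3 * S n \<omega> ^ 1) + Y n \<omega> ^ 4" for \<omega>
      unfolding S_Suc by (simp add: power4_eq_xxxx power3_eq_cube power2_eq_square algebra_simps)
    have I4: "integrable M (\<lambda>\<omega>. S (Suc n) \<omega> ^ 4)"
      unfolding e4 by (intro Bochner_Integration.integrable_add integrable_mult_right p iS iY) auto
    have "expectation (\<lambda>\<omega>. S (Suc n) \<omega> ^ 2) = expectation (\<lambda>\<omega>. S n \<omega> ^ 2)
        + 2 * (expectation (\<lambda>\<omega>. Y n \<omega> ^ 1) * expectation (\<lambda>\<omega>. S n \<omega> ^ 1)) + expectation (\<lambda>\<omega>. Y n \<omega> ^ 2)"
      unfolding e2 using p(1)[of 1 1] p(2)[of 1 1] iS[of 2] iY[of 2] by simp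
    also have "\<dots> \<le> Suc n * c" using E2 Y2[of n] mean[of n] by (simp add: algebra_simps)
    finally have E2': "expectation (\<lambda>\<omega>. S (Suc n) \<omega> ^ 2) \<le> Suc n * c" .
    have "expectation (\<lambda>\<omega>. S (Suc n) \<omega> ^ 4) = expectation (\<lambda>\<omega>. S n \<omega> ^ 4)
        + 4 * (expectation (\<lambda>\<omega>. Y n \<omega> ^ 1) * expectation (\<lambda>\<omega>. S n \<omega> ^ 3))
        + 6 * (expectation (\<lambda>\<omega>. Y n \<omega> ^ 2) * expectation (\<lambda>\<omega>. S n \<omega> ^ 2))
        + 4 * (expectation (\<lambda>\<omega>. Y n \<omega> ^ 3) * expectation (\<lambda>\<omega>. S n \<omega> ^ 1)) + expectation (\<lambda>\<omega>. Y n \<omega> ^ 4)"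
      unfolding e4 p(2)[of 1 3, symmetric, simplified] p(2)[of 2 2, symmetric, simplified] p(2)[of 3 1, symmetric, simplified]
      using p(1)[of 1 3] p(1)[of 2 2] p(1)[of 3 1] p(2)[of 1 3] p(2)[of 2 2] p(2)[of 3 1] int int4[of n] by simp
    also have "\<dots> \<le> 3 * n\<^sup>2 * c\<^sup>2 + 6 * (c * (n * c)) + c\<^sup>2"
      using E4 Y4[of n] mean[of n] E1 mult_mono[OF Y2[of n] E2] c1 by simp
    also have "\<dots> \<le> 3 * (Suc n)\<^sup>2 * c\<^sup>2" by (simp add: power2_eq_square algebra_simps)
    finally have "expectation (\<lambda>\<omega>. S (Suc n) \<omega> ^ 4) \<le> 3 * (Suc n)\<^sup>2 * c\<^sup>2" .
    moreover have "expectation (S (Suc n)) = 0" using E1 mean[of n] iS1 iY1 by (simp add: S_Suc[abs_def])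
    ultimately show ?case using I4 E2' by simp
  qed
  have "(\<integral>\<^sup>+\<omega>. (\<Sum>n. ennreal ((S n \<omega> / n) ^ 4)) \<partial>M) = (\<Sum>n. \<integral>\<^sup>+\<omega>. ennreal ((S n \<omega> / n) ^ 4) \<partial>M)"
    by (intro nn_integral_suminf) measurable
  also have "\<dots> \<le> (\<Sum>n. ennreal (3 * c\<^sup>2 * (1 / real n ^ 2)))"
  proof (intro suminf_le)
    fix n
    have "(\<integral>\<^sup>+\<omega>. ennreal ((S n \<omega> / n) ^ 4) \<partial>M) = ennreal (expectation (\<lambda>\<omega>. (S n \<omega> / n) ^ 4))"
      using moments[of n] by (intro nn_integral_eq_integral) (auto simp: power_divide)
    also have "expectation (\<lambda>\<omega>. (S n \<omega> / n) ^ 4) \<le> 3 * real n ^ 2 * c\<^sup>2 / real n ^ 4"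
      using moments[of n] by (simp add: power_divide divide_right_mono)
    also have "\<dots> = 3 * c\<^sup>2 * (1 / real n ^ 2)"
      by (cases "n = 0") (simp_all add: field_simps power4_eq_xxxx power2_eq_square)
    finally show "(\<integral>\<^sup>+\<omega>. ennreal ((S n \<omega> / n) ^ 4) \<partial>M) \<le> ennreal (3 * c\<^sup>2 * (1 / real n ^ 2))"
      by (simp add: ennreal_leI)
  qed auto
  also have "\<dots> < \<infinity>"
  proof -
    have "summable (\<lambda>n. 3 * c\<^sup>2 * (1 / real n ^ 2))"
      using inverse_power_summable[of 2, where 'a=real] by (intro summable_mult) (simp add: field_simps inverse_eq_divide)
    then show ?thesis by (subst suminf_ennreal2) auto
  qed
  finally have "AE \<omega> in M. (\<Sum>n. ennreal ((S n \<omega> / n) ^ 4)) \<noteq> \<infinity>"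
    by (intro nn_integral_PInf_AE) auto
  then show ?thesis
  proof eventually_elim
    case (elim \<omega>)
    then have "summable (\<lambda>n. (S n \<omega> / n) ^ 4)"
      by (intro summable_suminf_not_top) auto
    then have "(\<lambda>n. (S n \<omega> / n) ^ 4) \<longlonglongrightarrow> 0" by (rule summable_LIMSEQ_zero)
    then show ?case by (simp add: power_tendsto_0_iff S_def del: power_divide)
  qed
qed

text \<open>Stopping the partial sums once they leave \<open>[-c, c]\<close> turns the maximal inequality into
  Chebyshev's inequality for the stopped sum.\<close>

primrec stopped_sum :: "real \<Rightarrow> (nat \<Rightarrow> real) \<Rightarrow> nat \<Rightarrow> real" where
  "stopped_sum c y 0 = 0"
| "stopped_sum c y (Suc k) = stopped_sum c y k + (if \<bar>stopped_sum c y k\<bar> \<le> c then y k else 0)"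

lemma Kolmogorov_maximal_inequality:
  fixes Y :: "nat \<Rightarrow> 'a \<Rightarrow> real" and n :: nat and s c :: real
  assumes ind: "indep_vars (\<lambda>_. borel) Y UNIV"
    and int2: "\<And>l. integrable M (\<lambda>\<omega>. Y l \<omega> ^ 2)"
    and mean: "\<And>l. expectation (Y l) = 0"
    and var: "\<And>l. expectation (\<lambda>\<omega>. Y l \<omega> ^ 2) \<le> s"
    and c: "0 < c"
  shows "prob {\<omega>\<in>space M. \<exists>k\<le>n. c < \<bar>\<Sum>l<k. Y l \<omega>\<bar>} \<le> n * s / c\<^sup>2"
proof -
  have rv[measurable]: "random_variable borel (Y l)" for l
    using ind by (auto simp: indep_vars_def)
  define T where "T k \<omega> = stopped_sum c (\<lambda>l. Y l \<omega>) k" for k \<omega>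
  have T_Suc: "T (Suc k) \<omega> = T k \<omega> + (if \<bar>T k \<omega>\<bar> \<le> c then Y k \<omega> else 0)" for k \<omega> by (simp add: T_def)
  have T_rv[measurable]: "T k \<in> borel_measurable M" for k
  proof (induction k)
    case 0
    have "T 0 = (\<lambda>_. 0)" by (simp add: T_def fun_eq_iff)
    then show ?case by simp
  next
    case (Suc k)
    note Suc[measurable]
    show ?case unfolding T_Suc[abs_def] by measurable
  qed
  have cong: "stopped_sum c y k = stopped_sum c y' k" if "\<And>l. l < k \<Longrightarrow> y l = y' l" for y y' k
    using that by (induction k) auto
  have meas: "(\<lambda>y. stopped_sum c y k) \<in> borel_measurable (PiM {..<n} (\<lambda>_. borel))" if "k \<le> n" for k n
    using that
  proof (induction k)
    case (Suc k)
    then have [measurable]: "(\<lambda>y. stopped_sum c y k) \<in> borel_measurable (PiM {..<n} (\<lambda>_. borel))" by simp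
    have [measurable]: "(\<lambda>y. y k) \<in> borel_measurable (PiM {..<n} (\<lambda>_. borel))"
      using Suc by (intro measurable_component_singleton) auto
    show ?case by simp
  qed simp
  have indT: "indep_var borel (Y k) borel (T k)" for k
  proof -
    have *: "indep_var (PiM {k} (\<lambda>_. borel)) (\<lambda>\<omega>. restrict (\<lambda>i. Y i \<omega>) {k}) (PiM {..<k} (\<lambda>_. borel)) (\<lambda>\<omega>. restrict (\<lambda>i. Y i \<omega>) {..<k})"
      by (rule indep_var_restrict[OF ind]) auto
    have "indep_var borel ((\<lambda>f. f k) \<circ> (\<lambda>\<omega>. restrict (\<lambda>i. Y i \<omega>) {k})) borel
        ((\<lambda>f. stopped_sum c f k) \<circ> (\<lambda>\<omega>. restrict (\<lambda>i. Y i \<omega>) {..<k}))"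
      by (rule indep_var_compose[OF * _ meas]) auto
    moreover have "stopped_sum c (restrict (\<lambda>i. Y i \<omega>) {..<k}) k = T k \<omega>" for \<omega>
      unfolding T_def by (rule cong) simp
    ultimately show ?thesis by (simp add: o_def cong del: if_weak_cong)
  qed
  \<comment> \<open>\<open>g\<close> carries the stopping into the cross term:
    \<open>g (T k \<omega>)\<close> is bounded and independent of the centred \<open>Y k\<close>, so
    their product is integrable with expectation 0.\<close>
  define g where "g x = (if \<bar>x\<bar> \<le> c then x else 0)" for x :: real
  have [measurable]: "g \<in> borel_measurable borel" unfolding g_def by measurable
  have intY: "integrable M (Y l)" for l
    by (rule square_integrable_imp_integrable[OF rv int2])
  have second: "integrable M (\<lambda>\<omega>. T k \<omega> ^ 2) \<and> expectation (\<lambda>\<omega>. T k \<omega> ^ 2) \<le> k * s" for k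
  proof (induction k)
    case 0
    then show ?case by (simp add: T_def)
  next
    case (Suc k)
    have ig: "integrable M (\<lambda>\<omega>. g (T k \<omega>))"
      using c by (intro integrable_const_bound[of _ c]) (auto simp: g_def)
    have "indep_var borel (Y k) borel (\<lambda>\<omega>. g (T k \<omega>))"
      using indep_var_compose[OF indT, of "\<lambda>x. x" borel g borel k] by (simp add: o_def)
    from indep_var_integrable[OF this intY ig] indep_var_lebesgue_integral[OF this intY ig]
    have iYg: "integrable M (\<lambda>\<omega>. Y k \<omega> * g (T k \<omega>))" and EYg: "expectation (\<lambda>\<omega>. Y k \<omega> * g (T k \<omega>)) = 0"
      using mean by auto
    have iT: "integrable M (\<lambda>\<omega>. T k \<omega> ^ 2)" using Suc by simp
    have le: "T (Suc k) \<omega> ^ 2 \<le> T k \<omega> ^ 2 + 2 * (Y k \<omega> * g (T k \<omega>)) + Y k \<omega> ^ 2" for \<omega>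
      by (auto simp: T_Suc g_def power2_eq_square algebra_simps)
    have iR: "integrable M (\<lambda>\<omega>. T k \<omega> ^ 2 + 2 * (Y k \<omega> * g (T k \<omega>)) + Y k \<omega> ^ 2)"
      using iT iYg int2 by (intro Bochner_Integration.integrable_add integrable_mult_right) auto
    have i': "integrable M (\<lambda>\<omega>. T (Suc k) \<omega> ^ 2)"
      by (rule Bochner_Integration.integrable_bound[OF iR])
        (use le order_trans[OF le abs_ge_self] in auto)
    have "expectation (\<lambda>\<omega>. T (Suc k) \<omega> ^ 2) \<le> expectation (\<lambda>\<omega>. T k \<omega> ^ 2 + 2 * (Y k \<omega> * g (T k \<omega>)) + Y k \<omega> ^ 2)"
      by (intro integral_mono i' iR le)
    also have "\<dots> = expectation (\<lambda>\<omega>. T k \<omega> ^ 2) + expectation (\<lambda>\<omega>. Y k \<omega> ^ 2)"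
      using iT iYg int2 EYg by simp
    also have "\<dots> \<le> Suc k * s" using Suc var[of k] by (simp add: algebra_simps)
    finally show ?case using i' by simp
  qed
  \<comment> \<open>At the first exit the stopped sum still agrees with the partial sum, and from
    then on it does not move.\<close>
  have exit: "c < \<bar>T n \<omega>\<bar>" if k: "k \<le> n" "c < \<bar>\<Sum>l<k. Y l \<omega>\<bar>" for k :: nat and \<omega>
  proof -
    define k0 where "k0 = (LEAST k. c < \<bar>\<Sum>l<k. Y l \<omega>\<bar>)"
    have k0: "c < \<bar>\<Sum>l<k0. Y l \<omega>\<bar>" unfolding k0_def by (rule LeastI[of _ k]) (rule k)
    have less: "\<bar>\<Sum>l<j. Y l \<omega>\<bar> \<le> c" if "j < k0" for j
      using not_less_Least[of j "\<lambda>k. c < \<bar>\<Sum>l<k. Y l \<omega>\<bar>"] that by (simp add: k0_def not_less)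
    have "T j \<omega> = (\<Sum>l<j. Y l \<omega>)" if "j \<le> k0" for j
      using that
    proof (induction j)
      case (Suc j)
      then show ?case using less[of j] by (simp add: T_Suc)
    qed (simp add: T_def)
    then have "c < \<bar>T k0 \<omega>\<bar>" using k0 by simp
    moreover have "k0 \<le> n" using Least_le[of "\<lambda>k. c < \<bar>\<Sum>l<k. Y l \<omega>\<bar>" k] k by (simp add: k0_def)
    ultimately show ?thesis by (induction rule: dec_induct[OF \<open>k0 \<le> n\<close>]) (auto simp: T_Suc)
  qed
  have "prob {\<omega>\<in>space M. \<exists>k\<le>n. c < \<bar>\<Sum>l<k. Y l \<omega>\<bar>} \<le> prob {\<omega>\<in>space M. c\<^sup>2 \<le> T n \<omega> ^ 2}"
  proof (rule finite_measure_mono)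
    show "{\<omega>\<in>space M. \<exists>k\<le>n. c < \<bar>\<Sum>l<k. Y l \<omega>\<bar>} \<subseteq> {\<omega>\<in>space M. c\<^sup>2 \<le> T n \<omega> ^ 2}"
    proof safe
      fix \<omega> k assume "k \<le> n" "c < \<bar>\<Sum>l<k. Y l \<omega>\<bar>"
      from exit[OF this] have "\<bar>c\<bar> \<le> \<bar>T n \<omega>\<bar>" using c by simp
      then show "c\<^sup>2 \<le> T n \<omega> ^ 2" by (simp only: abs_le_square_iff)
    qed
  qed measurable
  also have "\<dots> \<le> expectation (\<lambda>\<omega>. T n \<omega> ^ 2) / c\<^sup>2"
    using second[of n] c by (intro integral_Markov_inequality_measure[of _ _ "space M"]) auto
  also have "\<dots> \<le> n * s / c\<^sup>2" using second[of n] by (intro divide_right_mono) auto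
  finally show ?thesis .
qed

text \<open>On the nonnegative half-line the centred normal density decreases, so on the interval it
  is at least its value at \<open>b\<close>.\<close>

lemma normal_interval_prob_ge:
  assumes Z: "distributed M lborel Z (normal_density 0 \<tau>)" and "0 < \<tau>" "0 \<le> a" "a \<le> b"
  shows "(b - a) * normal_density 0 \<tau> b \<le> prob {\<omega>\<in>space M. Z \<omega> \<in> {a..b}}"
proof -
  have [measurable]: "Z \<in> borel_measurable M" using distributed_measurable[OF Z] by simp
  have mono: "normal_density 0 \<tau> b \<le> normal_density 0 \<tau> x" if "x \<in> {a..b}" for x
    unfolding normal_density_def using assms that
    by (intro mult_left_mono) (auto intro!: divide_right_mono power_mono)
  have "ennreal ((b - a) * normal_density 0 \<tau> b) = (\<integral>\<^sup>+x. ennreal (normal_density 0 \<tau> b) * indicator {a..b} x \<partial>lborel)"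
    using assms by (simp add: nn_integral_cmult_indicator ennreal_mult mult.commute)
  also have "\<dots> \<le> (\<integral>\<^sup>+x. ennreal (normal_density 0 \<tau> x) * indicator {a..b} x \<partial>lborel)"
    using mono by (intro nn_integral_mono) (auto split: split_indicator intro!: ennreal_leI)
  also have "\<dots> = emeasure M (Z -` {a..b} \<inter> space M)"
    by (rule distributed_emeasure[OF Z, symmetric]) simp
  also have "Z -` {a..b} \<inter> space M = {\<omega>\<in>space M. Z \<omega> \<in> {a..b}}" by auto
  finally show ?thesis by (simp add: emeasure_eq_measure)
qed

text \<open>Continuity from above gives the limsup event a probability of at least \<open>p\<close>,
  and the zero-one law of Borel lifts a positive probability to 1.\<close>

lemma infinitely_often_of_indep_events:
  assumes ind: "indep_events (\<lambda>r. {\<omega>\<in>space M. E r \<omega>}) (UNIV :: nat set)"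
    and p: "0 < p" "\<And>r. p \<le> prob {\<omega>\<in>space M. E r \<omega>}"
  shows "AE \<omega> in M. infinite {r. E r \<omega>}"
proof -
  have [measurable]: "{\<omega>\<in>space M. E r \<omega>} \<in> events" for r
    using ind by (auto simp: indep_events_def)
  define U where "U n = (\<Union>r\<in>{n..}. {\<omega>\<in>space M. E r \<omega>})" for n
  have [measurable]: "U n \<in> events" for n unfolding U_def by measurable
  have "decseq U" unfolding U_def by (intro decseq_SucI UN_mono) auto
  then have "(\<lambda>n. prob (U n)) \<longlonglongrightarrow> prob (\<Inter>n. U n)"
    by (intro finite_Lim_measure_decseq) auto
  moreover have "p \<le> prob (U n)" for n
  proof -
    have "prob {\<omega>\<in>space M. E n \<omega>} \<le> prob (U n)" by (rule finite_measure_mono) (auto simp: U_def)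
    then show ?thesis using p(2)[of n] by linarith
  qed
  ultimately have "p \<le> prob (\<Inter>n. U n)" by (intro LIMSEQ_le_const) auto
  moreover have "(\<Inter>n. U n) = {\<omega>\<in>space M. infinite {r. E r \<omega>}}"
    by (auto simp: U_def infinite_nat_iff_unbounded_le)
  ultimately have "0 < prob {\<omega>\<in>space M. infinite {r. E r \<omega>}}" using p by simp
  then have "\<not> (AE \<omega> in M. finite {r. E r \<omega>})"
    by (auto simp: AE_iff_measurable[OF _ refl] measure_def)
  then show ?thesis using borel_0_1_law_AE[OF ind] by blast
qed

lemma indep_vars_reindex:
  assumes ind: "indep_vars (\<lambda>_. borel) Y UNIV" and f: "inj f"
  shows "indep_vars (\<lambda>_. borel) (\<lambda>l. Y (f l)) UNIV"
proof -
  have "indep_vars (\<lambda>l. PiM {f l} (\<lambda>_. borel)) (\<lambda>l \<omega>. restrict (\<lambda>p. Y p \<omega>) {f l}) UNIV"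
    using f by (intro indep_vars_restrict[OF ind]) (auto simp: disjoint_family_on_def inj_eq)
  from indep_vars_compose2[OF this, where N="\<lambda>_. borel" and Y="\<lambda>l y. y (f l)"] show ?thesis
    by simp
qed

text \<open>Budget in units of \<open>A i * sqrt N\<close>: the head block lands between 1.2 and
  1.6, the earlier samples and the running sum of the tail move the total by at most 0.1 each, and
  the result stays between 1 and 2. The head events have probabilities bounded below uniformly in
  the scale. The factor 200 brings the Kolmogorov bound for the tail down to
  \<open>100 * L * v i / (A i)\<^sup>2 \<le> 1 / 2\<close>.\<close>

lemma excursions_infinitely_often:
  fixes Y :: "'k::finite \<times> nat \<Rightarrow> 'a \<Rightarrow> real" and L :: nat and A v :: "'k \<Rightarrow> real"
  assumes ind: "indep_vars (\<lambda>_. borel) Y UNIV"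
    and normal: "\<And>i l. distributed M lborel (Y (i, l)) (normal_density 0 (sqrt (v i)))"
    and v: "\<And>i. 0 < v i"
    and slln: "\<And>i. AE \<omega> in M. (\<lambda>n. (\<Sum>l<n. Y (i, l) \<omega>) / n) \<longlonglongrightarrow> 0"
    and L: "1 \<le> L" and A: "\<And>i. 1 \<le> A i" "\<And>i. 200 * L * v i \<le> (A i)\<^sup>2"
  shows "AE \<omega> in M. \<exists>\<^sub>\<infinity>N. \<forall>i. \<forall>k\<in>{N..L * N}.
    A i * sqrt N \<le> (\<Sum>l<k. Y (i, l) \<omega>) \<and> (\<Sum>l<k. Y (i, l) \<omega>) \<le> 2 * A i * sqrt N"
proof -
  have rv[measurable]: "random_variable borel (Y p)" for p
    using ind by (cases p) (auto simp: indep_vars_def)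
  text \<open>The scales grow so fast that the \<open>L * N r\<close> samples before the next scale contribute at most
    \<open>sqrt (N (Suc r)) / 10\<close> to the sums; the events at different scales concern disjoint blocks of samples.\<close>
  define N where "N = rec_nat 1 (\<lambda>_ n. (10 * L * n)\<^sup>2)"
  have N0: "N 0 = 1" and N_Suc: "N (Suc r) = (10 * L * N r)\<^sup>2" for r by (simp_all add: N_def)
  have N_pos: "1 \<le> N r" for r
  proof (induction r)
    case (Suc r)
    then show ?case using L by (simp add: N_Suc Suc_le_eq)
  qed (simp add: N0)
  have N_growth: "2 * (L * N r) \<le> N (Suc r)" for r
  proof -
    have "N (Suc r) = 100 * ((L * N r) * (L * N r))" by (simp add: N_Suc power2_eq_square mult_ac)
    moreover have "L * N r \<le> (L * N r) * (L * N r)" by (rule le_square)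
    ultimately show ?thesis by linarith
  qed
  have LN: "L * N r \<le> L * N (Suc r)" "N r \<le> L * N r" "L * N r < N (Suc r)" for r
  proof -
    show "N r \<le> L * N r" for r using L by simp
    then have "0 < L * N r" using N_pos[of r] by (metis less_le_trans zero_less_one)
    then show l: "L * N r < N (Suc r)" using N_growth[of r] by linarith
    show "L * N r \<le> L * N (Suc r)" using l \<open>N (Suc r) \<le> L * N (Suc r)\<close> by linarith
  qed
  have sqrtN: "sqrt (N (Suc r)) = 10 * (L * N r)" for r
    by (simp add: N_Suc del: of_nat_mult of_nat_power) (simp add: real_sqrt_abs)
  define head where "head r i f \<longleftrightarrow> (\<Sum>l\<in>{L * N r..<N (Suc r)}. f (i, l)) \<in> {12 / 10 * A i * sqrt (N (Suc r))..16 / 10 * A i * sqrt (N (Suc r))}"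
    for r and i :: 'k and f :: "'k \<times> nat \<Rightarrow> real"
  define tail where "tail r i f \<longleftrightarrow> (\<forall>k\<in>{..(L - 1) * N (Suc r)}. \<bar>\<Sum>l<k. f (i, N (Suc r) + l)\<bar> \<le> 1 / 10 * A i * sqrt (N (Suc r)))"
    for r and i :: 'k and f :: "'k \<times> nat \<Rightarrow> real"
  define E where "E r f \<longleftrightarrow> (\<forall>i. head r i f \<and> tail r i f)" for r and f :: "'k \<times> nat \<Rightarrow> real"
  define K where "K r = (UNIV :: 'k set) \<times> {L * N r..<L * N (Suc r)}" for r
  define H where "H r i = {i :: 'k} \<times> {L * N r..<N (Suc r)}" for r i
  define T where "T r i = {i :: 'k} \<times> {N (Suc r)..<L * N (Suc r)}" for r i
  have LL: "N (Suc r) + (L - 1) * N (Suc r) = L * N (Suc r)" for r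
    using L by (metis add_mult_distrib le_add_diff_inverse mult_1)
  have head_cong: "head r i f \<longleftrightarrow> head r i g" if "\<And>p. p \<in> H r i \<Longrightarrow> f p = g p" for r i f g
    unfolding head_def using that by (simp add: H_def)
  have tail_cong: "tail r i f \<longleftrightarrow> tail r i g" if "\<And>p. p \<in> T r i \<Longrightarrow> f p = g p" for r i f g
  proof -
    have "(\<Sum>l<k. f (i, N (Suc r) + l)) = (\<Sum>l<k. g (i, N (Suc r) + l))" if "k \<le> (L - 1) * N (Suc r)" for k
    proof (rule sum.cong)
      fix l assume "l \<in> {..<k}"
      then have "N (Suc r) + l < L * N (Suc r)" using that LL[of r] by simp
      then show "f (i, N (Suc r) + l) = g (i, N (Suc r) + l)" by (intro \<open>\<And>p. p \<in> T r i \<Longrightarrow> f p = g p\<close>) (simp add: T_def)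
    qed simp
    then show ?thesis unfolding tail_def by simp
  qed
  have HT: "H r i \<subseteq> K r" "T r i \<subseteq> K r" for r i
  proof -
    have "l < L * N (Suc r)" if "l < N (Suc r)" for l using that LN(2)[of "Suc r"] by linarith
    moreover have "L * N r \<le> l" if "N (Suc r) \<le> l" for l using that LN(3)[of r] by linarith
    ultimately show "H r i \<subseteq> K r" "T r i \<subseteq> K r" by (auto simp: H_def T_def K_def)
  qed
  have head_meas: "{f \<in> space (PiM J (\<lambda>_. borel)). head r i f} \<in> sets (PiM J (\<lambda>_. borel))" if "H r i \<subseteq> J" for r i J
  proof -
    have [measurable]: "(\<lambda>f. f (i, l) :: real) \<in> borel_measurable (PiM J (\<lambda>_. borel))" if "l \<in> {L * N r..<N (Suc r)}" for l
      using that \<open>H r i \<subseteq> J\<close> by (intro measurable_component_singleton) (auto simp: H_def)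
    show ?thesis unfolding head_def by measurable
  qed
  have tail_meas: "{f \<in> space (PiM J (\<lambda>_. borel)). tail r i f} \<in> sets (PiM J (\<lambda>_. borel))" if "T r i \<subseteq> J" for r i J
  proof -
    have comp: "(\<lambda>f. f (i, N (Suc r) + l) :: real) \<in> borel_measurable (PiM J (\<lambda>_. borel))" if "l < k" "k \<le> (L - 1) * N (Suc r)" for k l
      using that \<open>T r i \<subseteq> J\<close> LL[of r] by (intro measurable_component_singleton) (auto simp: T_def)
    have "(\<lambda>f. \<Sum>l<k. f (i, N (Suc r) + l) :: real) \<in> borel_measurable (PiM J (\<lambda>_. borel))" if "k \<in> {..(L - 1) * N (Suc r)}" for k
      by (intro borel_measurable_sum comp[of _ k]) (use that in auto)
    then have "{f \<in> space (PiM J (\<lambda>_. borel)). \<forall>k\<in>{..(L - 1) * N (Suc r)}. \<bar>\<Sum>l<k. f (i, N (Suc r) + l)\<bar> \<le> 1 / 10 * A i * sqrt (N (Suc r))}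
        \<in> sets (PiM J (\<lambda>_. borel))"
      by (intro sets.sets_Collect_finite_All') auto
    then show ?thesis unfolding tail_def .
  qed
  have "indep_vars (\<lambda>r. PiM (K r) (\<lambda>_. borel)) (\<lambda>r \<omega>. restrict (\<lambda>p. Y p \<omega>) (K r)) UNIV"
  proof (rule indep_vars_restrict[OF ind])
    have mono: "L * N (Suc r) \<le> L * N s" if "r < s" for r s
      using that LN(1) by (intro lift_Suc_mono_le[of "\<lambda>r. L * N r" "Suc r" s]) auto
    have disj: "K r \<inter> K s = {}" if "r < s" for r s
    proof -
      have "\<not> (l < L * N (Suc r) \<and> L * N s \<le> l)" for l using mono[OF that] by linarith
      then show ?thesis unfolding K_def by force
    qed
    show "disjoint_family_on K UNIV"
      unfolding disjoint_family_on_def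
    proof (intro ballI impI)
      fix r s :: nat assume "r \<noteq> s"
      then show "K r \<inter> K s = {}" using disj[of r s] disj[of s r] by (cases "r < s") auto
    qed
  qed auto
  from indep_eventsI_indep_vars[OF this, of E]
  have "indep_events (\<lambda>r. {\<omega>\<in>space M. E r (restrict (\<lambda>p. Y p \<omega>) (K r))}) UNIV"
    unfolding E_def using head_meas[OF HT(1)] tail_meas[OF HT(2)]
    by (auto intro!: sets.sets_Collect_finite_All sets.sets_Collect_conj)
  moreover have "E r (restrict (\<lambda>p. Y p \<omega>) (K r)) \<longleftrightarrow> E r (\<lambda>p. Y p \<omega>)" for r \<omega>
    unfolding E_def using HT head_cong[of r _ "restrict (\<lambda>p. Y p \<omega>) (K r)" "\<lambda>p. Y p \<omega>"]
      tail_cong[of r _ "restrict (\<lambda>p. Y p \<omega>) (K r)" "\<lambda>p. Y p \<omega>"] by (auto simp: subset_iff)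
  ultimately have indE: "indep_events (\<lambda>r. {\<omega>\<in>space M. E r (\<lambda>p. Y p \<omega>)}) UNIV" by simp
  \<comment> \<open>The width 0.4 times a lower bound of the normal density at the right end 1.6,
    whose square is \<open>256 / 100\<close>. The block length lies between half the scale and the
    scale, so the bound is the same for every \<open>r\<close>.\<close>
  define q where "q i = 4 / 10 * A i * (1 / sqrt (2 * pi * v i) * exp (- (256 / 100 * (A i)\<^sup>2 / v i)))" for i
  have q: "0 < q i" for i using A(1)[of i] v[of i] by (auto simp: q_def intro!: mult_pos_pos)
  have head_prob: "q i \<le> prob {\<omega>\<in>space M. head r i (\<lambda>p. Y p \<omega>)}" for r i
  proof -
    define m where "m = real (N (Suc r))"
    define h where "h = real (N (Suc r) - L * N r)"
    have m: "0 < m" "0 < h" "m / 2 \<le> h" "h \<le> m"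
      using N_growth[of r] LN(3)[of r] by (auto simp: m_def h_def of_nat_diff simp flip: of_nat_mult)
    have "distributed M lborel (\<lambda>\<omega>. \<Sum>l\<in>{L * N r..<N (Suc r)}. Y (i, l) \<omega>)
        (normal_density (\<Sum>l\<in>{L * N r..<N (Suc r)}. 0) (sqrt (\<Sum>l\<in>{L * N r..<N (Suc r)}. (sqrt (v i))\<^sup>2)))"
      using LN(3)[of r] v normal indep_vars_reindex[OF ind, of "Pair i"]
      by (intro sum_indep_normal indep_vars_subset[OF indep_vars_reindex[OF ind, of "Pair i"]]) (auto simp: inj_on_def)
    then have D: "distributed M lborel (\<lambda>\<omega>. \<Sum>l\<in>{L * N r..<N (Suc r)}. Y (i, l) \<omega>) (normal_density 0 (sqrt (h * v i)))"
      using v[of i] by (simp add: h_def less_imp_le)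
    let ?a = "12 / 10 * A i * sqrt m" and ?b = "16 / 10 * A i * sqrt m"
    have "q i = (?b - ?a) * (1 / sqrt (2 * pi * v i * m) * exp (- (256 / 100 * (A i)\<^sup>2 / v i)))"
      using m by (simp add: q_def real_sqrt_mult field_simps)
    also have "\<dots> \<le> (?b - ?a) * normal_density 0 (sqrt (h * v i)) ?b"
    proof (rule mult_left_mono)
      have "?b\<^sup>2 / (2 * (h * v i)) \<le> ?b\<^sup>2 / (m * v i)"
        using m v[of i] by (intro divide_left_mono) auto
      also have "\<dots> = 256 / 100 * (A i)\<^sup>2 / v i" using m by (simp add: power_mult_distrib power_divide)
      finally have e: "- (256 / 100 * (A i)\<^sup>2 / v i) \<le> - (?b - 0)\<^sup>2 / (2 * (sqrt (h * v i))\<^sup>2)"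
        using m v[of i] by simp
      have "h * v i \<le> m * v i" using m v[of i] by (intro mult_right_mono) auto
      then have "1 / sqrt (2 * pi * v i * m) \<le> 1 / sqrt (2 * pi * (sqrt (h * v i))\<^sup>2)"
        using m v[of i] by (intro divide_left_mono) (auto simp: mult_ac)
      then show "1 / sqrt (2 * pi * v i * m) * exp (- (256 / 100 * (A i)\<^sup>2 / v i)) \<le> normal_density 0 (sqrt (h * v i)) ?b"
        unfolding normal_density_def using e by (intro mult_mono) auto
      show "0 \<le> ?b - ?a" using A(1)[of i] m by (simp flip: left_diff_distrib)
    qed
    also have "\<dots> \<le> prob {\<omega>\<in>space M. (\<Sum>l\<in>{L * N r..<N (Suc r)}. Y (i, l) \<omega>) \<in> {?a..?b}}"
      using A(1)[of i] m v[of i] by (intro normal_interval_prob_ge[OF D]) (auto intro!: mult_right_mono)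
    finally show ?thesis by (simp add: head_def m_def)
  qed
  have moment2: "integrable M (\<lambda>\<omega>. Y (i, l) \<omega> ^ 2)" "expectation (\<lambda>\<omega>. Y (i, l) \<omega> ^ 2) = v i" "expectation (Y (i, l)) = 0" for i l
  proof -
    have s: "0 < sqrt (v i)" using v by simp
    show "integrable M (\<lambda>\<omega>. Y (i, l) \<omega> ^ 2)"
      using integrable_normal_moment[OF s, of 0 2] distributed_integrable[OF normal, of "\<lambda>x. x ^ 2" i l] by simp
    show E: "expectation (Y (i, l)) = 0" by (rule normal_distributed_expectation[OF s normal])
    show "expectation (\<lambda>\<omega>. Y (i, l) \<omega> ^ 2) = v i"
      using normal_distributed_variance[OF s normal, of l] v[of i] by (simp add: E less_imp_le)
  qed
  have tail_prob: "1 / 2 \<le> prob {\<omega>\<in>space M. tail r i (\<lambda>p. Y p \<omega>)}" for r i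
  proof -
    define n where "n = (L - 1) * N (Suc r)"
    define c where "c = 1 / 10 * A i * sqrt (N (Suc r))"
    have c: "0 < c" using A(1)[of i] N_pos[of "Suc r"] by (simp add: c_def)
    let ?bad = "{\<omega>\<in>space M. \<exists>k\<le>n. c < \<bar>\<Sum>l<k. Y (i, N (Suc r) + l) \<omega>\<bar>}"
    have "prob ?bad \<le> n * v i / c\<^sup>2"
      by (rule Kolmogorov_maximal_inequality)
        (use c moment2 indep_vars_reindex[OF ind, of "\<lambda>l. (i, N (Suc r) + l)"] in \<open>auto simp: inj_on_def\<close>)
    also have "\<dots> \<le> 1 / 2"
    proof -
      have "real n \<le> real (L * N (Suc r))" by (simp add: n_def del: of_nat_mult)
      then have "2 * (n * v i) \<le> 2 * (real L * N (Suc r) * v i)" using v[of i] by (auto intro!: mult_right_mono)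
      also have "\<dots> = 1 / 100 * (200 * L * v i) * N (Suc r)" by simp
      also have "\<dots> \<le> 1 / 100 * (A i)\<^sup>2 * N (Suc r)" using A(2)[of i] by (intro mult_right_mono mult_left_mono) auto
      also have "\<dots> = c\<^sup>2" by (simp add: c_def power_mult_distrib power_divide)
      finally show ?thesis using c by (simp add: field_simps)
    qed
    finally have "prob ?bad \<le> 1 / 2" .
    moreover have "tail r i f \<longleftrightarrow> \<not> (\<exists>k\<le>n. c < \<bar>\<Sum>l<k. f (i, N (Suc r) + l)\<bar>)" for f
      unfolding tail_def n_def[symmetric] c_def[symmetric] Ball_def atMost_iff not_less[symmetric] by blast
    then have "{\<omega>\<in>space M. tail r i (\<lambda>p. Y p \<omega>)} = space M - ?bad" by auto
    moreover have "?bad \<in> events" by measurable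
    ultimately show ?thesis using prob_compl[of ?bad] by simp
  qed
  \<comment> \<open>Heads and tails of all designs are indexed by \<open>'k \<times> bool\<close>:
    their blocks are disjoint, so they form one independent family and the probability of
    \<open>E r\<close> is a product.\<close>
  define J where "J r = (\<lambda>(i, c). if c then T r i else H r i)" for r
  define F where "F r = (\<lambda>(i, c) f. if c then tail r i f else head r i f)" for r
  define p where "p = (\<Prod>(i, c)\<in>(UNIV :: ('k \<times> bool) set). if c then 1 / 2 else q i)"
  have E_prob: "p \<le> prob {\<omega>\<in>space M. E r (\<lambda>p. Y p \<omega>)}" for r
  proof -
    have "indep_vars (\<lambda>j. PiM (J r j) (\<lambda>_. borel)) (\<lambda>j \<omega>. restrict (\<lambda>p. Y p \<omega>) (J r j)) UNIV"
      by (rule indep_vars_restrict[OF ind]) (auto simp: disjoint_family_on_def J_def H_def T_def split: if_splits)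
    from indep_eventsI_indep_vars[OF this, of "F r"]
    have "indep_events (\<lambda>j. {\<omega>\<in>space M. F r j (restrict (\<lambda>p. Y p \<omega>) (J r j))}) UNIV"
      using head_meas[OF order_refl, of r] tail_meas[OF order_refl, of r]
      by (auto simp: F_def J_def split: prod.splits)
    moreover have "F r j (restrict (\<lambda>p. Y p \<omega>) (J r j)) \<longleftrightarrow> F r j (\<lambda>p. Y p \<omega>)" for j \<omega>
      using head_cong[of r "fst j" "restrict (\<lambda>p. Y p \<omega>) (H r (fst j))" "\<lambda>p. Y p \<omega>"]
        tail_cong[of r "fst j" "restrict (\<lambda>p. Y p \<omega>) (T r (fst j))" "\<lambda>p. Y p \<omega>"]
      by (auto simp: F_def J_def split: prod.splits)
    ultimately have "indep_events (\<lambda>j. {\<omega>\<in>space M. F r j (\<lambda>p. Y p \<omega>)}) UNIV" by simp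
    then have "prob (\<Inter>j\<in>UNIV. {\<omega>\<in>space M. F r j (\<lambda>p. Y p \<omega>)}) = (\<Prod>j\<in>UNIV. prob {\<omega>\<in>space M. F r j (\<lambda>p. Y p \<omega>)})"
      unfolding indep_events_def by (simp add: finite)
    also have "(\<Inter>j\<in>UNIV. {\<omega>\<in>space M. F r j (\<lambda>p. Y p \<omega>)}) = {\<omega>\<in>space M. E r (\<lambda>p. Y p \<omega>)}"
      by (auto simp: F_def E_def)
    finally have "prob {\<omega>\<in>space M. E r (\<lambda>p. Y p \<omega>)} = (\<Prod>j\<in>UNIV. prob {\<omega>\<in>space M. F r j (\<lambda>p. Y p \<omega>)})" .
    moreover have "p \<le> (\<Prod>j\<in>UNIV. prob {\<omega>\<in>space M. F r j (\<lambda>p. Y p \<omega>)})"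
      unfolding p_def using q head_prob[of _ r] tail_prob[of r]
      by (intro prod_mono) (auto simp: F_def split: prod.splits intro: less_imp_le)
    ultimately show ?thesis by simp
  qed
  have "0 < p" unfolding p_def using q by (intro prod_pos) auto
  from infinitely_often_of_indep_events[OF indE this E_prob]
  have "AE \<omega> in M. infinite {r. E r (\<lambda>p. Y p \<omega>)}" .
  moreover have "AE \<omega> in M. \<forall>i\<in>UNIV. (\<lambda>n. (\<Sum>l<n. Y (i, l) \<omega>) / n) \<longlonglongrightarrow> 0"
    by (intro AE_finite_allI slln) simp
  ultimately show ?thesis
  proof eventually_elim
    case (elim \<omega>)
    define S where "S i k = (\<Sum>l<k. Y (i, l) \<omega>)" for i k
    have "\<forall>\<^sub>F n in sequentially. \<forall>i\<in>UNIV. \<bar>S i n / n\<bar> < 1"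
    proof (intro eventually_ball_finite ballI)
      fix i
      have "(\<lambda>n. \<bar>S i n / n\<bar>) \<longlonglongrightarrow> \<bar>0\<bar>" using elim(2) unfolding S_def by (intro tendsto_rabs) simp
      then show "\<forall>\<^sub>F n in sequentially. \<bar>S i n / n\<bar> < 1" by (rule order_tendstoD) simp
    qed simp
    then obtain n0 where n0: "\<And>n i. n \<ge> n0 \<Longrightarrow> \<bar>S i n / n\<bar> < 1" by (auto simp: eventually_sequentially)
    have N_ge: "r < N r" for r
    proof (induction r)
      case (Suc r)
      then show ?case using LN(2,3)[of r] by linarith
    qed (simp add: N0)
    show ?case
      unfolding INFM_nat_le
    proof
      fix k0
      obtain r where r: "r \<ge> max n0 k0" "E r (\<lambda>p. Y p \<omega>)"
        using elim(1) unfolding infinite_nat_iff_unbounded_le mem_Collect_eq by blast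
      define m where "m = N (Suc r)"
      have "A i * sqrt m \<le> S i k \<and> S i k \<le> 2 * A i * sqrt m" if k: "k \<in> {m..L * m}" for i k
      proof -
        have pos: "0 < L * N r" using LN(2)[of r] N_ge[of r] by linarith
        \<comment> \<open>The law of large numbers bounds the early sum by its length, and
          \<open>sqrt (N (Suc r))\<close> is ten times that length by construction.\<close>
        have "n0 \<le> L * N r" using LN(2)[of r] N_ge[of r] r(1) by linarith
        from n0[OF this, of i] have "\<bar>S i (L * N r)\<bar> \<le> real (L * N r)"
          using pos by (simp add: abs_divide divide_less_eq del: of_nat_mult)
        also have "\<dots> = 1 / 10 * sqrt m" using sqrtN[of r] by (simp add: m_def)
        also have "\<dots> \<le> 1 / 10 * A i * sqrt m" using A(1)[of i] by (intro mult_right_mono) auto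
        finally have 1: "\<bar>S i (L * N r)\<bar> \<le> 1 / 10 * A i * sqrt m" .
        have 2: "(\<Sum>l\<in>{L * N r..<m}. Y (i, l) \<omega>) \<in> {12 / 10 * A i * sqrt m..16 / 10 * A i * sqrt m}"
          using r(2) by (simp add: E_def head_def m_def)
        have "k - m \<le> (L - 1) * m" using k by (auto simp: diff_mult_distrib)
        then have 3: "\<bar>\<Sum>l<k - m. Y (i, m + l) \<omega>\<bar> \<le> 1 / 10 * A i * sqrt m"
          using r(2) by (simp add: E_def tail_def m_def)
        have "S i k = S i (L * N r) + (\<Sum>l\<in>{L * N r..<m}. Y (i, l) \<omega>) + (\<Sum>l\<in>{m..<k}. Y (i, l) \<omega>)"
        proof -
          have "S i k = (\<Sum>l\<in>{0..<L * N r}. Y (i, l) \<omega>) + (\<Sum>l\<in>{L * N r..<k}. Y (i, l) \<omega>)"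
            unfolding S_def lessThan_atLeast0 using k LN(3)[of r]
            by (intro sum.atLeastLessThan_concat[symmetric]) (auto simp: m_def)
          also have "(\<Sum>l\<in>{L * N r..<k}. Y (i, l) \<omega>) = (\<Sum>l\<in>{L * N r..<m}. Y (i, l) \<omega>) + (\<Sum>l\<in>{m..<k}. Y (i, l) \<omega>)"
            using k LN(3)[of r] by (intro sum.atLeastLessThan_concat[symmetric]) (auto simp: m_def)
          finally show ?thesis by (simp add: S_def lessThan_atLeast0)
        qed
        moreover have "(\<Sum>l\<in>{m..<k}. Y (i, l) \<omega>) = (\<Sum>l<k - m. Y (i, m + l) \<omega>)"
          using k by (intro sum.reindex_bij_witness[of _ "\<lambda>l. m + l" "\<lambda>l. l - m"]) auto
        moreover have "0 \<le> A i * sqrt m" using A(1)[of i] by simp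
        ultimately show ?thesis using 1 2 3 by (auto simp: abs_le_iff)
      qed
      moreover have "k0 \<le> m" using N_ge[of "Suc r"] r(1) by (simp add: m_def)
      ultimately show "\<exists>N\<ge>k0. \<forall>i. \<forall>k\<in>{N..L * N}. A i * sqrt N \<le> (\<Sum>l<k. Y (i, l) \<omega>) \<and> (\<Sum>l<k. Y (i, l) \<omega>) \<le> 2 * A i * sqrt N"
        by (auto simp: S_def)
    qed
  qed
qed

end

section \<open>The posterior\<close>

lemma Basis_vec_real: "(Basis :: (real ^ 'k::finite) set) = range (\<lambda>i. axis i 1)"
  by (auto simp: Basis_vec_def)

lemma measurable_vec_lambda:
  assumes "\<And>i. f i \<in> borel_measurable M"
  shows "(\<lambda>x. \<chi> i. f i x) \<in> measurable M (borel :: (real ^ 'k::finite) measure)"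
  using assms by (subst borel_measurable_euclidean_space) (auto simp: Basis_vec_real inner_axis)

lemma measurable_vec_nth[measurable]: "(\<lambda>x. (x :: real ^ 'k::finite) $ i) \<in> borel_measurable borel"
  by (intro borel_measurable_continuous_onI continuous_intros)

text \<open>Lebesgue measure is determined by its values on boxes, and on these the product measure
  gives the product of the side lengths. This opens the way to Fubini over the designs.\<close>

lemma lborel_vec_eq_distr:
  "(lborel :: (real ^ 'k::finite) measure) = distr (PiM UNIV (\<lambda>_. lborel)) borel (\<lambda>y. \<chi> i. y i)"
proof (rule lborel_eqI)
  interpret product_sigma_finite "\<lambda>_::'k. lborel :: real measure" ..
  have meas: "(\<lambda>y. \<chi> i. y i) \<in> measurable (PiM UNIV (\<lambda>_. lborel)) (borel :: (real ^ 'k) measure)"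
    by (rule measurable_vec_lambda) simp
  fix l u :: "real ^ 'k" assume le: "\<And>b. b \<in> Basis \<Longrightarrow> l \<bullet> b \<le> u \<bullet> b"
  have le': "l $ i \<le> u $ i" for i using le[of "axis i 1"] by (simp add: inner_axis)
  have "(\<lambda>y. \<chi> i. y i) -` box l u \<inter> space (PiM UNIV (\<lambda>_. lborel)) = PiE UNIV (\<lambda>i. {l $ i<..<u $ i})"
    by (auto simp: mem_box_cart space_PiM PiE_def Pi_def)
  then have "emeasure (distr (PiM UNIV (\<lambda>_. lborel)) borel (\<lambda>y. \<chi> i. y i)) (box l u)
      = (\<Prod>i\<in>UNIV. emeasure lborel {l $ i<..<u $ i})"
    using meas by (simp add: emeasure_distr emeasure_PiM)
  also have "\<dots> = (\<Prod>i\<in>UNIV. ennreal (u $ i - l $ i))" using le' by simp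
  also have "\<dots> = ennreal (\<Prod>i\<in>UNIV. u $ i - l $ i)" using le' by (intro prod_ennreal) simp
  also have "(\<Prod>i\<in>UNIV. u $ i - l $ i) = (\<Prod>b\<in>Basis. (u - l) \<bullet> b)"
    unfolding Basis_vec_real by (subst prod.reindex) (auto simp: inj_on_def axis_eq_axis inner_axis)
  finally show "emeasure (distr (PiM UNIV (\<lambda>_. lborel)) borel (\<lambda>y. \<chi> i. y i)) (box l u) = (\<Prod>b\<in>Basis. (u - l) \<bullet> b)" .
qed simp

lemma nn_integral_vec_prod:
  fixes h :: "'k::finite \<Rightarrow> real \<Rightarrow> ennreal"
  assumes "\<And>i. h i \<in> borel_measurable borel"
  shows "(\<integral>\<^sup>+x. (\<Prod>i\<in>UNIV. h i (x $ i)) \<partial>lborel) = (\<Prod>i\<in>UNIV. \<integral>\<^sup>+t. h i t \<partial>lborel)"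
proof -
  interpret product_sigma_finite "\<lambda>_::'k. lborel :: real measure" ..
  note [measurable] = assms
  have meas: "(\<lambda>y. \<chi> i. y i) \<in> measurable (PiM UNIV (\<lambda>_. lborel)) (borel :: (real ^ 'k) measure)"
    by (rule measurable_vec_lambda) simp
  have "(\<integral>\<^sup>+x. (\<Prod>i\<in>UNIV. h i (x $ i)) \<partial>(lborel :: (real ^ 'k) measure))
      = (\<integral>\<^sup>+y. (\<Prod>i\<in>UNIV. h i (y i)) \<partial>PiM UNIV (\<lambda>_. lborel))"
    by (subst lborel_vec_eq_distr, subst nn_integral_distr[OF meas]) auto
  also have "\<dots> = (\<Prod>i\<in>UNIV. \<integral>\<^sup>+t. h i t \<partial>lborel)"
    by (rule product_nn_integral_prod) auto
  finally show ?thesis .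
qed

text \<open>Parameters are stored as a vector of means and a vector of variances, whereas the
  likelihood factorises over designs. Integrating the variances at fixed means, and then the means,
  regroups the coordinates.\<close>

lemma nn_integral_pair_vec_prod:
  fixes h :: "'k::finite \<Rightarrow> real \<times> real \<Rightarrow> ennreal"
  assumes h: "\<And>i. h i \<in> borel_measurable borel"
  shows "(\<integral>\<^sup>+z. (\<Prod>i\<in>UNIV. h i (fst z $ i, snd z $ i)) \<partial>lborel) = (\<Prod>i\<in>UNIV. \<integral>\<^sup>+t. h i t \<partial>lborel)"
proof -
  have [measurable]: "h i \<in> borel_measurable (borel \<Otimes>\<^sub>M borel)" for i
    using h by (simp add: borel_prod)
  have [measurable]: "(\<lambda>z. h i (fst z $ i, snd z $ i))
      \<in> borel_measurable ((borel :: (real ^ 'k) measure) \<Otimes>\<^sub>M (borel :: (real ^ 'k) measure))" for i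
    by (rule measurable_compose[where N="borel \<Otimes>\<^sub>M borel", of "\<lambda>z. (fst z $ i, snd z $ i)"]) auto
  have hl: "h i \<in> borel_measurable (lborel \<Otimes>\<^sub>M lborel)" for i by simp
  have "(\<integral>\<^sup>+z. (\<Prod>i\<in>UNIV. h i (fst z $ i, snd z $ i)) \<partial>(lborel :: ((real ^ 'k) \<times> (real ^ 'k)) measure))
      = (\<integral>\<^sup>+z. (\<Prod>i\<in>UNIV. h i (fst z $ i, snd z $ i)) \<partial>((lborel :: (real ^ 'k) measure) \<Otimes>\<^sub>M (lborel :: (real ^ 'k) measure)))"
    by (simp add: lborel_prod)
  also have "\<dots> = (\<integral>\<^sup>+x. \<integral>\<^sup>+y. (\<Prod>i\<in>UNIV. h i (x $ i, y $ i)) \<partial>lborel \<partial>lborel)"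
    by (subst lborel.nn_integral_fst[symmetric]) auto
  also have "\<dots> = (\<integral>\<^sup>+x. (\<Prod>i\<in>UNIV. \<integral>\<^sup>+t. h i (x $ i, t) \<partial>lborel) \<partial>lborel)"
    by (intro nn_integral_cong nn_integral_vec_prod) auto
  also have "\<dots> = (\<Prod>i\<in>UNIV. \<integral>\<^sup>+s. \<integral>\<^sup>+t. h i (s, t) \<partial>lborel \<partial>lborel)"
    by (rule nn_integral_vec_prod) measurable
  also have "\<dots> = (\<Prod>i\<in>UNIV. \<integral>\<^sup>+t. h i t \<partial>(lborel \<Otimes>\<^sub>M lborel))"
    by (intro prod.cong refl lborel.nn_integral_fst hl)
  finally show ?thesis by (simp add: lborel_prod)
qed

section \<open>Inverse-gamma integrals and the posterior of one design under a flat prior\<close>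

text \<open>Substituting \<open>B / t\<close> for the variable of the Gamma integral gives this one,
  the normalising constant of the inverse-gamma law of shape \<open>p - 1\<close> and scale
  \<open>B\<close>.\<close>

lemma nn_integral_inverse_gamma:
  assumes p: "1 < p" and B: "0 < B"
  shows "(\<integral>\<^sup>+t. ennreal (indicator {0<..} t * (t powr - p * exp (- B / t))) \<partial>lborel)
    = ennreal (Gamma (p - 1) / B powr (p - 1))"
proof -
  let ?f = "\<lambda>t::real. t powr (p - 1 - 1) / exp t"
  have "(?f has_integral Gamma (p - 1)) {0..}" using Gamma_integral_real[of "p - 1"] p by simp
  then have "((\<lambda>t. if t \<in> {0<..} then ?f t else 0) has_integral Gamma (p - 1)) {0..}"
    by (rule has_integral_spike[of "{0}", rotated 2]) auto
  then have f: "(?f has_integral Gamma (p - 1)) {0<..}" by (subst (asm) has_integral_restrict) auto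
  then have "?f absolutely_integrable_on {0<..}"
    by (intro nonnegative_absolutely_integrable_1) (auto simp: integrable_on_def)
  moreover have img: "(\<lambda>t. B / t) ` {0<..} = {0<..}"
  proof safe
    fix x :: real assume "0 < x"
    then show "x \<in> (\<lambda>t. B / t) ` {0<..}" using B by (intro image_eqI[of _ _ "B / x"]) auto
  qed (use B in auto)
  moreover have "integral {0<..} ?f = Gamma (p - 1)" using f by (rule integral_unique)
  ultimately have "?f absolutely_integrable_on (\<lambda>t. B / t) ` {0<..} \<and> integral ((\<lambda>t. B / t) ` {0<..}) ?f = Gamma (p - 1)" by simp
  moreover have "((\<lambda>t. B / t) has_field_derivative - B / x\<^sup>2) (at x within {0<..})" if "x \<in> {0<..}" for x
    using that by (auto intro!: derivative_eq_intros simp: power2_eq_square)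
  moreover have "inj_on (\<lambda>t. B / t) {0<..}" using B by (auto simp: inj_on_def)
  ultimately have "(\<lambda>t. \<bar>- B / t\<^sup>2\<bar> *\<^sub>R ?f (B / t)) absolutely_integrable_on {0<..} \<and>
      integral {0<..} (\<lambda>t. \<bar>- B / t\<^sup>2\<bar> *\<^sub>R ?f (B / t)) = Gamma (p - 1)"
    using has_absolute_integral_change_of_variables_real[of "{0<..}" "\<lambda>t. B / t" "\<lambda>t. - B / t\<^sup>2" ?f "Gamma (p - 1)"] by simp
  then have "((\<lambda>t. \<bar>- B / t\<^sup>2\<bar> *\<^sub>R ?f (B / t)) has_integral Gamma (p - 1)) {0<..}"
    using absolutely_integrable_on_def by (auto simp: has_integral_iff)
  moreover have "\<bar>- B / t\<^sup>2\<bar> *\<^sub>R ?f (B / t) = B powr (p - 1) * (t powr - p * exp (- B / t))" if "t \<in> {0<..}" for t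
  proof -
    have t: "0 < t" using that by simp
    have "\<bar>- B / t\<^sup>2\<bar> *\<^sub>R ?f (B / t) = (B powr 1 * B powr (p - 1 - 1)) * ((t powr - 2) * t powr - (p - 1 - 1)) * exp (- B / t)"
    proof -
      have "t powr (p - 2) * t powr (2 - p) = 1" using t by (simp flip: powr_add)
      then show ?thesis using t B by (simp add: powr_divide powr_minus field_simps exp_minus powr_numeral)
    qed
    also have "B powr 1 * B powr (p - 1 - 1) = B powr (p - 1)"
      by (subst powr_add[symmetric]) simp
    also have "t powr - 2 * t powr - (p - 1 - 1) = t powr - p"
      by (subst powr_add[symmetric]) simp
    finally show ?thesis by simp
  qed
  ultimately have "((\<lambda>t. B powr (p - 1) * (t powr - p * exp (- B / t))) has_integral Gamma (p - 1)) {0<..}"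
    using has_integral_cong by (metis (no_types, lifting))
  from has_integral_mult_right[OF this, of "1 / B powr (p - 1)"]
  have "((\<lambda>t. t powr - p * exp (- B / t)) has_integral Gamma (p - 1) / B powr (p - 1)) {0<..}"
    using B by simp
  from nn_integral_has_integral_lebesgue[OF _ this] show ?thesis by simp
qed

definition sample_mean :: "nat \<Rightarrow> (nat \<Rightarrow> real) \<Rightarrow> real" where
  "sample_mean n y = (\<Sum>l<n. y l) / n"

definition sample_dev :: "nat \<Rightarrow> (nat \<Rightarrow> real) \<Rightarrow> real" where
  "sample_dev n y = (\<Sum>l<n. (y l - sample_mean n y)\<^sup>2)"

lemma sum_squared_deviation:
  assumes "1 \<le> n"
  shows "(\<Sum>l<n. (y l - c)\<^sup>2) = sample_dev n y + n * (c - sample_mean n y)\<^sup>2"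
proof -
  let ?m = "sample_mean n y"
  have s: "(\<Sum>l<n. y l) = n * ?m" using assms by (simp add: sample_mean_def)
  have "(y l - c)\<^sup>2 = (y l - ?m)\<^sup>2 + (2 * (?m - c) * (y l - ?m) + (c - ?m)\<^sup>2)" for l
    by (simp add: power2_eq_square algebra_simps)
  then have "(\<Sum>l<n. (y l - c)\<^sup>2) = sample_dev n y + (2 * (?m - c) * ((\<Sum>l<n. y l) - n * ?m) + n * (c - ?m)\<^sup>2)"
    by (simp add: sum.distrib sample_dev_def sum_subtractf flip: sum_distrib_left)
  then show ?thesis by (simp add: s)
qed

text \<open>The value 0 at nonpositive variances makes it usable as a density on the whole
  plane.\<close>

definition flat_lik :: "nat \<Rightarrow> (nat \<Rightarrow> real) \<Rightarrow> real \<times> real \<Rightarrow> real" where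
  "flat_lik n y z = (if 0 < snd z then \<Prod>l<n. normal_density (fst z) (sqrt (snd z)) (y l) else 0)"

definition flat_const :: "nat \<Rightarrow> real" where
  "flat_const n = (2 * pi) powr (- ((real n - 1) / 2)) / sqrt n"

text \<open>The total mass of \<open>flat_lik\<close> in closed form: integrating out the mean
  leaves \<open>flat_const n\<close> times an inverse-gamma integral of exponent
  \<open>(n - 1) / 2\<close>.\<close>

definition flat_norm :: "nat \<Rightarrow> (nat \<Rightarrow> real) \<Rightarrow> real" where
  "flat_norm n y = flat_const n * (Gamma ((real n - 1) / 2 - 1) / (sample_dev n y / 2) powr ((real n - 1) / 2 - 1))"

definition flat_posterior :: "nat \<Rightarrow> (nat \<Rightarrow> real) \<Rightarrow> (real \<times> real) measure" where
  "flat_posterior n y = density lborel (\<lambda>z. ennreal (flat_lik n y z / flat_norm n y))"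

lemma flat_lik_nonneg: "0 \<le> flat_lik n y z"
  by (simp add: flat_lik_def prod_nonneg)

lemma measurable_flat_lik[measurable]:
  "flat_lik n y \<in> borel_measurable (borel \<Otimes>\<^sub>M borel)" "flat_lik n y \<in> borel_measurable borel"
proof -
  show "flat_lik n y \<in> borel_measurable (borel \<Otimes>\<^sub>M borel)"
    unfolding flat_lik_def[abs_def] normal_density_def by measurable
  then show "flat_lik n y \<in> borel_measurable borel" by (simp add: borel_prod)
qed

text \<open>Completing the square separates the mean, normal around the sample mean with variance
  \<open>\<psi> / n\<close>, from the variance. The normal density takes a factor
  \<open>\<psi> powr - (1 / 2)\<close> with it, which lowers the exponent from \<open>n / 2\<close>
  to \<open>(n - 1) / 2\<close>.\<close>

lemma flat_lik_eq:
  assumes n: "1 \<le> n" and \<psi>: "0 < \<psi>"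
  shows "flat_lik n y (\<phi>, \<psi>) = flat_const n * (\<psi> powr - ((real n - 1) / 2) * exp (- (sample_dev n y / 2) / \<psi>))
    * normal_density (sample_mean n y) (sqrt (\<psi> / n)) \<phi>"
proof -
  let ?w = "2 * pi * \<psi>"
  have w: "0 < ?w" using \<psi> by simp
  have sq: "1 / sqrt ?w = ?w powr - (1 / 2)" using w by (simp add: powr_minus powr_half_sqrt inverse_eq_divide)
  have "flat_lik n y (\<phi>, \<psi>) = (\<Prod>l<n. 1 / sqrt ?w * exp (- (y l - \<phi>)\<^sup>2 / (2 * \<psi>)))"
    using \<psi> by (simp add: flat_lik_def normal_density_def)
  also have "\<dots> = (1 / sqrt ?w) ^ n * exp (- (\<Sum>l<n. (y l - \<phi>)\<^sup>2) / (2 * \<psi>))"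
    unfolding prod.distrib by (simp add: exp_sum sum_divide_distrib flip: sum_negf)
  also have "(1 / sqrt ?w) ^ n = ?w powr - ((real n - 1) / 2) * (1 / sqrt ?w)"
  proof -
    have "(1 / sqrt ?w) ^ n = ?w powr (- (1 / 2) * n)"
      unfolding sq using w by (subst powr_realpow[symmetric]) (auto simp: powr_powr)
    also have "- (1 / 2) * real n = - ((real n - 1) / 2) + - (1 / 2)" by (simp add: field_simps)
    finally show ?thesis unfolding sq by (simp only: powr_add)
  qed
  also have "?w powr - ((real n - 1) / 2) = (2 * pi) powr - ((real n - 1) / 2) * \<psi> powr - ((real n - 1) / 2)"
    using \<psi> by (simp add: powr_mult)
  also have "exp (- (\<Sum>l<n. (y l - \<phi>)\<^sup>2) / (2 * \<psi>)) = exp (- (sample_dev n y / 2) / \<psi>) * exp (- (\<phi> - sample_mean n y)\<^sup>2 / (2 * (sqrt (\<psi> / n))\<^sup>2))"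
    unfolding sum_squared_deviation[OF n] using n \<psi> by (simp add: field_simps flip: exp_add)
  also have "1 / sqrt ?w = 1 / sqrt n * (1 / sqrt (2 * pi * (sqrt (\<psi> / n))\<^sup>2))"
    using n \<psi> by (simp add: real_sqrt_divide real_sqrt_mult field_simps)
  finally show ?thesis by (simp add: flat_const_def normal_density_def)
qed

lemma flat_const_pos: "1 \<le> n \<Longrightarrow> 0 < flat_const n"
  by (simp add: flat_const_def)

text \<open>Integrating the mean first gives \<open>(\<psi> / n) ^ k\<close>, and an inverse-gamma
  integral remains. With \<open>(k, r)\<close> equal to (0, 0), (0, 1), (0, -1) or (1, 0), the
  formula yields the total mass, the means of the variance and of its reciprocal, and the squared
  error of the mean.\<close>

lemma nn_integral_flat_lik:
  assumes n: "1 \<le> n" and ss: "0 < sample_dev n y" and k: "k \<le> 1" and p: "1 < (real n - 1) / 2 - r - real k"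
  shows "(\<integral>\<^sup>+z. ennreal (((fst z - sample_mean n y)\<^sup>2) ^ k * snd z powr r * flat_lik n y z) \<partial>lborel) =
    ennreal (flat_const n * (1 / n) ^ k * (Gamma ((real n - 1) / 2 - r - real k - 1) /
      (sample_dev n y / 2) powr ((real n - 1) / 2 - r - real k - 1)))"
proof -
  let ?m = "sample_mean n y" and ?B = "sample_dev n y / 2" and ?q = "(real n - 1) / 2"
  let ?c = "flat_const n"
  have meas: "(\<lambda>z. ennreal (((fst z - ?m)\<^sup>2) ^ k * snd z powr r * flat_lik n y z)) \<in> borel_measurable (lborel \<Otimes>\<^sub>M lborel)"
    by measurable
  have inner: "(\<integral>\<^sup>+\<phi>. ennreal (((\<phi> - ?m)\<^sup>2) ^ k * \<psi> powr r * flat_lik n y (\<phi>, \<psi>)) \<partial>lborel)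
      = ennreal (?c * (1 / n) ^ k) * ennreal (indicator {0<..} \<psi> * (\<psi> powr - (?q - r - k) * exp (- ?B / \<psi>)))" for \<psi>
  proof (cases "0 < \<psi>")
    case False
    then show ?thesis by (simp add: flat_lik_def)
  next
    case True
    let ?s = "sqrt (\<psi> / n)"
    let ?d = "?c * (\<psi> powr - ?q * exp (- ?B / \<psi>)) * \<psi> powr r"
    have s: "0 < ?s" using True n by simp
    have d: "0 \<le> ?d" using flat_const_pos[OF n] by simp
    have "(\<integral>\<^sup>+\<phi>. ennreal (((\<phi> - ?m)\<^sup>2) ^ k * \<psi> powr r * flat_lik n y (\<phi>, \<psi>)) \<partial>lborel)
        = (\<integral>\<^sup>+\<phi>. ennreal ?d * ennreal (normal_density ?m ?s \<phi> * (\<phi> - ?m) ^ (2 * k)) \<partial>lborel)"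
      unfolding flat_lik_eq[OF n True]
      by (intro nn_integral_cong) (subst ennreal_mult'[OF d, symmetric], simp add: power_mult[symmetric] mult_ac)
    also have "\<dots> = ennreal ?d * (\<integral>\<^sup>+\<phi>. ennreal (normal_density ?m ?s \<phi> * (\<phi> - ?m) ^ (2 * k)) \<partial>lborel)"
      by (intro nn_integral_cmult) measurable
    also have "(\<integral>\<^sup>+\<phi>. ennreal (normal_density ?m ?s \<phi> * (\<phi> - ?m) ^ (2 * k)) \<partial>lborel) = ennreal ((\<psi> / n) ^ k)"
    proof (subst nn_integral_eq_integral)
      show "integrable lborel (\<lambda>\<phi>. normal_density ?m ?s \<phi> * (\<phi> - ?m) ^ (2 * k))"
        by (rule integrable_normal_moment[OF s])
      have "k = 0 \<or> k = 1" using k by auto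
      then show "ennreal (LINT \<phi>|lborel. normal_density ?m ?s \<phi> * (\<phi> - ?m) ^ (2 * k)) = ennreal ((\<psi> / n) ^ k)"
        unfolding integral_normal_moment_even[OF s] using True by (auto simp: less_imp_le)
    qed simp
    also have "ennreal ?d * ennreal ((\<psi> / n) ^ k) = ennreal (?c * (1 / n) ^ k * (\<psi> powr - (?q - r - k) * exp (- ?B / \<psi>)))"
    proof -
      have "\<psi> powr - (?q - r - k) = \<psi> powr (- ?q + r + k)"
        by (rule arg_cong[of _ _ "\<lambda>e. \<psi> powr e"]) simp
      also have "\<dots> = \<psi> powr - ?q * \<psi> powr r * \<psi> ^ k" using True by (simp only: powr_add powr_realpow)
      finally show ?thesis using d True by (simp add: ennreal_mult[symmetric] power_divide power_one_over field_simps del: ennreal_mult)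
    qed
    finally show ?thesis using True flat_const_pos[OF n] by (simp add: ennreal_mult[symmetric])
  qed
  have "(\<integral>\<^sup>+z. ennreal (((fst z - ?m)\<^sup>2) ^ k * snd z powr r * flat_lik n y z) \<partial>lborel)
      = (\<integral>\<^sup>+\<psi>. \<integral>\<^sup>+\<phi>. ennreal (((\<phi> - ?m)\<^sup>2) ^ k * \<psi> powr r * flat_lik n y (\<phi>, \<psi>)) \<partial>lborel \<partial>lborel)"
    using lborel_pair.nn_integral_snd[OF meas] by (simp add: lborel_prod)
  also have "\<dots> = ennreal (?c * (1 / n) ^ k) * (\<integral>\<^sup>+\<psi>. ennreal (indicator {0<..} \<psi> * (\<psi> powr - (?q - r - k) * exp (- ?B / \<psi>))) \<partial>lborel)"
    unfolding inner by (intro nn_integral_cmult) measurable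
  also have "\<dots> = ennreal (?c * (1 / n) ^ k) * ennreal (Gamma (?q - r - k - 1) / ?B powr (?q - r - k - 1))"
    using ss p by (subst nn_integral_inverse_gamma) auto
  also have "\<dots> = ennreal (?c * (1 / n) ^ k * (Gamma (?q - r - k - 1) / ?B powr (?q - r - k - 1)))"
    using flat_const_pos[OF n] p by (intro ennreal_mult[symmetric]) (auto intro!: divide_nonneg_nonneg Gamma_real_nonneg)
  finally show ?thesis .
qed

lemma flat_norm_pos:
  assumes "6 \<le> n" "0 < sample_dev n y"
  shows "0 < flat_norm n y"
  using assms flat_const_pos[of n] by (auto simp: flat_norm_def intro!: mult_pos_pos divide_pos_pos Gamma_real_pos)

text \<open>All moments are ratios of neighbouring inverse-gamma integrals, evaluated by the
  functional equation of Gamma. The mean of the variance lowers the exponent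
  \<open>(n - 1) / 2\<close> by 1, and the result must exceed 1; this is where
  \<open>6 \<le> n\<close> enters.\<close>

lemma flat_posterior_moments:
  assumes n: "6 \<le> n" and ss: "0 < sample_dev n y"
  shows "prob_space (flat_posterior n y)"
    and "AE z in flat_posterior n y. 0 < snd z"
    and "has_bochner_integral (flat_posterior n y) snd (sample_dev n y / (real n - 5))"
    and "has_bochner_integral (flat_posterior n y) (\<lambda>z. 1 / snd z) ((real n - 3) / sample_dev n y)"
    and "has_bochner_integral (flat_posterior n y) (\<lambda>z. (fst z - sample_mean n y)\<^sup>2)
      (sample_dev n y / (n * (real n - 5)))"
proof -
  let ?F = "flat_posterior n y" and ?Z = "flat_norm n y" and ?q = "(real n - 1) / 2" and ?B = "sample_dev n y / 2"
  let ?J = "\<lambda>p. Gamma (p - 1) / ?B powr (p - 1)"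
  have Z: "0 < ?Z" by (rule flat_norm_pos[OF n ss])
  have q: "5 / 2 \<le> ?q" and n1: "1 \<le> n" using n by auto
  have c: "0 < flat_const n" using n1 by (rule flat_const_pos)
  have J: "?J (p + 1) = (p - 1) / ?B * ?J p" if "1 < p" for p
  proof -
    have "Gamma (p + 1 - 1) = (p - 1) * Gamma (p - 1)" using Gamma_plus1[of "p - 1"] that by (force dest: nonpos_Ints_nonpos)
    moreover have "?B powr (p + 1 - 1) = ?B * ?B powr (p - 1)"
      using ss by (simp add: powr_diff)
    ultimately show ?thesis by (simp only: times_divide_times_eq)
  qed
  have Jpos: "0 < ?J p" if "1 < p" for p using that ss by (auto intro!: divide_pos_pos Gamma_real_pos)
  have r1: "?J (?q - 1) / ?J ?q = sample_dev n y / (real n - 5)"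
  proof -
    have q1: "1 < ?q - 1" using q by simp
    from J[OF q1] have e: "?J ?q = (?q - 1 - 1) / ?B * ?J (?q - 1)" by (simp only: diff_add_cancel)
    have "j / (x / b * j) = b / x" if "0 < j" for j x b :: real using that by simp
    from this[OF Jpos[OF q1], of "?q - 1 - 1" ?B] have "?J (?q - 1) / ?J ?q = ?B / (?q - 1 - 1)" by (simp only: e)
    moreover have q5: "?q - 1 - 1 = (real n - 5) / 2" by (simp add: field_simps)
    have "?B / (?q - 1 - 1) = sample_dev n y / (real n - 5)" unfolding q5 by simp
    ultimately show ?thesis by (rule trans)
  qed
  have r2: "?J (?q + 1) / ?J ?q = (real n - 3) / sample_dev n y"
  proof -
    have q1: "1 < ?q" using q by simp
    have "x / b * j / j = x / b" if "0 < j" for j x b :: real using that by simp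
    from this[OF Jpos[OF q1], of "?q - 1" ?B] have "?J (?q + 1) / ?J ?q = (?q - 1) / ?B" by (simp only: J[OF q1])
    moreover have q3: "?q - 1 = (real n - 3) / 2" by (simp add: field_simps)
    have "(?q - 1) / ?B = (real n - 3) / sample_dev n y"
      unfolding q3 using ss by (simp add: field_simps)
    ultimately show ?thesis by (rule trans)
  qed
  have nn: "nn_integral ?F (\<lambda>z. ennreal (((fst z - sample_mean n y)\<^sup>2) ^ k * snd z powr r))
      = ennreal ((1 / n) ^ k * (?J (?q - r - k) / ?J ?q))"
    if k: "k \<le> 1" and p: "1 < ?q - r - k" for k r
  proof -
    have "nn_integral ?F (\<lambda>z. ennreal (((fst z - sample_mean n y)\<^sup>2) ^ k * snd z powr r))
        = (\<integral>\<^sup>+z. ennreal (flat_lik n y z / ?Z) * ennreal (((fst z - sample_mean n y)\<^sup>2) ^ k * snd z powr r) \<partial>lborel)"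
      unfolding flat_posterior_def by (subst nn_integral_density) (auto simp: lborel_prod[symmetric])
    also have "\<dots> = (\<integral>\<^sup>+z. ennreal (1 / ?Z) * ennreal (((fst z - sample_mean n y)\<^sup>2) ^ k * snd z powr r * flat_lik n y z) \<partial>lborel)"
      using Z flat_lik_nonneg[of n y] by (intro nn_integral_cong) (simp add: ennreal_mult[symmetric] mult_ac)
    also have "\<dots> = ennreal (1 / ?Z) * (\<integral>\<^sup>+z. ennreal (((fst z - sample_mean n y)\<^sup>2) ^ k * snd z powr r * flat_lik n y z) \<partial>lborel)"
      by (intro nn_integral_cmult) (simp add: lborel_prod[symmetric])
    also have "\<dots> = ennreal (1 / ?Z * (flat_const n * (1 / n) ^ k * ?J (?q - r - k)))"
      unfolding nn_integral_flat_lik[OF n1 ss k p] using Z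
      by (intro ennreal_mult'[symmetric]) simp
    also have "1 / ?Z * (flat_const n * (1 / n) ^ k * ?J (?q - r - k)) = (1 / n) ^ k * (?J (?q - r - k) / ?J ?q)"
      using c by (simp add: flat_norm_def mult_ac)
    finally show ?thesis .
  qed
  have ae: "AE z in ?F. 0 < snd z"
  proof -
    have "(\<lambda>z. ennreal (flat_lik n y z / ?Z)) \<in> borel_measurable lborel" by simp
    then show ?thesis
      unfolding flat_posterior_def by (subst AE_density) (auto intro!: AE_I2 simp: flat_lik_def split: if_splits)
  qed
  then show "AE z in ?F. 0 < snd z" .
  have ae1: "AE z in ?F. snd z powr 0 = 1" using ae by eventually_elim simp
  have "emeasure ?F (space ?F) = nn_integral ?F (\<lambda>z. 1)" by simp
  also have "\<dots> = nn_integral ?F (\<lambda>z. ennreal (((fst z - sample_mean n y)\<^sup>2) ^ 0 * snd z powr 0))"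
    using ae1 by (intro nn_integral_cong_AE) (auto elim!: eventually_mono)
  also have "\<dots> = ennreal ((1 / n) ^ 0 * (?J (?q - 0 - real 0) / ?J ?q))" by (rule nn) (use q in auto)
  also have "\<dots> = ennreal (?J ?q / ?J ?q)" by (simp only: power_0 mult_1 of_nat_0 diff_zero)
  also have "?J ?q / ?J ?q = 1" using Jpos[of ?q] q by (intro divide_self) linarith
  finally show "prob_space ?F" by (intro prob_spaceI) simp
  have sets: "sets ?F = sets (borel \<Otimes>\<^sub>M borel)" by (simp add: flat_posterior_def lborel_prod[symmetric])
  have [measurable]: "fst \<in> borel_measurable ?F" "snd \<in> borel_measurable ?F"
    unfolding measurable_cong_sets[OF sets refl] by auto
  have "nn_integral ?F (\<lambda>z. ennreal (snd z)) = nn_integral ?F (\<lambda>z. ennreal (((fst z - sample_mean n y)\<^sup>2) ^ 0 * snd z powr 1))"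
    using ae by (intro nn_integral_cong_AE) (auto elim!: eventually_mono)
  also have "\<dots> = ennreal (?J (?q - 1) / ?J ?q)" using nn[of 0 1] q by simp
  also have "?J (?q - 1) / ?J ?q = sample_dev n y / (real n - 5)"
    by (rule r1)
  finally show "has_bochner_integral ?F snd (sample_dev n y / (real n - 5))"
    using ae n ss by (intro has_bochner_integral_nn_integral) (auto elim!: eventually_mono)
  have "nn_integral ?F (\<lambda>z. ennreal (1 / snd z)) = nn_integral ?F (\<lambda>z. ennreal (((fst z - sample_mean n y)\<^sup>2) ^ 0 * snd z powr (-1)))"
    using ae by (intro nn_integral_cong_AE) (auto elim!: eventually_mono simp: powr_minus inverse_eq_divide)
  also have "\<dots> = ennreal (?J (?q + 1) / ?J ?q)" using nn[of 0 "-1"] q by simp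
  also have "?J (?q + 1) / ?J ?q = (real n - 3) / sample_dev n y"
    by (rule r2)
  finally show "has_bochner_integral ?F (\<lambda>z. 1 / snd z) ((real n - 3) / sample_dev n y)"
    using ae n ss by (intro has_bochner_integral_nn_integral) (auto elim!: eventually_mono)
  have "nn_integral ?F (\<lambda>z. ennreal ((fst z - sample_mean n y)\<^sup>2)) = nn_integral ?F (\<lambda>z. ennreal (((fst z - sample_mean n y)\<^sup>2) ^ 1 * snd z powr 0))"
    using ae1 by (intro nn_integral_cong_AE) (auto elim!: eventually_mono)
  also have "\<dots> = ennreal (1 / n * (?J (?q - 1) / ?J ?q))" using nn[of 1 0] q by simp
  also have "1 / n * (?J (?q - 1) / ?J ?q) = sample_dev n y / (n * (real n - 5))"
    unfolding r1 by simp
  finally show "has_bochner_integral ?F (\<lambda>z. (fst z - sample_mean n y)\<^sup>2) (sample_dev n y / (n * (real n - 5)))"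
    using n ss by (intro has_bochner_integral_nn_integral) auto
qed

section \<open>Comparison of the posterior with the flat-prior posterior\<close>

definition posterior :: "('k::finite params \<Rightarrow> real) \<Rightarrow> ('k \<Rightarrow> nat) \<Rightarrow> ('k \<Rightarrow> nat \<Rightarrow> real) \<Rightarrow> 'k params measure" where
  "posterior prior n x = density lborel (\<lambda>z. ennreal (indicator param_space z * posterior_density prior n x z))"

lemma measurable_param_coord:
  "(\<lambda>z. (fst z $ i, snd z $ i)) \<in> borel_measurable (borel :: ('k::finite params) measure)"
  by (intro borel_measurable_continuous_onI continuous_intros)

lemma sets_flat_posterior[measurable_cong, simp]: "sets (flat_posterior n y) = sets borel"
  by (simp add: flat_posterior_def)

lemma nn_integral_flat_posterior:
  assumes [measurable]: "g \<in> borel_measurable borel" and n: "6 \<le> n" "0 < sample_dev n y"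
  shows "(\<integral>\<^sup>+t. g t * ennreal (flat_lik n y t) \<partial>lborel) = ennreal (flat_norm n y) * (\<integral>\<^sup>+t. g t \<partial>flat_posterior n y)"
proof -
  let ?Z = "flat_norm n y"
  have Z: "0 < ?Z" by (rule flat_norm_pos[OF n])
  have "(\<integral>\<^sup>+t. g t * ennreal (flat_lik n y t) \<partial>lborel) = (\<integral>\<^sup>+t. ennreal ?Z * (ennreal (flat_lik n y t / ?Z) * g t) \<partial>lborel)"
  proof (intro nn_integral_cong)
    fix t
    have "ennreal (flat_lik n y t) = ennreal ?Z * ennreal (flat_lik n y t / ?Z)"
      using Z flat_lik_nonneg[of n y t] by (simp add: ennreal_mult[symmetric])
    then show "g t * ennreal (flat_lik n y t) = ennreal ?Z * (ennreal (flat_lik n y t / ?Z) * g t)"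
      by (simp add: mult_ac)
  qed
  also have "\<dots> = ennreal ?Z * (\<integral>\<^sup>+t. ennreal (flat_lik n y t / ?Z) * g t \<partial>lborel)"
    by (intro nn_integral_cmult) measurable
  also have "(\<integral>\<^sup>+t. ennreal (flat_lik n y t / ?Z) * g t \<partial>lborel) = (\<integral>\<^sup>+t. g t \<partial>flat_posterior n y)"
    unfolding flat_posterior_def by (subst nn_integral_density) auto
  finally show ?thesis .
qed

text \<open>The bound \<open>C\<close> of the prior bounds the weight by a product of flat
  likelihoods, and the bound \<open>c\<close> on the boxes bounds the normalising integral from
  below by a multiple of the product of their total masses. In the quotient these masses cancel, and
  the designs other than \<open>i\<close> integrate to 1. So the constant does not depend on the
  sample sizes as long as \<open>\<kappa>\<close> does not, and each design is controlled by its own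
  data.\<close>

lemma posterior_dominated:
  fixes prior :: "'k::finite params \<Rightarrow> real" and n :: "'k \<Rightarrow> nat" and x :: "'k \<Rightarrow> nat \<Rightarrow> real"
    and Bx :: "'k \<Rightarrow> (real \<times> real) set"
  assumes meas: "(\<lambda>z. indicator param_space z * prior z) \<in> borel_measurable borel"
    and prior_bounds: "\<forall>z\<in>param_space. 0 \<le> prior z" "\<forall>z\<in>param_space. prior z \<le> C"
      "\<forall>z. (\<forall>i. (fst z $ i, snd z $ i) \<in> Bx i) \<longrightarrow> z \<in> param_space \<and> c \<le> prior z"
    and C: "0 \<le> C" and c: "0 < c" and \<kappa>: "0 < \<kappa>"
    and Bx: "\<And>i. Bx i \<in> sets borel"
    and n: "\<And>i. 6 \<le> n i" "\<And>i. 0 < sample_dev (n i) (x i)"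
    and mass: "\<And>i. \<kappa> \<le> measure (flat_posterior (n i) (x i)) (Bx i)"
  shows "prob_space (posterior prior n x)"
    and "AE z in posterior prior n x. \<forall>i. 0 < snd z $ i"
    and "\<And>g i. g \<in> borel_measurable borel \<Longrightarrow>
      (\<integral>\<^sup>+z. g (fst z $ i, snd z $ i) \<partial>posterior prior n x)
        \<le> ennreal (C / c * (1 / \<kappa>) ^ CARD('k)) * (\<integral>\<^sup>+t. g t \<partial>flat_posterior (n i) (x i))"
    and "mean_hat prior n x i = (\<integral>z. fst z $ i \<partial>posterior prior n x)"
    and "var_hat prior n x i = (\<integral>z. snd z $ i \<partial>posterior prior n x)"
proof -
  note prior = prior_bounds(1,2)[rule_format] prior_bounds(3)[THEN spec, THEN mp]
  let ?l = "\<lambda>i. flat_lik (n i) (x i)" and ?Z = "\<lambda>i. flat_norm (n i) (x i)" and ?F = "\<lambda>i. flat_posterior (n i) (x i)"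
  let ?L = "\<lambda>z. \<Prod>i\<in>UNIV. ?l i (fst z $ i, snd z $ i)"
  let ?W = "\<lambda>z. indicator param_space z * posterior_weight prior n x z"
  have Z: "0 < ?Z i" for i by (rule flat_norm_pos[OF n])
  have L_nonneg: "0 \<le> ?L z" for z by (intro prod_nonneg ballI flat_lik_nonneg)
  have [measurable]: "(\<lambda>z. ?l i (fst z $ i, snd z $ i)) \<in> borel_measurable (borel :: 'k params measure)" for i
    by (rule measurable_compose[OF measurable_param_coord]) simp
  have W_eq: "?W z = indicator param_space z * prior z * ?L z" for z
  proof (cases "z \<in> param_space")
    case True
    then have "0 < snd z $ i" for i by (auto simp: param_space_def)
    then show ?thesis by (simp add: posterior_weight_def flat_lik_def)
  qed simp
  have W_meas[measurable]: "?W \<in> borel_measurable borel" unfolding W_eq[abs_def] using meas by measurable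
  have W_nonneg: "0 \<le> ?W z" for z
    unfolding W_eq using prior(1)[of z] L_nonneg[of z] by (cases "z \<in> param_space") auto
  have W_le: "?W z \<le> C * ?L z" for z
    unfolding W_eq using prior(2)[of z] L_nonneg[of z] C
    by (cases "z \<in> param_space") (auto intro: mult_right_mono)
  have Lprod: "ennreal (?L z) = (\<Prod>i\<in>UNIV. ennreal (?l i (fst z $ i, snd z $ i)))" for z
    by (rule prod_ennreal[symmetric]) (rule flat_lik_nonneg)
  have gL: "(\<integral>\<^sup>+z. g (fst z $ i, snd z $ i) * ennreal (?L z) \<partial>lborel) = ennreal (\<Prod>j\<in>UNIV. ?Z j) * (\<integral>\<^sup>+t. g t \<partial>?F i)"
    if g: "g \<in> borel_measurable borel" for g i
  proof -
    \<comment> \<open>\<open>g\<close> sits in the factor of design \<open>i\<close> only; every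
      other factor integrates to its total mass \<open>?Z j\<close>.\<close>
    let ?h = "\<lambda>j t. (if j = i then g t else 1) * ennreal (?l j t)"
    have h_meas: "?h j \<in> borel_measurable borel" for j using g by (cases "j = i") auto
    have "g (fst z $ i, snd z $ i) * ennreal (?L z) = (\<Prod>j\<in>UNIV. ?h j (fst z $ j, snd z $ j))" for z :: "'k params"
      unfolding Lprod prod.distrib by simp
    then have "(\<integral>\<^sup>+z. g (fst z $ i, snd z $ i) * ennreal (?L z) \<partial>lborel) = (\<Prod>j\<in>UNIV. \<integral>\<^sup>+t. ?h j t \<partial>lborel)"
      by (simp only: nn_integral_pair_vec_prod[of ?h, OF h_meas])
    also have "\<dots> = (\<Prod>j\<in>UNIV. ennreal (?Z j) * (if j = i then \<integral>\<^sup>+t. g t \<partial>?F i else 1))"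
    proof (intro prod.cong refl)
      fix j
      have "emeasure (?F j) (space (?F j)) = 1"
        by (rule prob_space.emeasure_space_1[OF flat_posterior_moments(1)[OF n]])
      then show "(\<integral>\<^sup>+t. ?h j t \<partial>lborel) = ennreal (?Z j) * (if j = i then \<integral>\<^sup>+t. g t \<partial>?F i else 1)"
        using nn_integral_flat_posterior[OF g n] nn_integral_flat_posterior[of "\<lambda>_. 1", OF _ n, of j] by auto
    qed
    also have "\<dots> = ennreal (\<Prod>j\<in>UNIV. ?Z j) * (\<integral>\<^sup>+t. g t \<partial>?F i)"
      using Z by (simp add: prod.distrib prod_ennreal less_imp_le)
    finally show ?thesis .
  qed
  have upper: "(\<integral>\<^sup>+z. ennreal (?W z) \<partial>lborel) \<le> ennreal (C * (\<Prod>j\<in>UNIV. ?Z j))"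
  proof -
    fix i :: 'k
    have "(\<integral>\<^sup>+z. ennreal (?W z) \<partial>lborel) \<le> (\<integral>\<^sup>+z. ennreal C * (1 * ennreal (?L z)) \<partial>lborel)"
      using C L_nonneg W_le by (intro nn_integral_mono) (simp add: ennreal_mult[symmetric] ennreal_leI)
    also have "\<dots> = ennreal C * (\<integral>\<^sup>+z. 1 * ennreal (?L z) \<partial>lborel)" by (intro nn_integral_cmult) simp
    also have "(\<integral>\<^sup>+z. 1 * ennreal (?L z) \<partial>lborel) = ennreal (\<Prod>j\<in>UNIV. ?Z j)"
      using gL[of "\<lambda>_. 1" i] prob_space.emeasure_space_1[OF flat_posterior_moments(1)[OF n], of i] by simp
    finally show ?thesis using C Z by (simp add: ennreal_mult prod_nonneg less_imp_le)
  qed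
  have lower: "ennreal (c * (\<Prod>j\<in>UNIV. ?Z j * \<kappa>)) \<le> (\<integral>\<^sup>+z. ennreal (?W z) \<partial>lborel)"
  proof -
    let ?h = "\<lambda>j t. indicator (Bx j) t * ennreal (?l j t)"
    have h_meas: "?h j \<in> borel_measurable borel" for j using Bx[of j] by measurable
    have "ennreal (c * (\<Prod>j\<in>UNIV. ?Z j * \<kappa>)) = ennreal c * (\<Prod>j\<in>UNIV. ennreal (?Z j * \<kappa>))"
      using c Z \<kappa> by (subst prod_ennreal) (auto simp: ennreal_mult prod_nonneg less_imp_le)
    also have "\<dots> \<le> ennreal c * (\<Prod>j\<in>UNIV. \<integral>\<^sup>+t. ?h j t \<partial>lborel)"
    proof (intro mult_left_mono prod_mono_ennreal)
      fix j
      interpret F: prob_space "?F j" by (rule flat_posterior_moments(1)[OF n])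
      have "(\<integral>\<^sup>+t. ?h j t \<partial>lborel) = ennreal (?Z j) * emeasure (?F j) (Bx j)"
        using nn_integral_flat_posterior[of "indicator (Bx j)", OF _ n, of j] Bx[of j] by simp
      also have "\<dots> = ennreal (?Z j * measure (?F j) (Bx j))"
        using Z[of j] by (simp add: F.emeasure_eq_measure ennreal_mult)
      finally show "ennreal (?Z j * \<kappa>) \<le> (\<integral>\<^sup>+t. ?h j t \<partial>lborel)"
        using mass[of j] Z[of j] by (simp add: ennreal_leI)
    qed simp
    also have "(\<Prod>j\<in>UNIV. \<integral>\<^sup>+t. ?h j t \<partial>lborel) = (\<integral>\<^sup>+z. (\<Prod>j\<in>UNIV. ?h j (fst z $ j, snd z $ j)) \<partial>(lborel :: 'k params measure))"
      by (rule nn_integral_pair_vec_prod[of ?h, OF h_meas, symmetric])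
    also have "ennreal c * \<dots> = (\<integral>\<^sup>+z. ennreal c * (\<Prod>j\<in>UNIV. ?h j (fst z $ j, snd z $ j)) \<partial>lborel)"
    proof (intro nn_integral_cmult[symmetric])
      have "(\<lambda>z :: 'k params. ?h j (fst z $ j, snd z $ j)) \<in> borel_measurable lborel" for j
        using measurable_compose[OF measurable_param_coord h_meas, of j j] by simp
      then show "(\<lambda>z :: 'k params. \<Prod>j\<in>UNIV. ?h j (fst z $ j, snd z $ j)) \<in> borel_measurable lborel"
        by (intro borel_measurable_prod_ennreal) auto
    qed
    also have "\<dots> \<le> (\<integral>\<^sup>+z. ennreal (?W z) \<partial>lborel)"
    proof (intro nn_integral_mono)
      fix z :: "'k params"
      show "ennreal c * (\<Prod>j\<in>UNIV. ?h j (fst z $ j, snd z $ j)) \<le> ennreal (?W z)"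
      proof (cases "\<forall>i. (fst z $ i, snd z $ i) \<in> Bx i")
        case True
        then have "z \<in> param_space" "c \<le> prior z" using prior(3)[of z] by auto
        then have "c * ?L z \<le> ?W z" unfolding W_eq using L_nonneg[of z] by (auto intro: mult_right_mono)
        moreover have "ennreal c * (\<Prod>j\<in>UNIV. ?h j (fst z $ j, snd z $ j)) = ennreal (c * ?L z)"
          using True c L_nonneg[of z] by (simp add: Lprod ennreal_mult)
        ultimately show ?thesis by (simp add: ennreal_leI)
      next
        case False
        then obtain i where "(fst z $ i, snd z $ i) \<notin> Bx i" by auto
        then have "?h i (fst z $ i, snd z $ i) = 0" by simp
        then have 0: "(\<Prod>j\<in>UNIV. ?h j (fst z $ j, snd z $ j)) = 0" by (intro prod_zero bexI[of _ i]) auto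
        show ?thesis unfolding 0 by simp
      qed
    qed
    finally show ?thesis .
  qed
  define Den where "Den = (LINT z:param_space|lborel. posterior_weight prior n x z)"
  have Den: "ennreal Den = (\<integral>\<^sup>+z. ennreal (?W z) \<partial>lborel)"
  proof -
    have fin: "(\<integral>\<^sup>+z. ennreal (?W z) \<partial>lborel) < \<infinity>" using upper by (rule le_less_trans) simp
    have "integrable lborel ?W" using fin W_nonneg by (intro integrableI_nonneg) auto
    then have "(\<integral>\<^sup>+z. ennreal (?W z) \<partial>lborel) = ennreal (\<integral>z. ?W z \<partial>lborel)"
      using W_nonneg by (intro nn_integral_eq_integral) auto
    then show ?thesis by (simp add: Den_def set_lebesgue_integral_def)
  qed
  have P: "0 < (\<Prod>j\<in>UNIV. ?Z j)" using Z by (intro prod_pos) auto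
  have Den_ge: "c * (\<Prod>j\<in>UNIV. ?Z j) * \<kappa> ^ CARD('k) \<le> Den" and Den_pos: "0 < Den"
  proof -
    have *: "0 < c * (\<Prod>j\<in>UNIV. ?Z j) * \<kappa> ^ CARD('k)" using c P \<kappa> by simp
    have "ennreal (c * (\<Prod>j\<in>UNIV. ?Z j) * \<kappa> ^ CARD('k)) \<le> ennreal Den"
      using lower by (simp add: Den prod.distrib mult.assoc)
    moreover have "0 \<le> Den" unfolding Den_def set_lebesgue_integral_def using W_nonneg by (intro integral_nonneg_AE) auto
    ultimately show "c * (\<Prod>j\<in>UNIV. ?Z j) * \<kappa> ^ CARD('k) \<le> Den" using * by (simp add: ennreal_le_iff)
    with * show "0 < Den" by linarith
  qed
  have dens: "indicator param_space z * posterior_density prior n x z = ?W z / Den" for z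
    by (simp add: posterior_density_def Den_def)
  have post: "posterior prior n x = density lborel (\<lambda>z. ennreal (?W z / Den))"
    unfolding posterior_def dens ..
  have nnp: "(\<integral>\<^sup>+z. g z \<partial>posterior prior n x) = (\<integral>\<^sup>+z. ennreal (?W z / Den) * g z \<partial>lborel)"
    if "g \<in> borel_measurable borel" for g
    unfolding post using that by (subst nn_integral_density) auto
  have "emeasure (posterior prior n x) (space (posterior prior n x)) = (\<integral>\<^sup>+z. 1 \<partial>posterior prior n x)" by simp
  also have "\<dots> = (\<integral>\<^sup>+z. ennreal (1 / Den) * ennreal (?W z) \<partial>lborel)"
    using Den_pos W_nonneg by (subst nnp) (auto simp: ennreal_mult[symmetric])
  also have "\<dots> = ennreal (1 / Den) * ennreal Den" unfolding Den by (intro nn_integral_cmult) simp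
  also have "\<dots> = 1" using Den_pos by (simp add: ennreal_mult[symmetric])
  finally show "prob_space (posterior prior n x)" by (intro prob_spaceI) simp
  show "AE z in posterior prior n x. \<forall>i. 0 < snd z $ i"
  proof -
    have m: "(\<lambda>z. ennreal (?W z / Den)) \<in> borel_measurable lborel" by simp
    show ?thesis
      unfolding post AE_density[OF m] by (auto intro!: AE_I2 simp: param_space_def indicator_def split: if_splits)
  qed
  show "(\<integral>\<^sup>+z. g (fst z $ i, snd z $ i) \<partial>posterior prior n x)
        \<le> ennreal (C / c * (1 / \<kappa>) ^ CARD('k)) * (\<integral>\<^sup>+t. g t \<partial>?F i)"
    if g: "g \<in> borel_measurable borel" for g i
  proof -
    have gz: "(\<lambda>z :: 'k params. g (fst z $ i, snd z $ i)) \<in> borel_measurable borel"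
      by (rule measurable_compose[OF measurable_param_coord g])
    have "(\<integral>\<^sup>+z. g (fst z $ i, snd z $ i) \<partial>posterior prior n x) = (\<integral>\<^sup>+z. ennreal (?W z / Den) * g (fst z $ i, snd z $ i) \<partial>lborel)"
      by (rule nnp[OF gz])
    also have "\<dots> \<le> (\<integral>\<^sup>+z. ennreal (C / Den) * (g (fst z $ i, snd z $ i) * ennreal (?L z)) \<partial>lborel)"
    proof (intro nn_integral_mono)
      fix z :: "'k params"
      have "ennreal (?W z / Den) \<le> ennreal (C / Den * ?L z)"
        using W_le[of z] Den_pos by (intro ennreal_leI) (simp add: divide_right_mono)
      also have "\<dots> = ennreal (C / Den) * ennreal (?L z)"
        using C Den_pos L_nonneg[of z] by (intro ennreal_mult) auto
      finally have "ennreal (?W z / Den) * g (fst z $ i, snd z $ i) \<le> ennreal (C / Den) * ennreal (?L z) * g (fst z $ i, snd z $ i)"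
        by (intro mult_right_mono) auto
      then show "ennreal (?W z / Den) * g (fst z $ i, snd z $ i) \<le> ennreal (C / Den) * (g (fst z $ i, snd z $ i) * ennreal (?L z))"
        by (simp add: mult_ac)
    qed
    also have "\<dots> = ennreal (C / Den) * (\<integral>\<^sup>+z. g (fst z $ i, snd z $ i) * ennreal (?L z) \<partial>lborel)"
      by (intro nn_integral_cmult borel_measurable_times_ennreal) (use gz in simp_all)
    also have "\<dots> = ennreal (C / Den * (\<Prod>j\<in>UNIV. ?Z j)) * (\<integral>\<^sup>+t. g t \<partial>?F i)"
    proof -
      have e: "ennreal (C / Den * (\<Prod>j\<in>UNIV. ?Z j)) = ennreal (C / Den) * ennreal (\<Prod>j\<in>UNIV. ?Z j)"
        using C Den_pos P by (intro ennreal_mult) auto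
      show ?thesis unfolding gL[OF g] e by (simp only: mult.assoc)
    qed
    also have "\<dots> \<le> ennreal (C / c * (1 / \<kappa>) ^ CARD('k)) * (\<integral>\<^sup>+t. g t \<partial>?F i)"
    proof (intro mult_right_mono ennreal_leI)
      have "C / Den * (\<Prod>j\<in>UNIV. ?Z j) \<le> C / (c * (\<Prod>j\<in>UNIV. ?Z j) * \<kappa> ^ CARD('k)) * (\<Prod>j\<in>UNIV. ?Z j)"
        using Den_ge Den_pos C c P \<kappa> by (intro mult_right_mono divide_left_mono) auto
      also have "C / (c * p * \<kappa> ^ CARD('k)) * p = C / c * (1 / \<kappa>) ^ CARD('k)" if "0 < p" for p
        using that by (simp add: power_one_over)
      from this[OF P] have "C / (c * (\<Prod>j\<in>UNIV. ?Z j) * \<kappa> ^ CARD('k)) * (\<Prod>j\<in>UNIV. ?Z j) = C / c * (1 / \<kappa>) ^ CARD('k)" .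
      finally show "C / Den * (\<Prod>j\<in>UNIV. ?Z j) \<le> C / c * (1 / \<kappa>) ^ CARD('k)" .
    qed simp
    finally show ?thesis .
  qed
  have int_eq: "(LINT z:param_space|lborel. f z * posterior_density prior n x z) = (\<integral>z. f z \<partial>posterior prior n x)"
    if "f \<in> borel_measurable borel" for f :: "'k params \<Rightarrow> real"
  proof -
    have "(\<integral>z. f z \<partial>posterior prior n x) = (\<integral>z. (?W z / Den) *\<^sub>R f z \<partial>lborel)"
      unfolding post using that W_nonneg Den_pos by (intro integral_density) auto
    also have "\<dots> = (\<integral>z. indicator param_space z *\<^sub>R (f z * posterior_density prior n x z) \<partial>lborel)"
      by (intro Bochner_Integration.integral_cong refl) (simp add: dens[symmetric])
    finally show ?thesis by (simp add: set_lebesgue_integral_def)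
  qed
  show "mean_hat prior n x i = (\<integral>z. fst z $ i \<partial>posterior prior n x)"
    unfolding mean_hat_def by (intro int_eq borel_measurable_continuous_onI continuous_intros)
  show "var_hat prior n x i = (\<integral>z. snd z $ i \<partial>posterior prior n x)"
    unfolding var_hat_def by (intro int_eq borel_measurable_continuous_onI continuous_intros)
qed

section \<open>Consistency and uniform bounds of the posterior estimates\<close>

lemma sample_dev_pos:
  assumes "y 0 \<noteq> y 1" "2 \<le> n"
  shows "0 < sample_dev n y"
proof (rule ccontr)
  assume "\<not> 0 < sample_dev n y"
  then have "sample_dev n y = 0" by (simp add: sample_dev_def not_less sum_nonneg antisym)
  then have "\<forall>l<n. y l = sample_mean n y" by (simp add: sample_dev_def sum_nonneg_eq_0_iff)
  then show False using assms by auto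
qed

lemma sample_dev_limits:
  assumes v: "(\<lambda>n. sample_dev n y / n) \<longlonglongrightarrow> v" "0 < v"
  shows "(\<lambda>n. sample_dev n y / (real n - 5)) \<longlonglongrightarrow> v"
    and "(\<lambda>n. (real n - 3) / sample_dev n y) \<longlonglongrightarrow> 1 / v"
    and "(\<lambda>n. sample_dev n y / (n * (real n - 5))) \<longlonglongrightarrow> 0"
proof -
  have "(\<lambda>n. (sample_dev n y / n) / (1 - 5 / real n)) \<longlonglongrightarrow> v / (1 - 0)"
    by (intro tendsto_divide v tendsto_diff tendsto_const lim_const_over_n) simp
  moreover have "\<forall>\<^sub>F n in sequentially. (sample_dev n y / n) / (1 - 5 / real n) = sample_dev n y / (real n - 5)"
    using eventually_gt_at_top[of 0]
  proof eventually_elim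
    case (elim n)
    then have "real n * (1 - 5 / real n) = real n - 5" by (simp add: right_diff_distrib)
    then show ?case by simp
  qed
  ultimately have "(\<lambda>n. sample_dev n y / (real n - 5)) \<longlonglongrightarrow> v / (1 - 0)"
    by (rule Lim_transform_eventually)
  then show 1: "(\<lambda>n. sample_dev n y / (real n - 5)) \<longlonglongrightarrow> v" by simp
  have "(\<lambda>n. (1 - 3 / real n) / (sample_dev n y / n)) \<longlonglongrightarrow> (1 - 0) / v"
    using v by (intro tendsto_divide tendsto_diff tendsto_const lim_const_over_n) auto
  moreover have "\<forall>\<^sub>F n in sequentially. (1 - 3 / real n) / (sample_dev n y / n) = (real n - 3) / sample_dev n y"
    using eventually_gt_at_top[of 0]
  proof eventually_elim
    case (elim n)
    then have "(1 - 3 / real n) * real n = real n - 3" by (simp add: left_diff_distrib)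
    then show ?case by simp
  qed
  ultimately have "(\<lambda>n. (real n - 3) / sample_dev n y) \<longlonglongrightarrow> (1 - 0) / v"
    by (rule Lim_transform_eventually)
  then show "(\<lambda>n. (real n - 3) / sample_dev n y) \<longlonglongrightarrow> 1 / v" by simp
  have "(\<lambda>n. sample_dev n y / (real n - 5) * (1 / real n)) \<longlonglongrightarrow> v * 0"
    by (intro tendsto_mult 1 lim_const_over_n)
  then show "(\<lambda>n. sample_dev n y / (n * (real n - 5))) \<longlonglongrightarrow> 0" by (simp add: mult.commute)
qed

lemma variance_deviation_lower:
  fixes v e t :: real
  assumes "0 < t" "0 < e" "e < v" "e < \<bar>t - v\<bar>"
  shows "1 \<le> (t - 2 * v + v\<^sup>2 * (1 / t)) * (2 * v / e\<^sup>2)"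
proof -
  define d where "d = \<bar>t - v\<bar>"
  have d: "e < d" "t \<le> v + d" "(t - v)\<^sup>2 = d\<^sup>2" using assms by (auto simp: d_def)
  have "e\<^sup>2 * t \<le> e\<^sup>2 * (v + d)" using d by (intro mult_left_mono) auto
  also have "\<dots> = e * e * v + e * (e * d)" by (simp add: power2_eq_square algebra_simps)
  also have "\<dots> \<le> d * d * v + v * (d * d)"
    using d assms by (intro add_mono mult_mono) auto
  also have "\<dots> = 2 * v * (t - v)\<^sup>2" unfolding d(3) by (simp add: power2_eq_square)
  finally have *: "e\<^sup>2 * t \<le> 2 * v * (t - v)\<^sup>2" .
  have "(t - 2 * v + v\<^sup>2 * (1 / t)) * (2 * v / e\<^sup>2) = 2 * v * (t - v)\<^sup>2 / (e\<^sup>2 * t)"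
    using assms by (simp add: power2_eq_square field_simps)
  then show ?thesis using * assms by simp
qed

lemma variance_deviation_nonneg:
  fixes v t :: real
  assumes "0 < t"
  shows "0 \<le> t - 2 * v + v\<^sup>2 * (1 / t)"
proof -
  have "t - 2 * v + v\<^sup>2 * (1 / t) = (t - v)\<^sup>2 / t" using assms by (simp add: power2_eq_square field_simps)
  then show ?thesis using assms by simp
qed

lemma flat_posterior_variance_deviation:
  assumes "6 \<le> n" "0 < sample_dev n y"
  shows "has_bochner_integral (flat_posterior n y) (\<lambda>z. snd z - 2 * v + v\<^sup>2 * (1 / snd z))
    (sample_dev n y / (real n - 5) - 2 * v + v\<^sup>2 * ((real n - 3) / sample_dev n y))"
proof -
  note m = flat_posterior_moments[OF assms]
  interpret prob_space "flat_posterior n y" by (rule m(1))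
  have c: "has_bochner_integral (flat_posterior n y) (\<lambda>z. 2 * v) (2 * v)"
    by (simp add: has_bochner_integral_iff prob_space)
  show ?thesis
    by (intro has_bochner_integral_add has_bochner_integral_diff c has_bochner_integral_mult_right m)
qed

text \<open>For large \<open>n\<close>, Chebyshev bounds in both coordinates show that the mass
  tends to 1. Each of the finitely many remaining \<open>n \<ge> 6\<close> has positive mass because
  the density is positive on the box, so a common lower bound exists.\<close>

lemma flat_posterior_box_mass:
  assumes y: "y 0 \<noteq> y 1" and m: "(\<lambda>n. sample_mean n y) \<longlonglongrightarrow> m"
    and v: "(\<lambda>n. sample_dev n y / n) \<longlonglongrightarrow> v" "0 < v" and e: "0 < e" "e < v"
  shows "\<exists>\<kappa>>0. \<forall>n\<ge>6. \<kappa> \<le> measure (flat_posterior n y) ({m - e..m + e} \<times> {v - e..v + e})"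
proof -
  let ?F = "\<lambda>n. flat_posterior n y" and ?B = "{m - e..m + e} \<times> {v - e..v + e}"
  have B[measurable]: "?B \<in> sets borel" by (simp add: borel_closed closed_Times)
  have dev: "0 < sample_dev n y" if "6 \<le> n" for n using sample_dev_pos[OF y, of n] that by simp
  \<comment> \<open>The first summand bounds the squared distance of the mean from \<open>m\<close>
    by the posterior spread and the error of the sample mean; the second is the expectation of
    \<open>(snd z - v)\<^sup>2 / snd z\<close> with the factor of
    \<open>variance_deviation_lower\<close>.\<close>
  define err where "err n = (2 * (sample_dev n y / (n * (real n - 5))) + 2 * (sample_mean n y - m)\<^sup>2) / e\<^sup>2
    + (sample_dev n y / (real n - 5) - 2 * v + v\<^sup>2 * ((real n - 3) / sample_dev n y)) * (2 * v / e\<^sup>2)" for n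
  have "err \<longlonglongrightarrow> (2 * 0 + 2 * (m - m)\<^sup>2) / e\<^sup>2 + (v - 2 * v + v\<^sup>2 * (1 / v)) * (2 * v / e\<^sup>2)"
    unfolding err_def using e by (intro tendsto_intros m sample_dev_limits[OF v]) auto
  then have "err \<longlonglongrightarrow> 0" using v by (simp add: power2_eq_square)
  then have "\<forall>\<^sub>F n in sequentially. err n < 1 / 2" by (rule order_tendstoD) simp
  then obtain n1 where n1: "\<And>n. n \<ge> n1 \<Longrightarrow> err n < 1 / 2" by (auto simp: eventually_sequentially)
  have mass: "1 - err n \<le> measure (?F n) ?B" if n: "6 \<le> n" for n
  proof -
    note mo = flat_posterior_moments[OF n dev[OF n]]
    interpret prob_space "?F n" by (rule mo(1))
    \<comment> \<open>\<open>?g\<close> is at least 1 wherever the variance is positive, hence so is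
      its integral, the mass of the box plus \<open>err n\<close>.\<close>
    let ?g = "\<lambda>z. indicator ?B z + (2 * (fst z - sample_mean n y)\<^sup>2 + 2 * (sample_mean n y - m)\<^sup>2) / e\<^sup>2
      + (snd z - 2 * v + v\<^sup>2 * (1 / snd z)) * (2 * v / e\<^sup>2)"
    have i1: "has_bochner_integral (?F n) (indicator ?B) (measure (?F n) ?B)"
      using B by (intro has_bochner_integral_real_indicator) (auto simp: emeasure_eq_measure)
    have i2: "has_bochner_integral (?F n) (\<lambda>z. 2 * (sample_mean n y - m)\<^sup>2) (2 * (sample_mean n y - m)\<^sup>2)"
      by (simp add: has_bochner_integral_iff prob_space)
    have g: "has_bochner_integral (?F n) ?g (measure (?F n) ?B + err n)"
      unfolding err_def add.assoc[symmetric]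
      by (intro has_bochner_integral_add has_bochner_integral_divide_zero i1 i2 flat_posterior_variance_deviation[OF n dev[OF n]]
          has_bochner_integral_mult_left has_bochner_integral_mult_right mo)
    have pw: "1 \<le> ?g z" if z: "0 < snd z" for z
    proof -
      have nn: "0 \<le> (snd z - 2 * v + v\<^sup>2 * (1 / snd z)) * (2 * v / e\<^sup>2)"
        using variance_deviation_nonneg[OF z, of v] v(2) by (intro mult_nonneg_nonneg) auto
      have nn': "0 \<le> (2 * (fst z - sample_mean n y)\<^sup>2 + 2 * (sample_mean n y - m)\<^sup>2) / e\<^sup>2" by simp
      have "z \<in> ?B" if "\<not> e < \<bar>fst z - m\<bar>" "\<not> e < \<bar>snd z - v\<bar>"
        using that by (cases z) (auto simp: abs_le_iff not_less)
      then consider "z \<in> ?B" | "e < \<bar>fst z - m\<bar>" | "e < \<bar>snd z - v\<bar>" by blast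
      then show ?thesis
      proof cases
        case 1
        then have "indicator ?B z = (1 :: real)" by (rule indicator_simps)
        then show ?thesis using nn nn' by linarith
      next
        case 2
        then have "e\<^sup>2 \<le> (fst z - m)\<^sup>2" using e by (subst power2_abs[symmetric]) (intro power_mono, auto)
        also have "\<dots> \<le> 2 * (fst z - sample_mean n y)\<^sup>2 + 2 * (sample_mean n y - m)\<^sup>2"
          using zero_le_power2[of "(fst z - sample_mean n y) - (sample_mean n y - m)"]
          by (simp add: power2_eq_square algebra_simps)
        finally have "1 \<le> (2 * (fst z - sample_mean n y)\<^sup>2 + 2 * (sample_mean n y - m)\<^sup>2) / e\<^sup>2" using e by simp
        moreover have "0 \<le> (indicator ?B z :: real)" by simp
        ultimately show ?thesis using nn by linarith
      next
        case 3
        have "0 \<le> (indicator ?B z :: real)" by simp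
        then show ?thesis using variance_deviation_lower[OF z e 3] nn' by linarith
      qed
    qed
    have "AE z in ?F n. 1 \<le> ?g z" using mo(2) by eventually_elim (rule pw)
    then have "(\<integral>z. 1 \<partial>?F n) \<le> (\<integral>z. ?g z \<partial>?F n)"
      using g by (intro integral_mono_AE) (auto simp: has_bochner_integral_iff)
    then show ?thesis using has_bochner_integral_integral_eq[OF g] prob_space by simp
  qed
  have pos: "0 < measure (?F n) ?B" if n: "6 \<le> n" for n
  proof (rule ccontr)
    assume "\<not> 0 < measure (?F n) ?B"
    then have 0: "measure (?F n) ?B = 0" by (simp add: not_less measure_nonneg antisym)
    note mo = flat_posterior_moments[OF n dev[OF n]]
    interpret prob_space "?F n" by (rule mo(1))
    have "emeasure (?F n) ?B = 0" using 0 by (simp add: emeasure_eq_measure)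
    then have "(\<integral>\<^sup>+z. ennreal (flat_lik n y z / flat_norm n y) * indicator ?B z \<partial>lborel) = 0"
      unfolding flat_posterior_def using B by (subst (asm) emeasure_density) auto
    then have "AE z in lborel. ennreal (flat_lik n y z / flat_norm n y) * indicator ?B z = 0"
      by (subst (asm) nn_integral_0_iff_AE) auto
    then have "AE z in (lborel :: (real \<times> real) measure). z \<notin> ?B"
    proof eventually_elim
      case (elim z)
      have "0 < flat_lik n y z" if "z \<in> ?B"
        using that e by (cases z) (auto simp: flat_lik_def intro!: prod_pos normal_density_pos)
      then show ?case using elim flat_norm_pos[OF n dev[OF n]] by (auto simp: indicator_def split: if_splits)
    qed
    then have "emeasure (lborel :: (real \<times> real) measure) ?B = 0"
      using B by (subst (asm) AE_iff_measurable[OF _ refl]) auto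
    moreover have "emeasure (lborel :: (real \<times> real) measure) ?B = ennreal (2 * e) * ennreal (2 * e)"
      unfolding lborel_prod[symmetric] using e by (subst lborel.emeasure_pair_measure_Times) auto
    ultimately show False using e by (simp add: ennreal_mult[symmetric])
  qed
  define \<kappa> where "\<kappa> = Min (insert (1 / 2) ((\<lambda>n. measure (?F n) ?B) ` {6..<n1}))"
  have "0 < \<kappa>" unfolding \<kappa>_def using pos by (subst Min_gr_iff) auto
  moreover have "\<kappa> \<le> measure (?F n) ?B" if n: "6 \<le> n" for n
  proof (cases "n1 \<le> n")
    case True
    have "\<kappa> \<le> 1 / 2" unfolding \<kappa>_def by (intro Min_le) auto
    then show ?thesis using n1[OF True] mass[OF n] by linarith
  next
    case False
    then show ?thesis unfolding \<kappa>_def using n by (intro Min_le) auto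
  qed
  ultimately show ?thesis by blast
qed

lemma (in prob_space) mean_error_le:
  assumes X: "random_variable borel X" "integrable M (\<lambda>\<omega>. (X \<omega> - x)\<^sup>2)" and s: "expectation (\<lambda>\<omega>. (X \<omega> - x)\<^sup>2) \<le> s"
  shows "\<bar>expectation X - x\<bar> \<le> sqrt s"
proof -
  have i: "integrable M (\<lambda>\<omega>. X \<omega> - x)" 
  proof (rule square_integrable_imp_integrable)
    show "random_variable borel (\<lambda>\<omega>. X \<omega> - x)" using X(1) by measurable
  qed (rule X(2))
  then have iX: "integrable M X" using Bochner_Integration.integrable_add[OF i integrable_const[of x]] by simp
  have "0 \<le> variance (\<lambda>\<omega>. X \<omega> - x)" by (rule variance_positive)
  also have "\<dots> = expectation (\<lambda>\<omega>. (X \<omega> - x)\<^sup>2) - (expectation (\<lambda>\<omega>. X \<omega> - x))\<^sup>2" using i X by (intro variance_eq)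
  finally have "(expectation X - x)\<^sup>2 \<le> s" using s iX by (simp add: prob_space)
  then show ?thesis by (metis real_sqrt_abs real_sqrt_le_iff)
qed

lemma (in prob_space) dominated_expectation:
  assumes dom: "(\<integral>\<^sup>+z. ennreal (g (h z)) \<partial>M) \<le> ennreal K * (\<integral>\<^sup>+t. ennreal (g t) \<partial>F)" and K: "0 \<le> K"
    and F: "has_bochner_integral F g b" "AE t in F. 0 \<le> g t"
    and gh: "(\<lambda>z. g (h z)) \<in> borel_measurable M" "AE z in M. 0 \<le> g (h z)"
  shows "integrable M (\<lambda>z. g (h z))" and "expectation (\<lambda>z. g (h z)) \<le> K * b"
proof -
  have "(\<integral>\<^sup>+t. ennreal (g t) \<partial>F) = ennreal b"
    using F by (subst nn_integral_eq_integral) (auto simp: has_bochner_integral_iff)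
  then have le: "(\<integral>\<^sup>+z. ennreal (g (h z)) \<partial>M) \<le> ennreal (K * b)"
    using dom K by (simp add: ennreal_mult')
  have b: "0 \<le> b" using F integral_nonneg_AE[OF F(2)] by (simp add: has_bochner_integral_iff)
  show i: "integrable M (\<lambda>z. g (h z))"
    using le_less_trans[OF le ennreal_less_top] gh by (intro integrableI_nonneg) auto
  have "ennreal (expectation (\<lambda>z. g (h z))) \<le> ennreal (K * b)"
    using le nn_integral_eq_integral[OF i gh(2)] by simp
  then show "expectation (\<lambda>z. g (h z)) \<le> K * b" using K b by (simp add: ennreal_le_iff)
qed

text \<open>Every bound is a moment of the flat posterior of a single design times the constant
  \<open>K\<close>. Hence the first part holds for all sample sizes from 6 on, whatever the sizes of
  the other designs. Since convergent sequences are bounded, \<open>lo\<close>, \<open>hi\<close>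
  and \<open>C\<close> can be chosen for all sizes at once; they depend on the path.\<close>

lemma posterior_estimates:
  fixes prior :: "'k::finite params \<Rightarrow> real" and \<mu> v :: "'k \<Rightarrow> real" and x :: "'k \<Rightarrow> nat \<Rightarrow> real"
  assumes prior: "admissible_prior \<mu> v prior" and v: "\<And>i. 0 < v i"
    and x: "\<And>i. x i 0 \<noteq> x i 1"
    and mean: "\<And>i. (\<lambda>n. sample_mean n (x i)) \<longlonglongrightarrow> \<mu> i"
    and dev: "\<And>i. (\<lambda>n. sample_dev n (x i) / n) \<longlonglongrightarrow> v i"
  shows "\<exists>lo hi C. 0 < lo \<and> (\<forall>n i. (\<forall>j. 6 \<le> n j) \<longrightarrow>
      lo \<le> var_hat prior n x i \<and> var_hat prior n x i \<le> hi \<and>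
      \<bar>mean_hat prior n x i - sample_mean (n i) (x i)\<bar> \<le> C / sqrt (n i))"
    and "0 < \<epsilon> \<Longrightarrow> \<exists>n1. \<forall>n. (\<forall>j. 6 \<le> n j) \<and> n1 \<le> n i \<longrightarrow> \<bar>var_hat prior n x i - v i\<bar> \<le> \<epsilon>"
proof -
  obtain C0 where C0: "\<And>z. z \<in> param_space \<Longrightarrow> prior z \<le> C0"
    using prior by (auto simp: admissible_prior_def)
  obtain e c where e: "0 < e" "e < Min (range v) / 2" and c: "0 < c" "\<And>z. z \<in> prior_core \<mu> v e \<Longrightarrow> c \<le> prior z"
    using prior by (auto simp: admissible_prior_def)
  have pnn: "\<And>z. z \<in> param_space \<Longrightarrow> 0 \<le> prior z" using prior by (auto simp: admissible_prior_def)
  have meas: "(\<lambda>z. indicator param_space z * prior z) \<in> borel_measurable borel"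
    using prior by (auto simp: admissible_prior_def set_integrable_def dest!: borel_measurable_integrable)
  have vmin: "Min (range v) \<le> v i" for i by (intro Min_le) auto
  have ev: "e < v i" for i using e vmin[of i] by linarith
  define C1 where "C1 = max C0 0"
  let ?B = "\<lambda>i. {\<mu> i - e..\<mu> i + e} \<times> {v i - e..v i + e}"
  have B_core: "z \<in> param_space \<and> c \<le> prior z" if z: "\<forall>i. (fst z $ i, snd z $ i) \<in> ?B i" for z
  proof
    have "0 < snd z $ i" for i using z[rule_format, of i] ev[of i] by auto
    then show "z \<in> param_space" by (cases z) (auto simp: param_space_def)
    have "fst z $ i \<in> {Min (range \<mu>) - e..Max (range \<mu>) + e} \<and>
        snd z $ i \<in> {Min (range v) - e..Max (range v) + e + (Max (range \<mu>) - Min (range \<mu>) + 2 * e)\<^sup>2}" for i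
    proof -
      have "Min (range \<mu>) \<le> \<mu> i" "\<mu> i \<le> Max (range \<mu>)" "Min (range v) \<le> v i" "v i \<le> Max (range v)"
        by (auto intro!: Min_le Max_ge)
      moreover have "0 \<le> (Max (range \<mu>) - Min (range \<mu>) + 2 * e)\<^sup>2" by simp
      moreover have "\<mu> i - e \<le> fst z $ i" "fst z $ i \<le> \<mu> i + e" "v i - e \<le> snd z $ i" "snd z $ i \<le> v i + e"
        using z[rule_format, of i] by auto
      ultimately show ?thesis unfolding atLeastAtMost_iff by linarith
    qed
    then have "z \<in> prior_core \<mu> v e" by (cases z) (simp add: prior_core_def Let_def)
    then show "c \<le> prior z" by (rule c)
  qed
  have B: "?B i \<in> sets borel" for i by (simp add: borel_closed closed_Times)
  have "\<exists>\<kappa>>0. \<forall>n\<ge>6. \<kappa> \<le> measure (flat_posterior n (x i)) (?B i)" for i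
    by (rule flat_posterior_box_mass[OF x mean dev v e(1) ev])
  then obtain \<kappa>' where \<kappa>': "\<And>i. 0 < \<kappa>' i" "\<And>i n. 6 \<le> n \<Longrightarrow> \<kappa>' i \<le> measure (flat_posterior n (x i)) (?B i)"
    by metis
  define \<kappa> where "\<kappa> = Min (range \<kappa>')"
  have \<kappa>: "0 < \<kappa>" "\<And>i. \<kappa> \<le> \<kappa>' i" using \<kappa>' by (auto simp: \<kappa>_def)
  define K where "K = C1 / c * (1 / \<kappa>) ^ CARD('k) + 1"
  have K: "0 < K" using c \<kappa> by (auto simp: K_def C1_def intro!: add_nonneg_pos mult_nonneg_nonneg)
  have sd: "0 < sample_dev n (x i)" if "6 \<le> n" for n i using sample_dev_pos[of "x i" n] x[of i] that by simp
  define R1 where "R1 i n = sample_dev n (x i) / (real n - 5)" for i n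
  define R2 where "R2 i n = (real n - 3) / sample_dev n (x i)" for i n
  have R: "R1 i \<longlonglongrightarrow> v i" "R2 i \<longlonglongrightarrow> 1 / v i" for i
    unfolding R1_def R2_def by (rule sample_dev_limits[OF dev v])+
  have "\<exists>b>0. \<forall>n. \<bar>R1 i n\<bar> \<le> b \<and> \<bar>R2 i n\<bar> \<le> b" for i
  proof -
    obtain b1 b2 where "0 < b1" "\<And>n. norm (R1 i n) \<le> b1" "0 < b2" "\<And>n. norm (R2 i n) \<le> b2"
      using convergent_imp_Bseq[OF convergentI[OF R(1)[of i]]] convergent_imp_Bseq[OF convergentI[OF R(2)[of i]]]
      by (auto simp: Bseq_def)
    then show ?thesis by (intro exI[of _ "max b1 b2"]) (auto simp: le_max_iff_disj)
  qed
  then obtain b' where b': "\<And>i. 0 < b' i" "\<And>i n. \<bar>R1 i n\<bar> \<le> b' i \<and> \<bar>R2 i n\<bar> \<le> b' i" by metis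
  define b where "b = Max (range b')"
  have b: "0 < b" "\<And>i n. \<bar>R1 i n\<bar> \<le> b" "\<And>i n. \<bar>R2 i n\<bar> \<le> b"
  proof -
    have le: "b' i \<le> b" for i by (simp add: b_def)
    show "0 < b" using b'(1) le by (meson less_le_trans)
    show "\<bar>R1 i n\<bar> \<le> b" "\<bar>R2 i n\<bar> \<le> b" for i n using b'(2)[of i n] le[of i] by linarith+
  qed
  \<comment> \<open>\<open>q\<close> is the flat-posterior mean of
    \<open>(t - v i)\<^sup>2 / t\<close>; it tends to 0 because the means of \<open>t\<close> and
    \<open>1 / t\<close> tend to \<open>v i\<close> and \<open>1 / v i\<close>.\<close>
  define q where "q i n = R1 i n - 2 * v i + (v i)\<^sup>2 * R2 i n" for i n
  have "q i \<longlonglongrightarrow> v i - 2 * v i + (v i)\<^sup>2 * (1 / v i)" for i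
    unfolding q_def by (intro tendsto_intros R)
  then have q_lim: "q i \<longlonglongrightarrow> 0" for i using v[of i] by (simp add: power2_eq_square)
  have est: "1 / (K * b) \<le> var_hat prior n x i" "var_hat prior n x i \<le> K * b"
      "\<bar>mean_hat prior n x i - sample_mean (n i) (x i)\<bar> \<le> sqrt (K * b) / sqrt (n i)"
      "\<And>\<eta>. 0 < \<eta> \<Longrightarrow> \<bar>var_hat prior n x i - v i\<bar> \<le> \<eta> + (v i / \<eta> + 1) * (K * q i (n i))"
    if n: "\<forall>j. 6 \<le> n j" for n i
  proof -
    let ?P = "posterior prior n x" and ?F = "flat_posterior (n i) (x i)"
    note n' = n[rule_format]
    have bounds: "\<forall>z\<in>param_space. 0 \<le> prior z" "\<forall>z\<in>param_space. prior z \<le> C1"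
      "\<forall>z. (\<forall>i. (fst z $ i, snd z $ i) \<in> ?B i) \<longrightarrow> z \<in> param_space \<and> c \<le> prior z" "0 \<le> C1"
      using C0 pnn B_core by (force simp: C1_def le_max_iff_disj)+
    have mass: "\<kappa> \<le> measure (flat_posterior (n j) (x j)) (?B j)" for j
      using \<kappa>(2)[of j] \<kappa>'(2)[OF n'[of j], of j] by linarith
    note D = posterior_dominated[of prior C1 ?B c \<kappa> n x, OF meas bounds c(1) \<kappa>(1) B n' sd[OF n'] mass]
    interpret prob_space ?P by (rule D(1))
    note mo = flat_posterior_moments[OF n'[of i] sd[OF n'[of i], of i]]
    let ?h = "\<lambda>z. (fst z $ i, snd z $ i)"
    have dom: "(\<integral>\<^sup>+z. ennreal (g (?h z)) \<partial>?P) \<le> ennreal K * (\<integral>\<^sup>+t. ennreal (g t) \<partial>?F)"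
      if "g \<in> borel_measurable borel" for g
    proof -
      have "(\<integral>\<^sup>+z. ennreal (g (?h z)) \<partial>?P) \<le> ennreal (C1 / c * (1 / \<kappa>) ^ CARD('k)) * (\<integral>\<^sup>+t. ennreal (g t) \<partial>?F)"
        using that by (intro D(3)[of "\<lambda>t. ennreal (g t)"]) simp
      also have "\<dots> \<le> ennreal K * (\<integral>\<^sup>+t. ennreal (g t) \<partial>?F)"
        by (intro mult_right_mono ennreal_leI) (simp_all add: K_def)
      finally show ?thesis .
    qed
    have sets_P: "sets ?P = sets borel" by (simp add: posterior_def)
    have gh: "(\<lambda>z. g (?h z)) \<in> borel_measurable ?P" if "g \<in> borel_measurable borel" for g :: "real \<times> real \<Rightarrow> real"
      unfolding measurable_cong_sets[OF sets_P refl] by (rule measurable_compose[OF measurable_param_coord that])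
    have fs[measurable]: "fst \<in> borel_measurable (borel :: (real \<times> real) measure)" "snd \<in> borel_measurable (borel :: (real \<times> real) measure)"
      by (intro borel_measurable_continuous_onI continuous_intros)+
    have aeP: "AE z in ?P. 0 < snd z $ i" using D(2) by eventually_elim simp
    have aeF: "AE t in ?F. 0 < snd t" by (rule mo(2))
    have E: "integrable ?P (\<lambda>z. g (?h z)) \<and> expectation (\<lambda>z. g (?h z)) \<le> K * s"
      if g: "g \<in> borel_measurable borel" "has_bochner_integral ?F g s" "\<And>t. 0 < snd t \<Longrightarrow> 0 \<le> g t" for g s
    proof -
      have aF: "AE t in ?F. 0 \<le> g t" using aeF by eventually_elim (rule g(3))
      have aP: "AE z in ?P. 0 \<le> g (?h z)" using aeP by eventually_elim (rule g(3), simp)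
      show ?thesis
        using dominated_expectation[where g=g and h="?h" and K=K and F="?F" and b=s,
          OF dom[OF g(1)] less_imp_le[OF K] g(2) aF gh[OF g(1)] aP] by blast
    qed
    have var_i: "integrable ?P (\<lambda>z. snd z $ i)" and var_le: "expectation (\<lambda>z. snd z $ i) \<le> K * R1 i (n i)"
      using E[OF fs(2) mo(3)] by (simp_all add: R1_def)
    have inv_m: "(\<lambda>t. 1 / snd t) \<in> borel_measurable (borel :: (real \<times> real) measure)" by measurable
    have inv_i: "integrable ?P (\<lambda>z. 1 / snd z $ i)" and inv_le: "expectation (\<lambda>z. 1 / snd z $ i) \<le> K * R2 i (n i)"
      using E[OF inv_m mo(4)] by (simp_all add: R2_def)
    have sq_m: "(\<lambda>t. (fst t - sample_mean (n i) (x i))\<^sup>2) \<in> borel_measurable (borel :: (real \<times> real) measure)" by measurable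
    have sq_i: "integrable ?P (\<lambda>z. (fst z $ i - sample_mean (n i) (x i))\<^sup>2)"
      and sq_le: "expectation (\<lambda>z. (fst z $ i - sample_mean (n i) (x i))\<^sup>2) \<le> K * (R1 i (n i) / n i)"
      using E[OF sq_m mo(5)] by (simp_all add: R1_def mult.commute)
    show "var_hat prior n x i \<le> K * b"
    proof -
      have "K * R1 i (n i) \<le> K * b" using K b(2)[of i "n i"] by (intro mult_left_mono) auto
      then show ?thesis using var_le D(5)[of i] by linarith
    qed
    show "1 / (K * b) \<le> var_hat prior n x i"
    proof -
      \<comment> \<open>The tangent bound \<open>2 * d - d\<^sup>2 / t \<le> t\<close> plays the
        role of the Jensen inequality for the reciprocal, and this \<open>d\<close> makes the lower
        bound \<open>2 * d - d = d\<close>.\<close>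
      define d where "d = 1 / (K * b)"
      define r where "r z = 1 / snd z $ i" for z :: "'k params"
      have r_i: "integrable ?P r" and r_le: "expectation r \<le> K * R2 i (n i)"
        using inv_i inv_le by (simp_all add: r_def[abs_def])
      have Kb: "0 < K * b" using K b by simp
      have "AE z in ?P. 2 * d - d\<^sup>2 * r z \<le> snd z $ i"
        using aeP
      proof eventually_elim
        case (elim z)
        then show ?case using variance_deviation_nonneg[of "snd z $ i" d] unfolding r_def by linarith
      qed
      then have "expectation (\<lambda>z. 2 * d - d\<^sup>2 * r z) \<le> expectation (\<lambda>z. snd z $ i)"
        using var_i r_i by (intro integral_mono_AE) auto
      moreover have "expectation (\<lambda>z. 2 * d - d\<^sup>2 * r z) = 2 * d - d\<^sup>2 * expectation r"
        using r_i prob_space by (subst Bochner_Integration.integral_diff) auto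
      moreover have "d\<^sup>2 * expectation r \<le> d\<^sup>2 * (K * b)"
      proof (intro mult_left_mono)
        have "K * R2 i (n i) \<le> K * b" using K b(3)[of i "n i"] by (intro mult_left_mono) auto
        then show "expectation r \<le> K * b" using r_le by linarith
      qed simp
      moreover have "d\<^sup>2 * (K * b) = d" using Kb by (simp add: d_def power2_eq_square)
      ultimately show ?thesis using D(5)[of i] unfolding d_def[symmetric] by linarith
    qed
    show "\<bar>mean_hat prior n x i - sample_mean (n i) (x i)\<bar> \<le> sqrt (K * b) / sqrt (n i)"
    proof -
      have "K * (R1 i (n i) / n i) \<le> K * b / n i"
        using K b(2)[of i "n i"] by (simp add: divide_right_mono mult_left_mono)
      then have "expectation (\<lambda>z. (fst z $ i - sample_mean (n i) (x i))\<^sup>2) \<le> K * b / n i" using sq_le by linarith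
      from mean_error_le[OF gh[of fst, simplified] sq_i this] show ?thesis
        unfolding D(4) real_sqrt_divide by simp
    qed
    \<comment> \<open>\<open>\<eta>\<close> is a cutoff: a deviation \<open>d > \<eta>\<close> has
      \<open>t \<le> v i + d \<le> (v i / \<eta> + 1) * d\<close>, so it is at most
      \<open>v i / \<eta> + 1\<close> times \<open>d\<^sup>2 / t\<close>.\<close>
    show "\<bar>var_hat prior n x i - v i\<bar> \<le> \<eta> + (v i / \<eta> + 1) * (K * q i (n i))" if \<eta>: "0 < \<eta>" for \<eta>
    proof -
      let ?g = "\<lambda>t. snd t - 2 * v i + (v i)\<^sup>2 * (1 / snd t)"
      have g_m: "?g \<in> borel_measurable (borel :: (real \<times> real) measure)" by measurable
      have g_i: "integrable ?P (\<lambda>z. ?g (?h z))" and g_le: "expectation (\<lambda>z. ?g (?h z)) \<le> K * q i (n i)"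
        using E[OF g_m flat_posterior_variance_deviation[OF n'[of i] sd[OF n'[of i], of i]] variance_deviation_nonneg]
        unfolding q_def R1_def R2_def by blast+
      have pw: "AE z in ?P. \<bar>snd z $ i - v i\<bar> \<le> \<eta> + (v i / \<eta> + 1) * ?g (?h z)"
        using aeP
      proof eventually_elim
        case (elim z)
        define t where "t = snd z $ i"
        have t: "0 < t" using elim by (simp add: t_def)
        have g: "?g (?h z) = (t - v i)\<^sup>2 / t" using t by (simp add: t_def power2_eq_square field_simps)
        have nn: "0 \<le> (v i / \<eta> + 1) * ((t - v i)\<^sup>2 / t)" using v[of i] \<eta> t by simp
        have "\<bar>t - v i\<bar> \<le> \<eta> + (v i / \<eta> + 1) * ((t - v i)\<^sup>2 / t)"
        proof (cases "\<bar>t - v i\<bar> \<le> \<eta>")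
          case True
          then show ?thesis using nn by linarith
        next
          case False
          define d where "d = \<bar>t - v i\<bar>"
          have d: "\<eta> < d" using False by (simp add: d_def)
          have "t \<le> v i + d" by (simp add: d_def)
          also have "v i = v i / \<eta> * \<eta>" using \<eta> by simp
          also have "v i / \<eta> * \<eta> \<le> v i / \<eta> * d" using d v[of i] \<eta> by (intro mult_left_mono) auto
          finally have "t \<le> (v i / \<eta> + 1) * d" by (simp add: algebra_simps)
          then have "t * d \<le> (v i / \<eta> + 1) * d * d" using d \<eta> by (intro mult_right_mono) auto
          then have "d \<le> (v i / \<eta> + 1) * d * d / t" using t by (simp add: pos_le_divide_eq mult.commute)
          also have "\<dots> = (v i / \<eta> + 1) * ((t - v i)\<^sup>2 / t)" by (simp add: d_def power2_eq_square mult.assoc flip: abs_mult)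
          finally show ?thesis using \<eta> by (simp add: d_def)
        qed
        then show ?case unfolding g by (simp add: t_def)
      qed
      define G where "G z = ?g (?h z)" for z :: "'k params"
      have G_i: "integrable ?P G" and G_le: "expectation G \<le> K * q i (n i)"
        using g_i g_le by (simp_all add: G_def[abs_def])
      have "\<bar>expectation (\<lambda>z. snd z $ i) - v i\<bar> = \<bar>expectation (\<lambda>z. snd z $ i - v i)\<bar>"
        using var_i prob_space by simp
      also have "\<dots> \<le> expectation (\<lambda>z. \<bar>snd z $ i - v i\<bar>)" by (rule integral_abs_bound)
      also have "\<dots> \<le> expectation (\<lambda>z. \<eta> + (v i / \<eta> + 1) * G z)"
        using pw var_i G_i unfolding G_def[symmetric]
        by (intro integral_mono_AE) auto
      also have "\<dots> = \<eta> + (v i / \<eta> + 1) * expectation G"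
        using G_i prob_space by (subst Bochner_Integration.integral_add) auto
      also have "\<dots> \<le> \<eta> + (v i / \<eta> + 1) * (K * q i (n i))"
        using G_le v[of i] \<eta> by (intro add_left_mono mult_left_mono) auto
      finally show ?thesis unfolding D(5) .
    qed
  qed
  show "\<exists>lo hi C. 0 < lo \<and> (\<forall>n i. (\<forall>j. 6 \<le> n j) \<longrightarrow>
      lo \<le> var_hat prior n x i \<and> var_hat prior n x i \<le> hi \<and>
      \<bar>mean_hat prior n x i - sample_mean (n i) (x i)\<bar> \<le> C / sqrt (n i))"
    using est(1-3) K b(1) by (intro exI[of _ "1 / (K * b)"] exI[of _ "K * b"] exI[of _ "sqrt (K * b)"]) auto
  show "\<exists>n1. \<forall>n. (\<forall>j. 6 \<le> n j) \<and> n1 \<le> n i \<longrightarrow> \<bar>var_hat prior n x i - v i\<bar> \<le> \<epsilon>" if \<epsilon>: "0 < \<epsilon>" for \<epsilon> i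
  proof -
    let ?e = "\<lambda>m. \<epsilon> / 2 + (v i / (\<epsilon> / 2) + 1) * (K * q i m)"
    have "?e \<longlonglongrightarrow> \<epsilon> / 2 + (v i / (\<epsilon> / 2) + 1) * (K * 0)" by (intro tendsto_intros q_lim) 
    then have "\<forall>\<^sub>F m in sequentially. ?e m < \<epsilon>" by (rule order_tendstoD) (use \<epsilon> in simp)
    then obtain n1 where n1: "\<And>m. n1 \<le> m \<Longrightarrow> ?e m < \<epsilon>" by (auto simp: eventually_sequentially)
    have "\<bar>var_hat prior n x i - v i\<bar> \<le> \<epsilon>" if "\<forall>j. 6 \<le> n j" "n1 \<le> n i" for n
      using est(4)[OF that(1), of "\<epsilon> / 2" i] n1[OF that(2)] \<epsilon> by linarith
    then show ?thesis by blast
  qed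
qed

section \<open>The theorem\<close>

lemma num_samples_Suc: "num_samples n0 I (Suc m) i = num_samples n0 I m i + (if I (Suc m) = i then 1 else 0)"
proof -
  have "{t \<in> {1..Suc m}. I t = i} = (if I (Suc m) = i then insert (Suc m) {t \<in> {1..m}. I t = i} else {t \<in> {1..m}. I t = i})"
    by (auto simp: le_Suc_eq)
  then show ?thesis by (simp add: num_samples_def)
qed

lemma sample_mean_excess: "real k * (sample_mean k y - m) = (\<Sum>l<k. y l - m)"
  by (cases "k = 0") (simp_all add: sample_mean_def sum_subtractf right_diff_distrib)

text \<open>All randomness is confined to the hypotheses on one path. The argument is deterministic,
  and the constants \<open>lo\<close>, \<open>hi\<close>, \<open>C\<close>, \<open>D\<close> and
  \<open>Q\<close> are taken from that path.\<close>

lemma pathwise_convergence: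
  fixes \<mu> v :: "'k::finite \<Rightarrow> real" and x :: "'k \<Rightarrow> nat \<Rightarrow> real" and I B :: "nat \<Rightarrow> 'k" and rank :: "'k \<Rightarrow> nat"
  assumes card: "2 \<le> CARD('k)" and v: "\<And>i. 0 < v i" and best: "\<And>i. i \<noteq> b \<Longrightarrow> \<mu> i < \<mu> b"
    and prior: "admissible_prior \<mu> v prior" and n0: "6 \<le> n0"
    and run: "OCBA_U_run prior n0 x I B" and opt: "unique_optimal_allocation \<mu> v b astar"
    and x: "\<And>i. x i 0 \<noteq> x i 1"
    and mean: "\<And>i. (\<lambda>n. sample_mean n (x i)) \<longlonglongrightarrow> \<mu> i"
    and dev: "\<And>i. (\<lambda>n. sample_dev n (x i) / n) \<longlonglongrightarrow> v i"
    and rank: "inj rank" "\<And>i. rank i < R"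
    and excursions: "\<And>L::nat. \<exists>K0. \<forall>K\<ge>K0. \<exists>\<^sub>\<infinity>N. \<forall>i. \<forall>k\<in>{N..L * N}.
        real K ^ Suc (rank i) * sqrt N \<le> k * (sample_mean k (x i) - \<mu> i) \<and>
        k * (sample_mean k (x i) - \<mu> i) \<le> 2 * real K ^ Suc (rank i) * sqrt N"
    and gaps: "\<And>i j. i \<noteq> b \<Longrightarrow> j \<noteq> b \<Longrightarrow>
      (\<lambda>m. W_hat prior n0 x I B m i - W_hat prior n0 x I B m j) \<longlonglongrightarrow> 0"
  shows "(\<lambda>m. alloc_hat n0 I m i) \<longlonglongrightarrow> astar i"
proof -
  define n where "n = num_samples n0 I"
  define mh where "mh m = mean_hat prior (n m) x" for m
  define vh where "vh m = var_hat prior (n m) x" for m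
  define a where "a = alloc_hat n0 I"
  define A where "A m = {i. \<forall>j. mh m j \<le> mh m i}" for m
  have n6: "6 \<le> n m i" for m i using n0 by (simp add: n_def num_samples_def)
  then have n1: "1 \<le> n m i" for m i by (meson le_trans one_le_numeral)
  have n_Suc: "n (Suc m) i = n m i + (if I (Suc m) = i then 1 else 0)" for m i
    unfolding n_def by (rule num_samples_Suc)
  define T where "T m = real (\<Sum>j\<in>UNIV. n m j)" for m
  have T: "0 < T m" for m
  proof -
    have "n m b \<le> (\<Sum>j\<in>UNIV. n m j)" by (intro member_le_sum) auto
    then show ?thesis using n1[of m b] by (simp add: T_def del: of_nat_sum)
  qed
  have a_eq: "a m i = real (n m i) / T m" for m i by (simp add: a_def alloc_hat_def n_def T_def)
  have step: "B m \<in> A m" "\<forall>i\<in>A m. n m (B m) \<le> n m i"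
    "if card (A m) \<noteq> 1 then I (Suc m) = B m
     else if (\<Sum>i\<in>UNIV - {B m}. rate_Ustar (mh m) (vh m) (a m) (B m) i / rate_U (mh m) (vh m) (a m) (B m) i) > 1
     then I (Suc m) = B m
     else I (Suc m) \<noteq> B m \<and> (\<forall>i. i \<noteq> B m \<longrightarrow> rate_V (mh m) (vh m) (a m) (B m) (I (Suc m)) \<le> rate_V (mh m) (vh m) (a m) (B m) i)"
    for m
    using run unfolding OCBA_U_run_def Let_def n_def[symmetric] mh_def[symmetric] vh_def[symmetric] a_def[symmetric] A_def[symmetric]
    by blast+
  have B_max: "mh m i \<le> mh m (B m)" for m i using step(1)[of m] by (simp add: A_def)
  obtain lo hi C where lo: "0 < lo" and est: "\<And>n i. (\<forall>j. 6 \<le> n j) \<Longrightarrow>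
      lo \<le> var_hat prior n x i \<and> var_hat prior n x i \<le> hi \<and>
      \<bar>mean_hat prior n x i - sample_mean (n i) (x i)\<bar> \<le> C / sqrt (n i)"
    using posterior_estimates(1)[OF prior v x mean dev] by blast
  have vh: "lo \<le> vh m i" "vh m i \<le> hi" and approx: "\<bar>mh m i - sample_mean (n m i) (x i)\<bar> \<le> C / sqrt (n m i)" for m i
    using est[of "n m" i] n6 by (auto simp: vh_def mh_def)
  have "\<exists>d. \<forall>k. \<bar>sample_mean k (x i)\<bar> \<le> d" for i
    using convergent_imp_Bseq[OF convergentI[OF mean[of i]]] by (auto simp: Bseq_def)
  then obtain d where d: "\<And>i k. \<bar>sample_mean k (x i)\<bar> \<le> d i" by metis
  \<comment> \<open>Convergent sample means are bounded, and the estimation error is at most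
    \<open>\<bar>C\<bar>\<close> because every design has at least one sample.\<close>
  define D where "D = Max (range d) + \<bar>C\<bar>"
  have D: "\<bar>mh m i\<bar> \<le> D" for m i
  proof -
    have "C / sqrt (n m i) \<le> \<bar>C\<bar> / sqrt (n m i)" by (intro divide_right_mono) auto
    also have "\<dots> \<le> \<bar>C\<bar> / 1" using n1[of m i] by (intro divide_left_mono) auto
    finally have "C / sqrt (n m i) \<le> \<bar>C\<bar>" by simp
    moreover have "d i \<le> Max (range d)" by simp
    ultimately show ?thesis using approx[of m i] d[of "n m i" i] unfolding D_def by linarith
  qed
  define H where "H = hi + 4 * D\<^sup>2"
  define Q where "Q = max 1 (max (nat \<lceil>(H / lo) ^ 3 * CARD('k)\<rceil>) (nat \<lceil>4 * H * (2 * D\<^sup>2 / lo)\<rceil>))"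
  have Q: "(H / lo) ^ 3 * CARD('k) \<le> Q" "4 * H * (2 * D\<^sup>2 / lo) \<le> Q" "1 \<le> Q"
  proof -
    have ceil: "r \<le> real Q" if "nat \<lceil>r\<rceil> \<le> Q" for r
      using real_nat_ceiling_ge[of r] that by linarith
    have "nat \<lceil>(H / lo) ^ 3 * CARD('k)\<rceil> \<le> Q"
      unfolding Q_def by (rule max.coboundedI2, rule max.cobounded1)
    then show "(H / lo) ^ 3 * CARD('k) \<le> Q" by (rule ceil)
    have "nat \<lceil>4 * H * (2 * D\<^sup>2 / lo)\<rceil> \<le> Q"
      unfolding Q_def by (rule max.coboundedI2, rule max.cobounded2)
    then show "4 * H * (2 * D\<^sup>2 / lo) \<le> Q" by (rule ceil)
    show "1 \<le> Q" by (simp add: Q_def)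
  qed
  note sampling = ocba_step_sampling[OF lo vh D H_def n1 T a_eq Q A_def step]
  have n_lim: "filterlim (\<lambda>m. n m i) at_top sequentially" for i
  proof (rule all_designs_sampled_infinitely_often[where mh=mh and xbar="\<lambda>i k. sample_mean k (x i)" and rank=rank and Q=Q])
    show "n (Suc m) i = n m i + (if I (Suc m) = i then 1 else 0)" for m i by (rule n_Suc)
    show "1 \<le> n m i" for m i by (rule n1)
    show "mh m i \<le> mh m (B m)" for m i by (rule B_max)
    show "\<exists>i. i \<noteq> B m \<and> n m (B m) \<le> Q * n m i" if "I (Suc m) = B m" for m by (rule sampling(1)[OF that])
    show "n m i \<le> Q * n m (B m)" if "I (Suc m) \<noteq> B m" "i \<noteq> B m" for m i by (rule sampling(2)[OF that])
    show "min (n m (I (Suc m))) (n m (B m)) * (mh m (B m) - mh m (I (Suc m)))\<^sup>2 \<le> Q * n m i"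
      if "I (Suc m) \<noteq> B m" "i \<noteq> B m" for m i by (rule sampling(3)[OF that])
    show "\<bar>mh m i - sample_mean (n m i) (x i)\<bar> \<le> C / sqrt (n m i)" for m i by (rule approx)
  qed (use mean rank excursions in auto)
  have mh_lim: "(\<lambda>m. mh m i) \<longlonglongrightarrow> \<mu> i" for i
  proof -
    have "(\<lambda>k. C / sqrt (real k)) \<longlonglongrightarrow> 0"
      by (intro tendsto_divide_0[OF tendsto_const] filterlim_at_top_imp_at_infinity
          filterlim_compose[OF sqrt_at_top filterlim_real_sequentially])
    from filterlim_compose[OF this n_lim[of i]] have "(\<lambda>m. mh m i - sample_mean (n m i) (x i)) \<longlonglongrightarrow> 0"
      by (rule Lim_null_comparison[rotated]) (simp add: approx)
    from tendsto_add[OF this filterlim_compose[OF mean[of i] n_lim[of i]]] show ?thesis by simp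
  qed
  have vh_lim: "(\<lambda>m. vh m i) \<longlonglongrightarrow> v i" for i
  proof (rule LIMSEQ_I)
    fix r :: real assume r: "0 < r"
    then have "0 < r / 2" by simp
    from posterior_estimates(2)[OF prior v x mean dev this, of i]
    obtain n2 where n2: "\<And>n. (\<forall>j. 6 \<le> n j) \<and> n2 \<le> n i \<Longrightarrow> \<bar>var_hat prior n x i - v i\<bar> \<le> r / 2" by blast
    have "\<forall>\<^sub>F m in sequentially. n2 \<le> n m i" using n_lim[of i] by (auto simp: filterlim_at_top)
    then have "\<forall>\<^sub>F m in sequentially. norm (vh m i - v i) < r"
    proof eventually_elim
      case (elim m)
      then show ?case using n2[of "n m"] n6 r by (force simp: vh_def)
    qed
    then show "\<exists>no. \<forall>m\<ge>no. norm (vh m i - v i) < r" by (simp add: eventually_sequentially)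
  qed
  have "\<forall>\<^sub>F m in sequentially. \<forall>i\<in>UNIV. i \<noteq> b \<longrightarrow> mh m i < mh m b"
  proof (intro eventually_ball_finite ballI)
    fix i
    show "\<forall>\<^sub>F m in sequentially. i \<noteq> b \<longrightarrow> mh m i < mh m b"
    proof (cases "i = b")
      case False
      have "(\<lambda>m. mh m b - mh m i) \<longlonglongrightarrow> \<mu> b - \<mu> i" by (intro tendsto_diff mh_lim)
      then have "\<forall>\<^sub>F m in sequentially. 0 < mh m b - mh m i"
        by (rule order_tendstoD) (use best[OF False] in simp)
      then show ?thesis by eventually_elim simp
    qed simp
  qed simp
  \<comment> \<open>Consistency separates the estimated best design from the rest, so from some time
    on there are no ties at the top and \<open>B m\<close> is \<open>b\<close>.\<close>
  then have B_ev: "\<forall>\<^sub>F m in sequentially. B m = b \<and> A m = {b}"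
  proof eventually_elim
    case (elim m)
    have "B m = b" using B_max[of m b] elim by (force simp: not_le[symmetric])
    moreover have "i \<notin> A m" if "i \<noteq> b" for i using elim that by (auto simp: A_def not_le)
    ultimately show ?case using step(1)[of m] by auto
  qed
  let ?G = "\<lambda>m. \<Sum>i\<in>UNIV - {b}. rate_Ustar (mh m) (vh m) (a m) b i / rate_U (mh m) (vh m) (a m) b i"
  have step_ev: "\<forall>\<^sub>F m in sequentially. I (Suc m) = b \<longleftrightarrow> ?G m > 1"
    using B_ev
  proof eventually_elim
    case (elim m)
    then show ?case using step(3)[of m] by (auto split: if_splits)
  qed
  have gaps': "(\<lambda>m. rate_W (mh m) (vh m) (a m) b i - rate_W (mh m) (vh m) (a m) b j) \<longlonglongrightarrow> 0"
    if "i \<noteq> b" "j \<noteq> b" for i j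
  proof (rule Lim_transform_eventually[OF gaps[OF that]])
    show "\<forall>\<^sub>F m in sequentially. W_hat prior n0 x I B m i - W_hat prior n0 x I B m j
        = rate_W (mh m) (vh m) (a m) b i - rate_W (mh m) (vh m) (a m) b j"
      using B_ev by eventually_elim (simp add: W_hat_def Let_def n_def mh_def vh_def a_def)
  qed
  have a_fun: "a m = (\<lambda>i. real (n m i) / real (\<Sum>j\<in>UNIV. n m j))" for m
    by (rule ext) (simp add: a_eq T_def)
  show ?thesis
    using allocation_converges[OF card v best mh_lim vh_lim n_Suc n1 step_ev[unfolded a_fun] gaps'[unfolded a_fun] opt, of i]
    by (simp add: a_fun a_def[symmetric])
qed

section \<open>Almost sure properties of normal samples\<close>

lemma normal_centered:
  assumes "prob_space P" "distributed P lborel X (normal_density m (sqrt s))" "0 < s"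
  shows "distributed P lborel (\<lambda>\<omega>. X \<omega> - m) (normal_density 0 (sqrt s))"
  using prob_space.normal_density_affine[OF assms(1,2), of 1 "- m"] assms(3) by simp

text \<open>The value depends on the standard deviation only, so it bounds the fourth moments of all
  observations of a design at once, and likewise those of their centred squares.\<close>

lemma (in prob_space) normal_polynomial_moment:
  fixes p :: "real poly"
  assumes Y: "distributed M lborel Y (normal_density 0 s)" and s: "0 < s"
  shows "integrable M (\<lambda>\<omega>. poly p (Y \<omega>))"
    and "expectation (\<lambda>\<omega>. poly p (Y \<omega>)) = (\<integral>t. normal_density 0 s t * poly p t \<partial>lborel)"
proof -
  have m: "poly p \<in> borel_measurable lborel" by (simp add: borel_measurable_continuous_onI continuous_on_poly)
  have "integrable lborel (\<lambda>t. normal_density 0 s t * poly p t)"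
    unfolding poly_altdef sum_distrib_left
    using integrable_normal_moment[OF s, of 0]
    by (intro Bochner_Integration.integrable_sum) (auto simp: mult.left_commute)
  then show "integrable M (\<lambda>\<omega>. poly p (Y \<omega>))" using distributed_integrable[OF Y m] by simp
  show "expectation (\<lambda>\<omega>. poly p (Y \<omega>)) = (\<integral>t. normal_density 0 s t * poly p t \<partial>lborel)"
    using distributed_integral[OF Y m] by simp
qed

context prob_space
begin

text \<open>Both limits are instances of \<open>strong_law_fourth_moment\<close>, for the
  observations and for their centred squares. The last claim holds because the difference of two
  independent normal variables has no atoms; it makes \<open>sample_dev\<close> positive from the
  second sample on.\<close>

lemma normal_sample_laws:
  fixes Y :: "'k::finite \<times> nat \<Rightarrow> 'a \<Rightarrow> real" and v :: "'k \<Rightarrow> real"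
  assumes ind: "indep_vars (\<lambda>_. borel) Y UNIV"
    and normal: "\<And>i l. distributed M lborel (Y (i, l)) (normal_density 0 (sqrt (v i)))"
    and v: "\<And>i. 0 < v i"
  shows "AE \<omega> in M. (\<lambda>n. (\<Sum>l<n. Y (i, l) \<omega>) / n) \<longlonglongrightarrow> 0"
    and "AE \<omega> in M. (\<lambda>n. (\<Sum>l<n. (Y (i, l) \<omega>)\<^sup>2 - v i) / n) \<longlonglongrightarrow> 0"
    and "AE \<omega> in M. Y (i, 0) \<omega> \<noteq> Y (i, 1) \<omega>"
proof -
  have s: "0 < sqrt (v i)" using v by simp
  have poly: "integrable M (\<lambda>\<omega>. poly p (Y (i, l) \<omega>))"
    "expectation (\<lambda>\<omega>. poly p (Y (i, l) \<omega>)) = (\<integral>t. normal_density 0 (sqrt (v i)) t * poly p t \<partial>lborel)" for p l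
    by (rule normal_polynomial_moment[OF normal s])+
  have indi: "indep_vars (\<lambda>_. borel) (\<lambda>l. Y (i, l)) UNIV"
    using indep_vars_reindex[OF ind, of "Pair i"] by (simp add: inj_on_def)
  have mean: "expectation (Y (i, l)) = 0" for l by (rule normal_distributed_expectation[OF s normal])
  show "AE \<omega> in M. (\<lambda>n. (\<Sum>l<n. Y (i, l) \<omega>) / n) \<longlonglongrightarrow> 0"
  proof (rule strong_law_fourth_moment[OF indi _ mean])
    show "integrable M (\<lambda>\<omega>. Y (i, l) \<omega> ^ 4)" for l using poly(1)[of "monom 1 4" l] by (simp add: poly_monom)
    show "expectation (\<lambda>\<omega>. Y (i, l) \<omega> ^ 4) \<le> (\<integral>t. normal_density 0 (sqrt (v i)) t * poly (monom 1 4) t \<partial>lborel)" for l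
      using poly(2)[of "monom 1 4" l] by (simp add: poly_monom)
  qed
  let ?p = "[:- v i, 0, 1:]"
  have p: "poly ?p t = t\<^sup>2 - v i" for t by (simp add: power2_eq_square algebra_simps)
  have p4: "poly (?p ^ 4) t = (t\<^sup>2 - v i) ^ 4" for t by (simp only: poly_power p)
  show "AE \<omega> in M. (\<lambda>n. (\<Sum>l<n. (Y (i, l) \<omega>)\<^sup>2 - v i) / n) \<longlonglongrightarrow> 0"
  proof (rule strong_law_fourth_moment)
    show "indep_vars (\<lambda>_. borel) (\<lambda>l \<omega>. (Y (i, l) \<omega>)\<^sup>2 - v i) UNIV"
      by (rule indep_vars_compose2[OF indi, where Y="\<lambda>_ t. t\<^sup>2 - v i"]) measurable
    show "expectation (\<lambda>\<omega>. (Y (i, l) \<omega>)\<^sup>2 - v i) = 0" for l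
      using normal_distributed_variance[OF s normal, of l] poly(1)[of "monom 1 2" l] v[of i] prob_space
      by (simp add: mean poly_monom less_imp_le)
    show "integrable M (\<lambda>\<omega>. ((Y (i, l) \<omega>)\<^sup>2 - v i) ^ 4)" for l
      using poly(1)[of "?p ^ 4" l] unfolding p4 .
    show "expectation (\<lambda>\<omega>. ((Y (i, l) \<omega>)\<^sup>2 - v i) ^ 4) \<le> (\<integral>t. normal_density 0 (sqrt (v i)) t * poly (?p ^ 4) t \<partial>lborel)" for l
      using poly(2)[of "?p ^ 4" l] unfolding p4 by simp
  qed
  have rv[measurable]: "Y (i, l) \<in> borel_measurable M" for l using distributed_measurable[OF normal[of i l]] by simp
  have "indep_var borel (Y (i, 0)) borel (\<lambda>\<omega>. \<Sum>l\<in>{1}. Y (i, l) \<omega>)"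
    by (rule indep_vars_sum[of "{1}" 0 "\<lambda>l. Y (i, l)"]) (auto intro: indep_vars_subset[OF indi])
  then have "indep_var borel (Y (i, 0)) borel (Y (i, 1))" by simp
  from diff_indep_normal[OF this s s normal normal]
  have D: "distributed M lborel (\<lambda>\<omega>. Y (i, 0) \<omega> - Y (i, 1) \<omega>) (normal_density (0 - 0) (sqrt ((sqrt (v i))\<^sup>2 + (sqrt (v i))\<^sup>2)))" .
  have "emeasure M ((\<lambda>\<omega>. Y (i, 0) \<omega> - Y (i, 1) \<omega>) -` {0} \<inter> space M)
      = (\<integral>\<^sup>+t. ennreal (normal_density (0 - 0) (sqrt ((sqrt (v i))\<^sup>2 + (sqrt (v i))\<^sup>2)) t) * indicator {0} t \<partial>lborel)"
    by (rule distributed_emeasure[OF D]) simp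
  also have "\<dots> = (\<integral>\<^sup>+(t :: real). 0 \<partial>lborel)"
    by (rule nn_integral_cong_AE) (use AE_lborel_singleton[of "0::real"] in \<open>auto elim!: eventually_mono\<close>)
  finally have "emeasure M ((\<lambda>\<omega>. Y (i, 0) \<omega> - Y (i, 1) \<omega>) -` {0} \<inter> space M) = 0" by simp
  then show "AE \<omega> in M. Y (i, 0) \<omega> \<noteq> Y (i, 1) \<omega>"
    by (intro AE_I[of _ _ "(\<lambda>\<omega>. Y (i, 0) \<omega> - Y (i, 1) \<omega>) -` {0} \<inter> space M"]) auto
qed

text \<open>The constants that determine \<open>L\<close> and \<open>K\<close> come from the path,
  so the exceptional set must not depend on them. Both are natural numbers, so it is a countable
  union of null sets.\<close>

lemma normal_sample_excursions:
  fixes Y :: "'k::finite \<times> nat \<Rightarrow> 'a \<Rightarrow> real" and rank :: "'k \<Rightarrow> nat" and v :: "'k \<Rightarrow> real"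
  assumes ind: "indep_vars (\<lambda>_. borel) Y UNIV"
    and normal: "\<And>i l. distributed M lborel (Y (i, l)) (normal_density 0 (sqrt (v i)))"
    and v: "\<And>i. 0 < v i"
  shows "AE \<omega> in M. \<forall>L::nat. \<exists>K0. \<forall>K\<ge>K0. \<exists>\<^sub>\<infinity>N. \<forall>i. \<forall>k\<in>{N..L * N}.
      real K ^ Suc (rank i) * sqrt N \<le> (\<Sum>l<k. Y (i, l) \<omega>) \<and>
      (\<Sum>l<k. Y (i, l) \<omega>) \<le> 2 * real K ^ Suc (rank i) * sqrt N"
proof -
  let ?E = "\<lambda>L K \<omega>. \<exists>\<^sub>\<infinity>N. \<forall>i. \<forall>k\<in>{N..L * N}.
      real K ^ Suc (rank i) * sqrt N \<le> (\<Sum>l<k. Y (i, l) \<omega>) \<and>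
      (\<Sum>l<k. Y (i, l) \<omega>) \<le> 2 * real K ^ Suc (rank i) * sqrt N"
  \<comment> \<open>\<open>c L\<close> is so large that
    \<open>200 * L * v i \<le> K \<le> (K ^ Suc (rank i))\<^sup>2\<close> for all designs; the added
    1 gives \<open>K \<ge> 1\<close>.\<close>
  define c where "c L = nat \<lceil>200 * real L * (\<Sum>i\<in>UNIV. v i)\<rceil> + 1" for L :: nat
  have ex: "AE \<omega> in M. ?E L K \<omega>" if L: "1 \<le> L" and K: "c L \<le> K" for L K
  proof (rule excursions_infinitely_often[OF ind normal v normal_sample_laws(1)[OF ind normal v] L])
    fix i
    have K1: "1 \<le> real K" using K by (simp add: c_def)
    then show "1 \<le> real K ^ Suc (rank i)" by (rule one_le_power)
    have "200 * L * v i \<le> 200 * L * (\<Sum>i\<in>UNIV. v i)"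
      using v by (intro mult_left_mono member_le_sum) (auto intro: less_imp_le)
    also have "\<dots> \<le> K" using K by (simp add: c_def) linarith
    also have "\<dots> \<le> (real K ^ Suc (rank i)) ^ 2"
      unfolding power_mult[symmetric] using K1 by (intro self_le_power) auto
    finally show "200 * L * v i \<le> (real K ^ Suc (rank i)) ^ 2" .
  qed
  have "AE \<omega> in M. \<forall>L K. 1 \<le> L \<longrightarrow> c L \<le> K \<longrightarrow> ?E L K \<omega>"
    unfolding AE_all_countable using ex by auto
  then show ?thesis
  proof eventually_elim
    case (elim \<omega>)
    show ?case
    proof
      fix L :: nat
      \<comment> \<open>\<open>L = 0\<close> is served by the larger window of
        \<open>max 1 L\<close>.\<close>
      have "?E L K \<omega>" if K: "c (max 1 L) \<le> K" for K
      proof -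
        have "?E (max 1 L) K \<omega>" using elim K by auto
        then show ?thesis
        proof (rule INFM_mono)
          fix N assume *: "\<forall>i. \<forall>k\<in>{N..max 1 L * N}. real K ^ Suc (rank i) * sqrt N \<le> (\<Sum>l<k. Y (i, l) \<omega>) \<and>
              (\<Sum>l<k. Y (i, l) \<omega>) \<le> 2 * real K ^ Suc (rank i) * sqrt N"
          have "{N..L * N} \<subseteq> {N..max 1 L * N}" by (intro atLeastatMost_subset_iff[THEN iffD2] disjI2 conjI mult_le_mono1) auto
          then show "\<forall>i. \<forall>k\<in>{N..L * N}. real K ^ Suc (rank i) * sqrt N \<le> (\<Sum>l<k. Y (i, l) \<omega>) \<and>
              (\<Sum>l<k. Y (i, l) \<omega>) \<le> 2 * real K ^ Suc (rank i) * sqrt N" using * by blast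
        qed
      qed
      then show "\<exists>K0. \<forall>K\<ge>K0. ?E L K \<omega>" by blast
    qed
  qed
qed

end

lemma sample_limits:
  assumes "(\<lambda>n. (\<Sum>l<n. y l - m) / n) \<longlonglongrightarrow> 0" "(\<lambda>n. (\<Sum>l<n. (y l - m)\<^sup>2 - s) / n) \<longlonglongrightarrow> 0"
  shows "(\<lambda>n. sample_mean n y) \<longlonglongrightarrow> m" and "(\<lambda>n. sample_dev n y / n) \<longlonglongrightarrow> s"
proof -
  have "(\<lambda>n. (\<Sum>l<n. y l - m) / n + m) \<longlonglongrightarrow> 0 + m" by (intro tendsto_add assms tendsto_const)
  moreover have "\<forall>\<^sub>F n in sequentially. (\<Sum>l<n. y l - m) / n + m = sample_mean n y"
    using eventually_gt_at_top[of 0]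
  proof eventually_elim
    case (elim n)
    then show ?case unfolding sample_mean_excess[symmetric] by simp
  qed
  ultimately have "(\<lambda>n. sample_mean n y) \<longlonglongrightarrow> 0 + m" by (rule Lim_transform_eventually)
  then show mean: "(\<lambda>n. sample_mean n y) \<longlonglongrightarrow> m" by simp
  have "(\<lambda>n. (\<Sum>l<n. (y l - m)\<^sup>2 - s) / n + s - (m - sample_mean n y)\<^sup>2) \<longlonglongrightarrow> 0 + s - (m - m)\<^sup>2"
    by (intro tendsto_intros assms mean)
  moreover have "\<forall>\<^sub>F n in sequentially. (\<Sum>l<n. (y l - m)\<^sup>2 - s) / n + s - (m - sample_mean n y)\<^sup>2 = sample_dev n y / n"
    using eventually_gt_at_top[of 0]
  proof eventually_elim
    case (elim n)
    then have "(\<Sum>l<n. (y l - m)\<^sup>2 - s) = sample_dev n y + n * (m - sample_mean n y)\<^sup>2 - n * s"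
      using sum_squared_deviation[of n y m] by (simp add: sum_subtractf)
    then show ?case using elim by (simp add: add_divide_distrib diff_divide_distrib)
  qed
  ultimately have "(\<lambda>n. sample_dev n y / n) \<longlonglongrightarrow> 0 + s - (m - m)\<^sup>2" by (rule Lim_transform_eventually)
  then show "(\<lambda>n. sample_dev n y / n) \<longlonglongrightarrow> s" by simp
qed

theorem theorem3:
  fixes P :: "'w measure"
    and \<mu> v :: "'k::finite \<Rightarrow> real"
    and istar :: 'k
    and X :: "'k \<Rightarrow> nat \<Rightarrow> 'w \<Rightarrow> real"
    and prior :: "'k params \<Rightarrow> real"
    and n0 :: nat
    and I B :: "nat \<Rightarrow> 'w \<Rightarrow> 'k"
    and astar :: "'k \<Rightarrow> real"
  assumes "CARD('k) \<ge> 2"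
    and "\<And>i. v i > 0"
    and "\<And>i. i \<noteq> istar \<Longrightarrow> \<mu> i < \<mu> istar"
    and "prob_space P"
    and "\<And>i l. distributed P lborel (X i l) (normal_density (\<mu> i) (sqrt (v i)))"
    and "prob_space.indep_vars P (\<lambda>_. borel) (\<lambda>(i, l). X i l) UNIV"
    and "admissible_prior \<mu> v prior"
    and "n0 \<ge> 6"
    and "\<And>\<omega>. \<omega> \<in> space P \<Longrightarrow>
           OCBA_U_run prior n0 (\<lambda>i l. X i l \<omega>) (\<lambda>m. I m \<omega>) (\<lambda>m. B m \<omega>)"
    and "unique_optimal_allocation \<mu> v istar astar"
  shows "AE \<omega> in P. \<exists>ebar>0. \<forall>\<epsilon>. 0 < \<epsilon> \<and> \<epsilon> < ebar \<longrightarrow>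
           (\<forall>M. (\<forall>m\<ge>M. \<forall>i j. i \<noteq> istar \<and> j \<noteq> istar \<longrightarrow>
                    \<bar>W_hat prior n0 (\<lambda>i l. X i l \<omega>) (\<lambda>m. I m \<omega>) (\<lambda>m. B m \<omega>) m i -
                     W_hat prior n0 (\<lambda>i l. X i l \<omega>) (\<lambda>m. I m \<omega>) (\<lambda>m. B m \<omega>) m j\<bar> \<le> \<epsilon>)
                \<longrightarrow> (\<exists>M'\<ge>M. \<forall>m\<ge>M'. \<forall>i. \<bar>alloc_hat n0 (\<lambda>m. I m \<omega>) m i - astar i\<bar> \<le> \<epsilon>))"
proof -
  interpret prob_space P by fact
  define Y where "Y p \<omega> = (case p of (i, l) \<Rightarrow> X i l \<omega> - \<mu> i)" for p \<omega>
  have Y: "Y (i, l) = (\<lambda>\<omega>. X i l \<omega> - \<mu> i)" for i l by (simp add: Y_def fun_eq_iff)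
  have normal: "distributed P lborel (Y (i, l)) (normal_density 0 (sqrt (v i)))" for i l
    unfolding Y by (rule normal_centered[OF assms(4,5,2)])
  have "indep_vars (\<lambda>_. borel) (\<lambda>p \<omega>. (\<lambda>p t. t - \<mu> (fst p)) p ((\<lambda>(i, l). X i l) p \<omega>)) UNIV"
    by (rule indep_vars_compose2[OF assms(6)]) measurable
  also have "(\<lambda>p \<omega>. (\<lambda>p t. t - \<mu> (fst p)) p ((\<lambda>(i, l). X i l) p \<omega>)) = Y"
    by (auto simp: Y_def fun_eq_iff split: prod.splits)
  finally have ind: "indep_vars (\<lambda>_. borel) Y UNIV" .
  note laws = normal_sample_laws[OF ind normal assms(2)]
  \<comment> \<open>An enumeration of the designs gives each of them its own excursion
    amplitude.\<close>
  obtain rank :: "'k \<Rightarrow> nat" where rank: "bij_betw rank UNIV {0..<CARD('k)}"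
    using ex_bij_betw_finite_nat[of "UNIV :: 'k set"] by auto
  have rank_inj: "inj rank" and rank_less: "rank i < CARD('k)" for i
    using rank bij_betwE[OF rank] by (auto simp: bij_betw_def)
  have "AE \<omega> in P. \<forall>i\<in>UNIV. (\<lambda>n. (\<Sum>l<n. Y (i, l) \<omega>) / n) \<longlonglongrightarrow> 0" by (intro AE_finite_allI laws) simp
  moreover have "AE \<omega> in P. \<forall>i\<in>UNIV. (\<lambda>n. (\<Sum>l<n. (Y (i, l) \<omega>)\<^sup>2 - v i) / n) \<longlonglongrightarrow> 0" by (intro AE_finite_allI laws) simp
  moreover have "AE \<omega> in P. \<forall>i\<in>UNIV. Y (i, 0) \<omega> \<noteq> Y (i, 1) \<omega>" by (intro AE_finite_allI laws) simp
  moreover note normal_sample_excursions[OF ind normal assms(2), of rank] AE_space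
  ultimately show ?thesis
  proof eventually_elim
    case (elim \<omega>)
    let ?x = "\<lambda>i l. X i l \<omega>"
    let ?W = "W_hat prior n0 ?x (\<lambda>m. I m \<omega>) (\<lambda>m. B m \<omega>)" and ?a = "alloc_hat n0 (\<lambda>m. I m \<omega>)"
    have lims: "(\<lambda>n. sample_mean n (?x i)) \<longlonglongrightarrow> \<mu> i" "(\<lambda>n. sample_dev n (?x i) / n) \<longlonglongrightarrow> v i" for i
      using sample_limits[of "?x i" "\<mu> i" "v i"] elim(1,2) by (auto simp: Y)
    have distinct: "?x i 0 \<noteq> ?x i 1" for i using elim(3) by (auto simp: Y)
    \<comment> \<open>If the gaps vanish, convergence gives every accuracy and
      \<open>ebar = 1\<close> will do. Otherwise some gap returns to a size of at least
      \<open>r\<close>, and \<open>ebar = r\<close> serves.\<close>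
    show ?case
    proof (cases "\<forall>i j. i \<noteq> istar \<longrightarrow> j \<noteq> istar \<longrightarrow> (\<lambda>m. ?W m i - ?W m j) \<longlonglongrightarrow> 0")
      case True
      have "(\<lambda>m. ?a m i) \<longlonglongrightarrow> astar i" for i
        by (rule pathwise_convergence[where x="?x" and rank=rank and \<mu>=\<mu> and v=v, OF assms(1,2,3,7,8) assms(9)[OF elim(5)] assms(10) distinct lims rank_inj rank_less])
          (use elim(4) True in \<open>auto simp: sample_mean_excess Y\<close>)
      note a_lim = this
      have conv: "\<forall>\<^sub>F m in sequentially. \<forall>i\<in>UNIV. \<bar>?a m i - astar i\<bar> \<le> \<epsilon>" if "0 < \<epsilon>" for \<epsilon>
      proof (intro eventually_ball_finite ballI)
        fix i
        show "\<forall>\<^sub>F m in sequentially. \<bar>?a m i - astar i\<bar> \<le> \<epsilon>"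
          using tendstoD[OF a_lim[of i] that] by eventually_elim (simp add: dist_real_def)
      qed simp
      show ?thesis
      proof (rule exI[of _ 1], intro conjI allI impI)
        fix \<epsilon> :: real and M assume \<epsilon>: "0 < \<epsilon> \<and> \<epsilon> < 1"
        obtain M1 where "\<And>m i. m \<ge> M1 \<Longrightarrow> \<bar>?a m i - astar i\<bar> \<le> \<epsilon>"
          using conv[of \<epsilon>] \<epsilon> by (auto simp: eventually_sequentially)
        then show "\<exists>M'\<ge>M. \<forall>m\<ge>M'. \<forall>i. \<bar>?a m i - astar i\<bar> \<le> \<epsilon>" by (intro exI[of _ "max M M1"]) auto
      qed simp
    next
      case False
      then obtain i j where ij: "i \<noteq> istar" "j \<noteq> istar" and "\<not> (\<lambda>m. ?W m i - ?W m j) \<longlonglongrightarrow> 0" by auto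
      then obtain r where r: "0 < r" and far: "\<And>M. \<exists>m\<ge>M. r \<le> \<bar>?W m i - ?W m j\<bar>"
        by (auto simp: LIMSEQ_iff not_less)
      have "\<not> (\<forall>m\<ge>M. \<forall>i j. i \<noteq> istar \<and> j \<noteq> istar \<longrightarrow> \<bar>?W m i - ?W m j\<bar> \<le> \<epsilon>)" if "\<epsilon> < r" for \<epsilon> M
        using far[of M] ij that by (meson leD order_trans le_less_trans)
      then show ?thesis using r by blast
    qed
  qed
qed

end
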